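(* Let $\kappa>1$ and let $h,\gamma>0$. For $\lambda>0$ let $U_\lambda(x)=\lambda x^2/2$ on $\mathbb R$, and let $$M_\lambda=\begin{pmatrix}1-uA\lambda & D/\gamma \\ -D\lambda/\gamma & \beta\end{pmatrix},\qquad u=\frac1{\gamma^2},\quad \beta=e^{-\gamma h},\quad D=1-\beta,\quad A=\gamma h+\beta-1 .$$ If $M_\kappa$ is not Schur stable, then the left-endpoint exponential integrator (with step size $h$ and friction $\gamma$) for $U_\kappa$ has no invariant probability law. If $M_\kappa$ is Schur stable, then $M_\lambda$ is Schur stable for every $\lambda\in[1,\kappa]$, and $$\rho(M_1)\ge1-\frac{64}{\kappa}.$$ In this case, the chain for $U_1$ has a unique invariant law $\pi_1$. Let $P$ denote the transition kernel of the chain for $U_1$. For every initial state $y\in\mathbb R^2$, $$\limsup_{n\to\infty}\|\delta_yP^n-\pi_1\|_{\mathrm{TV}}^{1/n}\le\rho(M_1),$$ and the limit exists and equals $\rho(M_1)$ for a suitable $y$. Moreover, there are initial states $y,\widetilde y\in\mathbb R^2$ such that $$\lim_{n\to\infty}\|\delta_yP^n-\delta_{\widetilde y}P^n\|_{\mathrm{TV}}^{1/n}=\rho(M_1)\ge1-\frac{64}{\kappa}.$$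
   Context: Left-endpoint exponential integrator for a differentiable potential $U:\mathbb R^d\to\mathbb R$ with step size $h>0$ and friction $\gamma>0$, $\beta=e^{-\gamma h}$: the Markov chain $(X_k,V_k)$ on $\mathbb R^d\times\mathbb R^d$ given by $$X_{k+1}=X_k+\frac{1-\beta}{\gamma}V_k-\frac{\gamma h+\beta-1}{\gamma^2}\nabla U(X_k)+\zeta^X_{k+1},\qquad V_{k+1}=\beta V_k-\frac{1-\beta}{\gamma}\nabla U(X_k)+\zeta^V_{k+1},$$ where the noise pairs are independent over $k$ and $$\begin{pmatrix} \zeta^X_{k+1} \\ \zeta^V_{k+1} \end{pmatrix}=\sqrt{2\gamma}\int_0^h\begin{pmatrix} (1-e^{-\gamma(h-t)})/\gamma \\ {} e^{-\gamma(h-t)} \end{pmatrix}dW_{k,t},$$ with independent standard $d$-dimensional Brownian motions $W_{k,\cdot}$. $\rho(\cdot)$ is the spectral radius; a matrix is Schur stable if its spectral radius is strictly less than one. $\|\nu-\widetilde\nu\|_{\mathrm{TV}}=\sup_A|\nu(A)-\widetilde\nu(A)|$; $\delta_y$ is the Dirac mass at $y$. *)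

theory Defs
  imports "HOL-Probability.Probability" "Jordan_Normal_Form.Spectral_Radius"
begin

section \<open>Brownian motion and the Wiener integral\<close>

definition brownian_motion :: "'w measure \<Rightarrow> (real \<Rightarrow> 'w \<Rightarrow> real) \<Rightarrow> bool" where
  "brownian_motion M W \<longleftrightarrow>
     (\<forall>t\<ge>0. W t \<in> borel_measurable M) \<and>
     (AE \<omega> in M. W 0 \<omega> = 0) \<and>
     (\<forall>s t. 0 \<le> s \<longrightarrow> s < t \<longrightarrow>
        distributed M lborel (\<lambda>\<omega>. W t \<omega> - W s \<omega>) (normal_density 0 (sqrt (t - s)))) \<and>
     (\<forall>n. \<forall>t :: nat \<Rightarrow> real. 0 \<le> t 0 \<longrightarrow> (\<forall>i<n. t i \<le> t (Suc i)) \<longrightarrow>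
        prob_space.indep_vars M (\<lambda>_. borel) (\<lambda>i \<omega>. W (t (Suc i)) \<omega> - W (t i) \<omega>) {..<n}) \<and>
     (AE \<omega> in M. continuous_on {0..} (\<lambda>t. W t \<omega>))"

definition step_fun :: "nat \<Rightarrow> (nat \<Rightarrow> real) \<Rightarrow> (nat \<Rightarrow> 'b) \<Rightarrow> real \<Rightarrow> 'b::real_normed_vector" where
  "step_fun m t c s = (\<Sum>i<m. indicator {t i<..t (Suc i)} s *\<^sub>R c i)"

definition step_integral ::
  "(real \<Rightarrow> 'w \<Rightarrow> real) \<Rightarrow> nat \<Rightarrow> (nat \<Rightarrow> real) \<Rightarrow> (nat \<Rightarrow> 'b) \<Rightarrow> 'w \<Rightarrow> 'b::real_normed_vector" where
  "step_integral W m t c \<omega> = (\<Sum>i<m. (W (t (Suc i)) \<omega> - W (t i) \<omega>) *\<^sub>R c i)"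

text \<open>\<open>Z\<close> is a version of the integral over \<open>[0, h]\<close> of the deterministic, vector-valued
  integrand \<open>f\<close> against the scalar Brownian motion \<open>W\<close>: a mean-square limit of integrals of step
  functions that converge to \<open>f\<close> in \<open>L\<^sup>2\<close>.  Both errors are nonnegative (extended) integrals, so
  convergence to zero is not affected by the default value of the Bochner integral.\<close>

definition has_wiener_integral ::
  "'w measure \<Rightarrow> (real \<Rightarrow> 'w \<Rightarrow> real) \<Rightarrow> real \<Rightarrow> (real \<Rightarrow> 'b) \<Rightarrow> ('w \<Rightarrow> 'b::euclidean_space) \<Rightarrow> bool" where
  "has_wiener_integral M W h f Z \<longleftrightarrow>
     Z \<in> borel_measurable M \<and>
     (\<exists>(m :: nat \<Rightarrow> nat) (t :: nat \<Rightarrow> nat \<Rightarrow> real) (c :: nat \<Rightarrow> nat \<Rightarrow> 'b).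
        (\<forall>n. t n 0 = 0 \<and> t n (m n) = h \<and> (\<forall>i<m n. t n i \<le> t n (Suc i))) \<and>
        (\<lambda>n. \<integral>\<^sup>+s\<in>{0..h}. ennreal ((norm (f s - step_fun (m n) (t n) (c n) s))\<^sup>2) \<partial>lborel)
           \<longlonglongrightarrow> 0 \<and>
        (\<lambda>n. \<integral>\<^sup>+\<omega>. ennreal ((norm (Z \<omega> - step_integral W (m n) (t n) (c n) \<omega>))\<^sup>2) \<partial>M)
           \<longlonglongrightarrow> 0)"


section \<open>The left-endpoint exponential integrator\<close>

text \<open>The noise pair \<open>\<zeta> (k + 1)\<close> is driven by \<open>W k\<close>; \<open>\<zeta> 0\<close> plays no role.\<close>

locale left_endpoint_noise = prob_space M
  for M :: "'w measure" and h \<gamma> :: real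
    and W :: "nat \<Rightarrow> real \<Rightarrow> 'w \<Rightarrow> real" and \<zeta> :: "nat \<Rightarrow> 'w \<Rightarrow> real \<times> real" +
  assumes brownian: "\<And>k. brownian_motion M (W k)"
    and independent: "indep_vars (\<lambda>_. Pi\<^sub>M {0..} (\<lambda>_. borel)) (\<lambda>k \<omega>. \<lambda>t\<in>{0..}. W k t \<omega>) UNIV"
    and noise: "\<And>k. \<exists>Z. has_wiener_integral M (W k) h
          (\<lambda>t. ((1 - exp (- \<gamma> * (h - t))) / \<gamma>, exp (- \<gamma> * (h - t)))) Z \<and>
        \<zeta> (Suc k) = (\<lambda>\<omega>. sqrt (2 * \<gamma>) *\<^sub>R Z \<omega>)"

text \<open>In dimension one the gradient of the potential \<open>U\<close> is its derivative.\<close>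

definition integrator_step ::
  "real \<Rightarrow> real \<Rightarrow> (real \<Rightarrow> real) \<Rightarrow> real \<times> real \<Rightarrow> real \<times> real \<Rightarrow> real \<times> real" where
  "integrator_step h \<gamma> U = (\<lambda>(x, v) (zx, zv). let \<beta> = exp (- \<gamma> * h) in
     (x + (1 - \<beta>) / \<gamma> * v - (\<gamma> * h + \<beta> - 1) / \<gamma>\<^sup>2 * deriv U x + zx,
      \<beta> * v - (1 - \<beta>) / \<gamma> * deriv U x + zv))"

primrec integrator_chain ::
  "real \<Rightarrow> real \<Rightarrow> (real \<Rightarrow> real) \<Rightarrow> (nat \<Rightarrow> 'w \<Rightarrow> real \<times> real) \<Rightarrow> real \<times> real
     \<Rightarrow> nat \<Rightarrow> 'w \<Rightarrow> real \<times> real" where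
  "integrator_chain h \<gamma> U \<zeta> y 0 = (\<lambda>\<omega>. y)"
| "integrator_chain h \<gamma> U \<zeta> y (Suc k) =
     (\<lambda>\<omega>. integrator_step h \<gamma> U (integrator_chain h \<gamma> U \<zeta> y k \<omega>) (\<zeta> (Suc k) \<omega>))"

text \<open>The noise is independent and identically distributed over time, so the law of the first step
  from a deterministic state is the (time-homogeneous) transition kernel of the chain.\<close>

definition integrator_kernel ::
  "'w measure \<Rightarrow> real \<Rightarrow> real \<Rightarrow> (nat \<Rightarrow> 'w \<Rightarrow> real \<times> real) \<Rightarrow> (real \<Rightarrow> real)
     \<Rightarrow> real \<times> real \<Rightarrow> (real \<times> real) measure" where
  "integrator_kernel M h \<gamma> \<zeta> U y = distr M borel (integrator_chain h \<gamma> U \<zeta> y 1)"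

definition quadratic_potential :: "real \<Rightarrow> real \<Rightarrow> real" where
  "quadratic_potential l x = l * x\<^sup>2 / 2"


section \<open>Markov kernels and total variation\<close>

primrec kernel_iterate :: "('a \<Rightarrow> 'a measure) \<Rightarrow> 'a measure \<Rightarrow> nat \<Rightarrow> 'a measure" where
  "kernel_iterate P \<mu> 0 = \<mu>"
| "kernel_iterate P \<mu> (Suc n) = kernel_iterate P \<mu> n \<bind> P"

definition iterate_from :: "('a::topological_space \<Rightarrow> 'a measure) \<Rightarrow> 'a \<Rightarrow> nat \<Rightarrow> 'a measure" where
  "iterate_from P y n = kernel_iterate P (return borel y) n"

definition invariant_law :: "('a::topological_space \<Rightarrow> 'a measure) \<Rightarrow> 'a measure \<Rightarrow> bool" where
  "invariant_law P \<pi> \<longleftrightarrow> prob_space \<pi> \<and> sets \<pi> = sets borel \<and> \<pi> \<bind> P = \<pi>"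

definition tv_dist :: "'a measure \<Rightarrow> 'a measure \<Rightarrow> real" where
  "tv_dist \<mu> \<nu> = (SUP A\<in>sets \<mu>. \<bar>measure \<mu> A - measure \<nu> A\<bar>)"


section \<open>The drift matrix\<close>

definition integrator_matrix :: "real \<Rightarrow> real \<Rightarrow> real \<Rightarrow> real mat" where
  "integrator_matrix h \<gamma> l =
     (let u = 1 / \<gamma>\<^sup>2; \<beta> = exp (- \<gamma> * h); D = 1 - \<beta>; A = \<gamma> * h + \<beta> - 1
      in mat_of_rows_list 2 [[1 - u * A * l, D / \<gamma>], [- D * l / \<gamma>, \<beta>]])"

definition real_spectral_radius :: "real mat \<Rightarrow> real" where
  "real_spectral_radius B = spectral_radius (map_mat complex_of_real B)"

definition schur_stable :: "real mat \<Rightarrow> bool" where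
  "schur_stable B \<longleftrightarrow> real_spectral_radius B < 1"

end

theory Submission
  imports Defs
begin

text \<open>For a quadratic potential the chain is a linear autoregression \<open>X \<mapsto> L X + z\<close> in the plane, where
  \<open>L\<close> is the drift matrix and \<open>z\<close> is Gaussian noise.  Everything is decided by the powers of \<open>L\<close>.

  \<^bold>\<open>The noise.\<close>  Every projection of the Wiener integral is an \<open>L\<^sup>2\<close> limit of sums of independent
  normal increments, so its characteristic function is Gaussian (\<open>wiener_integral_iexp\<close>).  The two
  components of the integrand are linearly independent functions, so the covariance is positive
  definite; decorrelating the pair and using that a factorising joint characteristic function forces
  independence (\<open>pair_distr_eq_of_char_factorization\<close>) identifies the law of the noise as a triangular
  image of two independent standard normal variables (\<open>noise_law_planar_gaussian\<close>).

  \<^bold>\<open>No invariant law.\<close>  If \<open>\<phi>\<close> is the characteristic functional of an invariant law, then \<open>|\<phi>(\<xi>)|\<close> is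
  at most the product of the noise factors along the orbit of \<open>\<xi>\<close> under the transpose of \<open>L\<close>.  When an
  eigenvalue has modulus at least one, the orbits of the real and imaginary parts of a left
  eigenvector do not both shrink to \<open>0\<close>, so one of the two products tends to \<open>0\<close>, and \<open>\<phi>\<close> vanishes
  arbitrarily close to \<open>0\<close>, which contradicts \<open>\<phi>(0) = 1\<close> (\<open>no_invariant_law\<close>).

  \<^bold>\<open>Rates.\<close>  If \<open>L\<close> is stable, the law of \<open>\<Sum>k. L\<^sup>k z\<^sub>k\<close> is invariant.  Two chains with different starting
  points differ by the deterministic vector \<open>L\<^sup>n (y - y')\<close>, and the last noise variable alone makes
  the total variation distance at most a constant times its length (\<open>iterate_from_diff\<close>).  Conversely,
  testing with \<open>sin (\<xi> \<bullet> x)\<close> bounds the distance below by a multiple of \<open>|L\<^sup>n y|\<close>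
  (\<open>tv_dist_lower_eventually\<close>).  Since \<open>|L\<^sup>n y|\<close> is of order at most \<open>n \<rho>\<^sup>n\<close>, and of order at least \<open>\<rho>\<^sup>n\<close> for a
  suitable \<open>y\<close>, the exponential rate is the spectral radius \<open>\<rho>\<close> (\<open>stable_rates\<close>).

  \<^bold>\<open>The bound.\<close>  With \<open>x = \<gamma> h\<close> and \<open>\<beta> = exp (- x)\<close>, the stability conditions on trace and determinant are
  affine in \<open>\<lambda>\<close>, which gives monotonicity, and at \<open>\<lambda> = \<kappa>\<close> they force \<open>x / \<gamma>\<^sup>2 \<le> 16 / \<kappa>\<close>
  (\<open>stability_step_bound\<close>).  At \<open>\<lambda> = 1\<close> the eigenvalues satisfy \<open>(1 - z) (1 - w) = x (1 - \<beta>) / \<gamma>\<^sup>2\<close>;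
  for a real pair this puts one of them within \<open>2 x / \<gamma>\<^sup>2\<close> of \<open>1\<close>, and for a complex pair the
  negative discriminant gives \<open>1 - \<beta> < 4 x / \<gamma>\<^sup>2\<close> while \<open>\<rho> \<ge> \<beta>\<close> (\<open>spectral_radius_lower\<close>).\<close>

\<comment> \<open>the dot denotes the inner product of Euclidean spaces throughout\<close>
no_notation scalar_prod (infix "\<bullet>" 70)

section \<open>Characteristic functionals and total variation\<close>

definition charfun :: "'a::euclidean_space measure \<Rightarrow> 'a \<Rightarrow> complex" where
  "charfun \<mu> \<xi> = (CLINT x|\<mu>. iexp (\<xi> \<bullet> x))"

lemma integrable_iexp_inner:
  assumes "prob_space \<mu>" "sets \<mu> = sets borel" "f \<in> borel_measurable \<mu>"
  shows "complex_integrable \<mu> (\<lambda>x. iexp (f x))"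
  by (rule prob_space.integrable_iexp[OF assms(1)]) (use assms(3) in auto)

lemma charfun_tendsto_1:
  assumes "prob_space \<mu>" "sets \<mu> = sets borel" "\<xi> \<longlonglongrightarrow> 0"
  shows "(\<lambda>n. charfun \<mu> (\<xi> n)) \<longlonglongrightarrow> 1"
proof -
  interpret prob_space \<mu> by fact
  note [measurable_cong] = assms(2)
  have "(\<lambda>n. CLINT x|\<mu>. iexp (\<xi> n \<bullet> x)) \<longlonglongrightarrow> (CLINT x|\<mu>. 1)"
  proof (rule integral_dominated_convergence[where w="\<lambda>_. 1"])
    show "AE x in \<mu>. (\<lambda>n. iexp (\<xi> n \<bullet> x)) \<longlonglongrightarrow> 1"
    proof (intro AE_I2)
      fix x
      have "(\<lambda>n. iexp (\<xi> n \<bullet> x)) \<longlonglongrightarrow> iexp (0 \<bullet> x)"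
        by (intro tendsto_intros assms(3))
      then show "(\<lambda>n. iexp (\<xi> n \<bullet> x)) \<longlonglongrightarrow> 1" by simp
    qed
  qed (auto simp: norm_exp_i_times)
  then show ?thesis by (simp add: charfun_def prob_space)
qed

lemma norm_charfun_le_1:
  assumes "prob_space \<mu>" "sets \<mu> = sets borel"
  shows "norm (charfun \<mu> \<xi>) \<le> 1"
proof -
  interpret prob_space \<mu> by fact
  have "norm (charfun \<mu> \<xi>) \<le> (\<integral>x. norm (iexp (\<xi> \<bullet> x)) \<partial>\<mu>)"
    unfolding charfun_def by (rule integral_norm_bound)
  also have "\<dots> = 1" by (simp add: prob_space norm_exp_i_times)
  finally show ?thesis .
qed

lemma tv_dist_le:
  assumes "\<And>A. A \<in> sets \<mu> \<Longrightarrow> \<bar>measure \<mu> A - measure \<nu> A\<bar> \<le> c"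
  shows "tv_dist \<mu> \<nu> \<le> c"
  unfolding tv_dist_def by (rule cSUP_least) (use assms in auto)

lemma tv_dist_ge:
  assumes "prob_space \<mu>" "prob_space \<nu>" "A \<in> sets \<mu>"
  shows "\<bar>measure \<mu> A - measure \<nu> A\<bar> \<le> tv_dist \<mu> \<nu>"
proof -
  have "\<bar>measure \<mu> B - measure \<nu> B\<bar> \<le> 1" for B
    using prob_space.prob_le_1[OF assms(1), of B] prob_space.prob_le_1[OF assms(2), of B]
      measure_nonneg[of \<mu> B] measure_nonneg[of \<nu> B] by linarith
  then have "bdd_above ((\<lambda>A. \<bar>measure \<mu> A - measure \<nu> A\<bar>) ` sets \<mu>)"
    by (auto simp: bdd_above_def)
  then show ?thesis unfolding tv_dist_def using assms(3) by (rule cSUP_upper2) auto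
qed

text \<open>Fubini for the region under the graph of \<open>f\<close>: this layer-cake formula turns a bound that is uniform
  over sets into a bound on integrals.\<close>

lemma integral_eq_layers:
  fixes f :: "'a \<Rightarrow> real"
  assumes "prob_space \<mu>" and [measurable]: "f \<in> borel_measurable \<mu>" and "\<And>x. 0 \<le> f x" "\<And>x. f x \<le> 1"
  shows "(\<integral>x. f x \<partial>\<mu>) = (\<integral>t\<in>{0..1}. measure \<mu> {x \<in> space \<mu>. t < f x} \<partial>lborel)"
    and "set_integrable lborel {0..1} (\<lambda>t. measure \<mu> {x \<in> space \<mu>. t < f x})"
proof -
  interpret prob_space \<mu> by fact
  interpret P: pair_sigma_finite \<mu> lborel ..
  let ?g = "\<lambda>x t::real. indicator {0..1} t * indicator {..<f x} t :: real"
  have g: "(\<lambda>z. ?g (fst z) (snd z)) = (\<lambda>z. indicator {0..1} (snd z) * (if snd z < f (fst z) then 1 else 0))"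
    by (auto simp: indicator_def fun_eq_iff)
  have [measurable]: "case_prod ?g \<in> borel_measurable (\<mu> \<Otimes>\<^sub>M lborel)"
    unfolding case_prod_beta g by measurable
  have in1: "(\<integral>t. ?g x t \<partial>lborel) = f x" for x
  proof -
    have "(\<integral>t. ?g x t \<partial>lborel) = (\<integral>t. indicator {0..<f x} t \<partial>lborel)"
      using assms(4)[of x] by (intro Bochner_Integration.integral_cong) (auto simp: indicator_def)
    then show ?thesis using assms(3)[of x] by simp
  qed
  have in2: "(\<integral>x. ?g x t \<partial>\<mu>) = indicator {0..1} t *\<^sub>R measure \<mu> {x \<in> space \<mu>. t < f x}" for t
  proof -
    have "(\<integral>x. indicator {..<f x} t \<partial>\<mu>) = (\<integral>x. indicator {x \<in> space \<mu>. t < f x} x \<partial>\<mu>)"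
      by (intro Bochner_Integration.integral_cong) (auto simp: indicator_def)
    also have "\<dots> = measure \<mu> {x \<in> space \<mu>. t < f x}" by simp
    finally show ?thesis by (simp del: Bochner_Integration.integral_indicator)
  qed
  have "integrable (\<mu> \<Otimes>\<^sub>M lborel) (case_prod ?g)"
  proof (rule integrableI_bounded)
    have "(\<integral>\<^sup>+z. norm (case_prod ?g z) \<partial>(\<mu> \<Otimes>\<^sub>M lborel)) = (\<integral>\<^sup>+x. \<integral>\<^sup>+t. norm (?g x t) \<partial>lborel \<partial>\<mu>)"
      by (subst lborel.nn_integral_fst[symmetric]) auto
    also have "\<dots> \<le> (\<integral>\<^sup>+x. \<integral>\<^sup>+t. indicator {0..1::real} t \<partial>lborel \<partial>\<mu>)"
      by (intro nn_integral_mono) (auto simp: indicator_def)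
    also have "\<dots> < \<infinity>" by (simp add: emeasure_space_1)
    finally show "(\<integral>\<^sup>+z. norm (case_prod ?g z) \<partial>(\<mu> \<Otimes>\<^sub>M lborel)) < \<infinity>" .
  qed simp
  note i = this
  show "(\<integral>x. f x \<partial>\<mu>) = (\<integral>t\<in>{0..1}. measure \<mu> {x \<in> space \<mu>. t < f x} \<partial>lborel)"
    using P.Fubini_integral[OF i] by (simp only: in1 in2 set_lebesgue_integral_def)
  show "set_integrable lborel {0..1} (\<lambda>t. measure \<mu> {x \<in> space \<mu>. t < f x})"
    using P.integrable_snd[OF i] by (simp only: in2 set_integrable_def)
qed

text \<open>The factor \<open>2\<close> comes from rescaling \<open>f\<close> to values between \<open>0\<close> and \<open>1\<close>, where the layer-cake
  formula applies.\<close>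

lemma integral_diff_le_tv_dist:
  fixes f :: "'a \<Rightarrow> real"
  assumes \<mu>: "prob_space \<mu>" and \<nu>: "prob_space \<nu>" and eq: "sets \<mu> = sets \<nu>"
    and [measurable]: "f \<in> borel_measurable \<mu>" and f: "\<And>x. \<bar>f x\<bar> \<le> 1"
  shows "(\<integral>x. f x \<partial>\<mu>) - (\<integral>x. f x \<partial>\<nu>) \<le> 2 * tv_dist \<mu> \<nu>"
proof -
  interpret M: prob_space \<mu> by fact
  interpret N: prob_space \<nu> by fact
  define g where "g x = (f x + 1) / 2" for x
  have fN: "f \<in> borel_measurable \<nu>"
    using assms(4) by (simp add: measurable_cong_sets[OF eq])
  have iM: "integrable \<mu> f" and iN: "integrable \<nu> f"
    using fN f by (auto intro!: M.integrable_const_bound[where B=1] N.integrable_const_bound[where B=1])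
  have g0: "0 \<le> g x" "g x \<le> 1" for x using f[of x] by (auto simp: g_def)
  have gM: "g \<in> borel_measurable \<mu>" "g \<in> borel_measurable \<nu>"
    unfolding g_def using fN by auto
  note lM = integral_eq_layers[OF \<mu> gM(1) g0] and lN = integral_eq_layers[OF \<nu> gM(2) g0]
  have "(\<integral>x. g x \<partial>\<mu>) - (\<integral>x. g x \<partial>\<nu>) =
     (\<integral>t\<in>{0..1}. (measure \<mu> {x \<in> space \<mu>. t < g x} - measure \<nu> {x \<in> space \<nu>. t < g x}) \<partial>lborel)"
    unfolding lM(1) lN(1) using lM(2) lN(2) by (subst set_integral_diff) auto
  also have "\<dots> \<le> (\<integral>t\<in>{0..1::real}. tv_dist \<mu> \<nu> \<partial>lborel)"
  proof (intro set_integral_mono set_integral_diff lM(2) lN(2))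
    fix t :: real
    have "{x \<in> space \<mu>. t < g x} \<in> sets \<mu>" using gM by measurable
    from tv_dist_ge[OF \<mu> \<nu> this]
    show "measure \<mu> {x \<in> space \<mu>. t < g x} - measure \<nu> {x \<in> space \<nu>. t < g x} \<le> tv_dist \<mu> \<nu>"
      using sets_eq_imp_space_eq[OF eq] by auto
  qed (auto simp: set_integrable_def)
  also have "\<dots> = tv_dist \<mu> \<nu>" by (simp add: set_lebesgue_integral_def)
  finally have "(\<integral>x. g x \<partial>\<mu>) - (\<integral>x. g x \<partial>\<nu>) \<le> tv_dist \<mu> \<nu>" .
  moreover have "(\<integral>x. g x \<partial>\<mu>) = ((\<integral>x. f x \<partial>\<mu>) + 1) / 2" "(\<integral>x. g x \<partial>\<nu>) = ((\<integral>x. f x \<partial>\<nu>) + 1) / 2"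
    unfolding g_def using iM iN by (simp_all add: M.prob_space N.prob_space)
  ultimately show ?thesis by argo
qed

lemma Im_charfun_diff_le_tv_dist:
  assumes \<mu>: "prob_space \<mu>" "sets \<mu> = sets borel" and \<nu>: "prob_space \<nu>" "sets \<nu> = sets borel"
  shows "\<bar>Im (charfun \<mu> \<xi> - charfun \<nu> \<xi>)\<bar> \<le> 2 * tv_dist \<mu> \<nu>"
proof -
  note [measurable_cong] = assms(2,4)
  have im: "Im (charfun \<rho> \<xi>) = (\<integral>x. sin (\<xi> \<bullet> x) \<partial>\<rho>)" if "prob_space \<rho>" "sets \<rho> = sets borel" for \<rho>
  proof -
    note [measurable_cong] = that(2)
    have "Im (charfun \<rho> \<xi>) = (\<integral>x. Im (iexp (\<xi> \<bullet> x)) \<partial>\<rho>)" unfolding charfun_def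
      by (rule integral_Im[symmetric], rule integrable_iexp_inner[OF that]) measurable
    then show ?thesis by (simp add: Im_exp)
  qed
  have eq: "sets \<mu> = sets \<nu>" using assms by simp
  have "(\<integral>x. sin (\<xi> \<bullet> x) \<partial>\<mu>) - (\<integral>x. sin (\<xi> \<bullet> x) \<partial>\<nu>) \<le> 2 * tv_dist \<mu> \<nu>"
    by (rule integral_diff_le_tv_dist[OF \<mu>(1) \<nu>(1) eq]) auto
  moreover have "(\<integral>x. - sin (\<xi> \<bullet> x) \<partial>\<mu>) - (\<integral>x. - sin (\<xi> \<bullet> x) \<partial>\<nu>) \<le> 2 * tv_dist \<mu> \<nu>"
    by (rule integral_diff_le_tv_dist[OF \<mu>(1) \<nu>(1) eq]) auto
  ultimately show ?thesis using im[OF \<mu>] im[OF \<nu>] by auto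
qed

section \<open>Linear autoregressive chains\<close>

text \<open>The adjoint \<open>T\<close> is a parameter so that instances can supply the transposed matrix explicitly.\<close>

locale linear_chain =
  fixes L T :: "'a::euclidean_space \<Rightarrow> 'a" and \<nu> :: "'a measure"
  assumes linear_L: "linear L"
    and adj: "\<And>\<xi> x. \<xi> \<bullet> L x = T \<xi> \<bullet> x"
    and prob_noise: "prob_space \<nu>"
    and sets_noise [measurable_cong]: "sets \<nu> = sets borel"
begin

definition kern :: "'a \<Rightarrow> 'a measure" where
  "kern y = distr \<nu> borel (\<lambda>z. L y + z)"

lemma measurable_L [measurable]: "L \<in> borel_measurable borel"
  by (intro borel_measurable_continuous_onI linear_continuous_on linear_L)
    (use linear_L linear_conv_bounded_linear in blast)

lemma linear_L_pow: "linear (L ^^ n)"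
proof (induction n)
  case 0
  show ?case using linear_id by (simp add: id_def)
next
  case (Suc n)
  show ?case using linear_compose[OF Suc linear_L] by (simp add: comp_def)
qed

lemma measurable_L_pow [measurable]: "L ^^ n \<in> borel_measurable borel"
  by (intro borel_measurable_continuous_onI linear_continuous_on)
    (use linear_L_pow linear_conv_bounded_linear in blast)

lemma adj_pow: "\<xi> \<bullet> (L ^^ n) x = (T ^^ n) \<xi> \<bullet> x"
  by (induction n arbitrary: x) (simp_all add: adj funpow_swap1)

lemma adjoint_pow_scale: "(T ^^ n) (t *\<^sub>R \<xi>) = t *\<^sub>R (T ^^ n) \<xi>"
proof (rule vector_eq_ldot[THEN iffD1], rule allI)
  fix z
  show "z \<bullet> (T ^^ n) (t *\<^sub>R \<xi>) = z \<bullet> t *\<^sub>R (T ^^ n) \<xi>"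
    using adj_pow[of "t *\<^sub>R \<xi>" n z] adj_pow[of \<xi> n z] by (simp add: inner_commute)
qed

lemma prob_kern: "prob_space (kern y)"
  unfolding kern_def by (intro prob_space.prob_space_distr[OF prob_noise]) measurable

lemma sets_kern [simp, measurable_cong]: "sets (kern y) = sets borel"
  by (simp add: kern_def)

lemma measurable_kern [measurable]: "kern \<in> borel \<rightarrow>\<^sub>M subprob_algebra borel"
proof -
  have "\<nu> \<in> space (subprob_algebra borel)"
    using prob_noise sets_noise by (simp add: space_subprob_algebra prob_space_imp_subprob_space)
  then show ?thesis unfolding kern_def
    by (intro measurable_distr2[where M=borel] measurable_const) measurable
qed

text \<open>Writing one step as an image of a product measure makes Fubini available.\<close>

lemma bind_kern_eq_distr:
  assumes "prob_space \<mu>" "sets \<mu> = sets borel"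
  shows "\<mu> \<bind> kern = distr (\<mu> \<Otimes>\<^sub>M \<nu>) borel (\<lambda>(x, z). L x + z)"
proof (rule measure_eqI)
  interpret M: prob_space \<mu> by fact
  interpret N: prob_space \<nu> by (rule prob_noise)
  note [measurable_cong] = assms(2)
  have k: "kern \<in> \<mu> \<rightarrow>\<^sub>M subprob_algebra borel" by measurable
  show s: "sets (\<mu> \<bind> kern) = sets (distr (\<mu> \<Otimes>\<^sub>M \<nu>) borel (\<lambda>(x, z). L x + z))"
    by (simp add: sets_bind[OF sets_kern M.not_empty])
  fix A assume "A \<in> sets (\<mu> \<bind> kern)"
  then have A[measurable]: "A \<in> sets borel" using s by simp
  have sp: "space \<mu> = UNIV" "space \<nu> = UNIV"
    using assms(2) sets_noise by (auto dest: sets_eq_imp_space_eq)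
  have "emeasure (\<mu> \<bind> kern) A = (\<integral>\<^sup>+x. emeasure (kern x) A \<partial>\<mu>)"
    by (rule emeasure_bind[OF M.not_empty k A])
  also have "\<dots> = (\<integral>\<^sup>+x. emeasure \<nu> (Pair x -` ((\<lambda>(x, z). L x + z) -` A \<inter> space (\<mu> \<Otimes>\<^sub>M \<nu>))) \<partial>\<mu>)"
    by (intro nn_integral_cong)
       (auto simp: kern_def emeasure_distr space_pair_measure sp intro!: arg_cong[where f="emeasure \<nu>"])
  also have "\<dots> = emeasure (distr (\<mu> \<Otimes>\<^sub>M \<nu>) borel (\<lambda>(x, z). L x + z)) A"
    by (subst emeasure_distr, measurable, subst N.emeasure_pair_measure_alt) auto
  finally show "emeasure (\<mu> \<bind> kern) A = emeasure (distr (\<mu> \<Otimes>\<^sub>M \<nu>) borel (\<lambda>(x, z). L x + z)) A" .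
qed

lemma prob_bind_kern:
  assumes "prob_space \<mu>" "sets \<mu> = sets borel"
  shows "prob_space (\<mu> \<bind> kern)" "sets (\<mu> \<bind> kern) = sets borel"
proof -
  interpret M: prob_space \<mu> by fact
  interpret N: prob_space \<nu> by (rule prob_noise)
  interpret P: pair_prob_space \<mu> \<nu> ..
  note [measurable_cong] = assms(2)
  show "prob_space (\<mu> \<bind> kern)" "sets (\<mu> \<bind> kern) = sets borel"
    unfolding bind_kern_eq_distr[OF assms] by (auto intro!: P.prob_space_distr)
qed

lemma charfun_bind_kern:
  assumes "prob_space \<mu>" "sets \<mu> = sets borel"
  shows "charfun (\<mu> \<bind> kern) \<xi> = charfun \<mu> (T \<xi>) * charfun \<nu> \<xi>"
proof -
  interpret M: prob_space \<mu> by fact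
  interpret N: prob_space \<nu> by (rule prob_noise)
  interpret P: pair_prob_space \<mu> \<nu> ..
  note [measurable_cong] = assms(2)
  have i: "complex_integrable (\<mu> \<Otimes>\<^sub>M \<nu>) (\<lambda>(x, z). iexp (T \<xi> \<bullet> x) * iexp (\<xi> \<bullet> z))"
    by (rule P.integrable_const_bound[where B=1]) (auto simp: norm_mult norm_exp_i_times)
  have "charfun (\<mu> \<bind> kern) \<xi> = (CLINT p|\<mu> \<Otimes>\<^sub>M \<nu>. iexp (\<xi> \<bullet> (case p of (x, z) \<Rightarrow> L x + z)))"
    unfolding bind_kern_eq_distr[OF assms] charfun_def by (rule integral_distr) measurable
  also have "\<dots> = (CLINT p|\<mu> \<Otimes>\<^sub>M \<nu>. (case p of (x, z) \<Rightarrow> iexp (T \<xi> \<bullet> x) * iexp (\<xi> \<bullet> z)))"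
    by (intro Bochner_Integration.integral_cong)
       (auto simp: inner_add_right adj exp_add[symmetric] algebra_simps)
  also have "\<dots> = (CLINT x|\<mu>. CLINT z|\<nu>. iexp (T \<xi> \<bullet> x) * iexp (\<xi> \<bullet> z))"
    using P.integral_fst'[OF i] by simp
  also have "\<dots> = charfun \<mu> (T \<xi>) * charfun \<nu> \<xi>"
    by (simp add: charfun_def)
  finally show ?thesis .
qed

lemma kernel_iterate_prob:
  assumes "prob_space \<mu>" "sets \<mu> = sets borel"
  shows "prob_space (kernel_iterate kern \<mu> n)" "sets (kernel_iterate kern \<mu> n) = sets borel"
  using assms by (induction n) (auto simp: prob_bind_kern)

text \<open>Each step contributes one independent noise factor and moves the argument by the adjoint.\<close>

lemma charfun_kernel_iterate:
  assumes "prob_space \<mu>" "sets \<mu> = sets borel"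
  shows "charfun (kernel_iterate kern \<mu> n) \<xi> = charfun \<mu> ((T ^^ n) \<xi>) * (\<Prod>k<n. charfun \<nu> ((T ^^ k) \<xi>))"
proof (induction n arbitrary: \<xi>)
  case (Suc n)
  have "charfun (kernel_iterate kern \<mu> (Suc n)) \<xi> =
     charfun \<mu> ((T ^^ Suc n) \<xi>) * ((\<Prod>k<n. charfun \<nu> ((T ^^ Suc k) \<xi>)) * charfun \<nu> \<xi>)"
    by (simp add: charfun_bind_kern kernel_iterate_prob assms Suc.IH funpow_swap1)
  also have "(\<Prod>k<n. charfun \<nu> ((T ^^ Suc k) \<xi>)) * charfun \<nu> \<xi> = (\<Prod>k<Suc n. charfun \<nu> ((T ^^ k) \<xi>))"
    by (subst prod.lessThan_Suc_shift) (simp add: mult.commute)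
  finally show ?case .
qed simp

lemma iterate_from_prob:
  "prob_space (iterate_from kern y n)" "sets (iterate_from kern y n) = sets borel"
  unfolding iterate_from_def by (auto intro!: kernel_iterate_prob prob_space_return)

lemma charfun_iterate_from:
  "charfun (iterate_from kern y n) \<xi> = iexp (\<xi> \<bullet> (L ^^ n) y) * (\<Prod>k<n. charfun \<nu> ((T ^^ k) \<xi>))"
proof -
  have "charfun (return borel y) \<eta> = iexp (\<eta> \<bullet> y)" for \<eta>
    unfolding charfun_def by (subst integral_return) auto
  then show ?thesis unfolding iterate_from_def
    by (subst charfun_kernel_iterate) (auto intro!: prob_space_return simp: adj_pow)
qed

lemma kernel_iterate_invariant:
  assumes "invariant_law kern \<pi>"
  shows "kernel_iterate kern \<pi> n = \<pi>"
  using assms by (induction n) (auto simp: invariant_law_def)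

text \<open>The noise enters additively, so the starting point only translates the law.\<close>

lemma iterate_from_shift:
  "iterate_from kern y n = distr (iterate_from kern 0 n) borel (\<lambda>m. (L ^^ n) y + m)"
proof (induction n)
  case 0
  show ?case by (simp add: iterate_from_def distr_return)
next
  case (Suc n)
  let ?K = "iterate_from kern 0 n"
  interpret K: prob_space ?K by (rule iterate_from_prob)
  note [measurable_cong] = iterate_from_prob(2)
  have kern_shift: "kern ((L ^^ n) y + m) = distr (kern m) borel (\<lambda>x. (L ^^ Suc n) y + x)" for m
    by (simp add: kern_def distr_distr comp_def linear_add[OF linear_L] add.assoc)
  have "iterate_from kern y (Suc n) = distr ?K borel (\<lambda>m. (L ^^ n) y + m) \<bind> kern"
    using Suc by (simp add: iterate_from_def)
  also have "\<dots> = ?K \<bind> (\<lambda>m. kern ((L ^^ n) y + m))"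
    by (rule bind_distr[where K=borel]) (auto simp: K.not_empty)
  also have "\<dots> = ?K \<bind> (\<lambda>m. distr (kern m) borel (\<lambda>x. (L ^^ Suc n) y + x))"
    by (simp only: kern_shift)
  also have "\<dots> = distr (?K \<bind> kern) borel (\<lambda>x. (L ^^ Suc n) y + x)"
    by (rule distr_bind[symmetric, where K=borel]) (auto simp: K.not_empty)
  finally show ?case by (simp add: iterate_from_def)
qed

lemma measurable_iterate_from [measurable]:
  "(\<lambda>y. iterate_from kern y n) \<in> borel \<rightarrow>\<^sub>M subprob_algebra borel"
proof (induction n)
  case 0
  show ?case by (simp add: iterate_from_def)
next
  case (Suc n)
  have "(\<lambda>y. iterate_from kern y n \<bind> kern) \<in> borel \<rightarrow>\<^sub>M subprob_algebra borel"
    by (rule measurable_bind2[OF Suc]) measurable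
  then show ?case by (simp add: iterate_from_def)
qed

lemma kernel_iterate_eq_bind:
  assumes "prob_space \<mu>" "sets \<mu> = sets borel"
  shows "kernel_iterate kern \<mu> n = \<mu> \<bind> (\<lambda>y. iterate_from kern y n)"
proof (induction n)
  case 0
  show ?case using assms by (simp add: iterate_from_def bind_return'')
next
  case (Suc n)
  note [measurable_cong] = assms(2)
  have "kernel_iterate kern \<mu> (Suc n) = (\<mu> \<bind> (\<lambda>y. iterate_from kern y n)) \<bind> kern"
    by (simp add: Suc)
  also have "\<dots> = \<mu> \<bind> (\<lambda>y. iterate_from kern y n \<bind> kern)"
    by (rule bind_assoc[where N=borel and R=borel]) measurable
  finally show ?case by (simp add: iterate_from_def)
qed

lemma measure_invariant:
  assumes \<pi>: "invariant_law kern \<pi>" and A: "A \<in> sets borel"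
  shows "measure \<pi> A = (\<integral>y. measure (iterate_from kern y n) A \<partial>\<pi>)"
proof -
  interpret prob_space \<pi> using \<pi> by (simp add: invariant_law_def)
  have s [measurable_cong]: "sets \<pi> = sets borel" using \<pi> by (simp add: invariant_law_def)
  have "\<pi> = \<pi> \<bind> (\<lambda>y. iterate_from kern y n)"
    using kernel_iterate_eq_bind[OF prob_space_axioms s, of n] kernel_iterate_invariant[OF \<pi>, of n]
    by simp
  then have "measure \<pi> A = measure (\<pi> \<bind> (\<lambda>y. iterate_from kern y n)) A" by simp
  also have "\<dots> = (\<integral>y. measure (iterate_from kern y n) A \<partial>\<pi>)"
    by (rule measure_bind[where N=borel]) (use A in measurable)
  finally show ?thesis .
qed

end

text \<open>The vectors \<open>a\<close> and \<open>b\<close> stand for the real and imaginary part of an eigenvector of the adjoint.  Their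
  individual orbits may come close to \<open>0\<close> from time to time, but the sum of the two quadratic forms
  stays away from \<open>0\<close>; hence the product of the two values of the characteristic functional is at most
  \<open>exp (- t\<^sup>2 n \<epsilon> / 2)\<close> for every \<open>n\<close>.\<close>

lemma (in linear_chain) no_invariant_law:
  fixes q :: "'a \<Rightarrow> real"
  assumes gauss: "\<And>\<xi>. charfun \<nu> \<xi> = of_real (exp (- q \<xi> / 2))"
    and q_scale: "\<And>t \<xi>. q (t *\<^sub>R \<xi>) = t\<^sup>2 * q \<xi>"
    and \<epsilon>: "\<epsilon> > 0" "\<And>k. \<epsilon> \<le> q ((T ^^ k) a) + q ((T ^^ k) b)"
  shows "\<not> (\<exists>\<pi>. invariant_law kern \<pi>)"
proof
  assume "\<exists>\<pi>. invariant_law kern \<pi>"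
  then obtain \<pi> where \<pi>: "invariant_law kern \<pi>" by blast
  have p: "prob_space \<pi>" "sets \<pi> = sets borel" using \<pi> by (auto simp: invariant_law_def)
  have bound: "norm (charfun \<pi> (t *\<^sub>R \<xi>)) \<le> (\<Prod>k<n. exp (- t\<^sup>2 * q ((T ^^ k) \<xi>) / 2))" for t \<xi> n
  proof -
    have "norm (charfun \<pi> (t *\<^sub>R \<xi>)) = norm (charfun \<pi> ((T ^^ n) (t *\<^sub>R \<xi>))) *
        (\<Prod>k<n. norm (charfun \<nu> ((T ^^ k) (t *\<^sub>R \<xi>))))"
      using charfun_kernel_iterate[OF p, of n "t *\<^sub>R \<xi>"] kernel_iterate_invariant[OF \<pi>, of n]
      by (simp add: norm_mult prod_norm)
    also have "\<dots> \<le> 1 * (\<Prod>k<n. norm (charfun \<nu> ((T ^^ k) (t *\<^sub>R \<xi>))))"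
      by (intro mult_right_mono norm_charfun_le_1 p prod_nonneg) auto
    also have "\<dots> = (\<Prod>k<n. exp (- t\<^sup>2 * q ((T ^^ k) \<xi>) / 2))"
      by (simp only: gauss adjoint_pow_scale q_scale norm_of_real) simp
    finally show ?thesis .
  qed
  have zero: "norm (charfun \<pi> (t *\<^sub>R a)) * norm (charfun \<pi> (t *\<^sub>R b)) = 0" if "t \<noteq> 0" for t
  proof -
    let ?r = "exp (- (t\<^sup>2 * \<epsilon> / 2))"
    have "norm (charfun \<pi> (t *\<^sub>R a)) * norm (charfun \<pi> (t *\<^sub>R b)) \<le> ?r ^ n" for n
    proof -
      have "norm (charfun \<pi> (t *\<^sub>R a)) * norm (charfun \<pi> (t *\<^sub>R b)) \<le>
         (\<Prod>k<n. exp (- t\<^sup>2 * q ((T ^^ k) a) / 2)) * (\<Prod>k<n. exp (- t\<^sup>2 * q ((T ^^ k) b) / 2))"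
        by (intro mult_mono bound prod_nonneg) auto
      also have "\<dots> = (\<Prod>k<n. exp (- (t\<^sup>2 * (q ((T ^^ k) a) + q ((T ^^ k) b)) / 2)))"
        unfolding prod.distrib[symmetric] exp_add[symmetric]
        by (intro prod.cong refl arg_cong[where f=exp]) (simp add: field_simps)
      also have "\<dots> \<le> (\<Prod>k<n. ?r)"
        using \<epsilon>(2) by (intro prod_mono) (auto intro!: mult_left_mono)
      finally show ?thesis by simp
    qed
    moreover have "(\<lambda>n. ?r ^ n) \<longlonglongrightarrow> 0"
      using that \<epsilon> by (intro LIMSEQ_realpow_zero) auto
    ultimately have "norm (charfun \<pi> (t *\<^sub>R a)) * norm (charfun \<pi> (t *\<^sub>R b)) \<le> 0"
      by (intro LIMSEQ_le_const) auto
    then show ?thesis by (auto simp: mult_le_0_iff)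
  qed
  define s where "s m = inverse (real (Suc m))" for m
  have s0: "s \<longlonglongrightarrow> 0" unfolding s_def by (rule LIMSEQ_inverse_real_of_nat)
  have lim: "(\<lambda>m. norm (charfun \<pi> (s m *\<^sub>R \<xi>))) \<longlonglongrightarrow> 1" for \<xi>
  proof -
    have "(\<lambda>m. s m *\<^sub>R \<xi>) \<longlonglongrightarrow> 0"
      using tendsto_scaleR[OF s0 tendsto_const, of \<xi>] by simp
    from tendsto_norm[OF charfun_tendsto_1[OF p this]] show ?thesis by simp
  qed
  have "(\<lambda>m. norm (charfun \<pi> (s m *\<^sub>R a)) * norm (charfun \<pi> (s m *\<^sub>R b))) \<longlonglongrightarrow> 1 * 1"
    by (intro tendsto_mult lim)
  moreover have "norm (charfun \<pi> (s m *\<^sub>R a)) * norm (charfun \<pi> (s m *\<^sub>R b)) = 0" for m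
    by (rule zero) (simp add: s_def)
  ultimately show False by (simp add: LIMSEQ_const_iff)
qed

text \<open>The assumption \<open>noise_shift\<close> is the smoothing effect of a single noise variable: translating it by a
  small vector costs little in total variation.\<close>

locale stable_linear_chain = linear_chain +
  fixes B :: "nat \<Rightarrow> real" and C :: real
  assumes pow_bound: "\<And>n x. norm ((L ^^ n) x) \<le> B n * norm x"
    and summable_B: "summable B"
    and noise_shift: "\<And>a b A. A \<in> sets borel \<Longrightarrow>
      \<bar>measure (distr \<nu> borel (\<lambda>z. a + z)) A - measure (distr \<nu> borel (\<lambda>z. b + z)) A\<bar> \<le> C * norm (a - b)"
    and noise_moment: "integrable \<nu> norm"
begin

text \<open>Condition on the state before the last step: what remains is the law of one noise variable, translated
  by vectors whose difference does not depend on the state.\<close>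

lemma iterate_from_diff:
  assumes A[measurable]: "A \<in> sets borel" and "n > 0"
  shows "\<bar>measure (iterate_from kern y n) A - measure (iterate_from kern y' n) A\<bar> \<le> C * norm ((L ^^ n) (y - y'))"
proof -
  obtain k where n: "n = Suc k" using \<open>n > 0\<close> gr0_implies_Suc by blast
  let ?K = "iterate_from kern 0 k"
  interpret K: prob_space ?K by (rule iterate_from_prob)
  note [measurable_cong] = iterate_from_prob(2)
  have eq: "measure (iterate_from kern y n) A = (\<integral>m. measure (kern ((L ^^ k) y + m)) A \<partial>?K)" for y
  proof -
    have "iterate_from kern y n = distr ?K borel (\<lambda>m. (L ^^ k) y + m) \<bind> kern"
      using iterate_from_shift[of y k] by (simp add: n iterate_from_def)
    also have "\<dots> = ?K \<bind> (\<lambda>m. kern ((L ^^ k) y + m))"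
      by (rule bind_distr[where K=borel]) (auto simp: K.not_empty)
    finally have "measure (iterate_from kern y n) A = measure (?K \<bind> (\<lambda>m. kern ((L ^^ k) y + m))) A"
      by simp
    also have "\<dots> = (\<integral>m. measure (kern ((L ^^ k) y + m)) A \<partial>?K)"
      by (rule K.measure_bind[where N=borel]) measurable
    finally show ?thesis .
  qed
  have i: "integrable ?K (\<lambda>m. measure (kern ((L ^^ k) y + m)) A)" for y
  proof (rule K.integrable_const_bound[where B=1])
    show "(\<lambda>m. measure (kern ((L ^^ k) y + m)) A) \<in> borel_measurable ?K" by measurable
  qed (auto intro!: prob_space.prob_le_1 prob_kern)
  have "\<bar>measure (iterate_from kern y n) A - measure (iterate_from kern y' n) A\<bar> =
     \<bar>\<integral>m. measure (kern ((L ^^ k) y + m)) A - measure (kern ((L ^^ k) y' + m)) A \<partial>?K\<bar>"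
    unfolding eq using i by simp
  also have "\<dots> \<le> (\<integral>m. \<bar>measure (kern ((L ^^ k) y + m)) A - measure (kern ((L ^^ k) y' + m)) A\<bar> \<partial>?K)"
    by (rule integral_abs_bound)
  also have "\<dots> \<le> (\<integral>m. C * norm ((L ^^ n) (y - y')) \<partial>?K)"
  proof (rule integral_mono)
    fix m
    have "L ((L ^^ k) y + m) - L ((L ^^ k) y' + m) = (L ^^ n) (y - y')"
      by (simp add: n linear_add[OF linear_L] linear_diff[OF linear_L] linear_diff[OF linear_L_pow])
    then show "\<bar>measure (kern ((L ^^ k) y + m)) A - measure (kern ((L ^^ k) y' + m)) A\<bar> \<le> C * norm ((L ^^ n) (y - y'))"
      unfolding kern_def using noise_shift[OF A, of "L ((L ^^ k) y + m)" "L ((L ^^ k) y' + m)"] by simp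
  qed (use i in auto)
  also have "\<dots> = C * norm ((L ^^ n) (y - y'))" by (simp add: K.prob_space)
  finally show ?thesis .
qed

lemma shift_constant_nonneg: "C \<ge> 0"
proof -
  obtain b :: 'a where b: "b \<in> Basis" using nonempty_Basis by blast
  have "0 \<le> C * norm (b - 0)" using noise_shift[of UNIV b 0] by simp
  then show ?thesis using b by simp
qed

lemma pow_bound_nonneg: "B n \<ge> 0"
proof -
  obtain b :: 'a where b: "b \<in> Basis" using nonempty_Basis by blast
  have "0 \<le> B n * norm b" by (rule order_trans[OF norm_ge_zero pow_bound])
  then show ?thesis using b by simp
qed

text \<open>Averaging the previous bound over a starting point with law \<open>\<pi>\<close> costs a first moment of \<open>\<pi>\<close>.\<close>

lemma iterate_from_invariant_diff:
  assumes \<pi>: "invariant_law kern \<pi>" and m: "integrable \<pi> norm"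
    and A[measurable]: "A \<in> sets borel" and n: "n > 0"
  shows "\<bar>measure (iterate_from kern y n) A - measure \<pi> A\<bar> \<le> C * B n * (norm y + (\<integral>x. norm x \<partial>\<pi>))"
proof -
  interpret prob_space \<pi> using \<pi> by (simp add: invariant_law_def)
  have s [measurable_cong]: "sets \<pi> = sets borel" using \<pi> by (simp add: invariant_law_def)
  have i: "integrable \<pi> (\<lambda>y. measure (iterate_from kern y n) A)"
  proof (rule integrable_const_bound[where B=1])
    show "(\<lambda>y. measure (iterate_from kern y n) A) \<in> borel_measurable \<pi>" by measurable
  qed (auto intro!: prob_space.prob_le_1 iterate_from_prob)
  have "\<bar>measure (iterate_from kern y n) A - measure \<pi> A\<bar> =
     \<bar>\<integral>x. measure (iterate_from kern y n) A - measure (iterate_from kern x n) A \<partial>\<pi>\<bar>"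
    unfolding measure_invariant[OF \<pi> A, of n] using i by (simp add: prob_space)
  also have "\<dots> \<le> (\<integral>x. \<bar>measure (iterate_from kern y n) A - measure (iterate_from kern x n) A\<bar> \<partial>\<pi>)"
    by (rule integral_abs_bound)
  also have "\<dots> \<le> (\<integral>x. C * B n * (norm y + norm x) \<partial>\<pi>)"
  proof (rule integral_mono)
    fix x
    have "\<bar>measure (iterate_from kern y n) A - measure (iterate_from kern x n) A\<bar> \<le> C * norm ((L ^^ n) (y - x))"
      by (rule iterate_from_diff[OF A n])
    also have "\<dots> \<le> C * (B n * (norm y + norm x))"
      by (intro mult_left_mono shift_constant_nonneg order_trans[OF pow_bound] pow_bound_nonneg norm_triangle_ineq4)
    finally show "\<bar>measure (iterate_from kern y n) A - measure (iterate_from kern x n) A\<bar> \<le> C * B n * (norm y + norm x)"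
      by (simp add: mult.assoc)
  qed (use i m in auto)
  also have "\<dots> = C * B n * (norm y + (\<integral>x. norm x \<partial>\<pi>))" using m by (simp add: prob_space)
  finally show ?thesis .
qed

text \<open>From every starting point the chain converges to \<open>\<pi>\<close> on each set, so by dominated convergence it does
  so when started from any other invariant law.\<close>

lemma invariant_unique:
  assumes \<pi>: "invariant_law kern \<pi>" "integrable \<pi> norm" and \<pi>': "invariant_law kern \<pi>'"
  shows "\<pi>' = \<pi>"
proof -
  interpret Q: prob_space \<pi>' using \<pi>' by (simp add: invariant_law_def)
  interpret P: prob_space \<pi> using \<pi> by (simp add: invariant_law_def)
  have s [measurable_cong]: "sets \<pi>' = sets borel" "sets \<pi> = sets borel"
    using \<pi> \<pi>' by (simp_all add: invariant_law_def)
  show ?thesis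
  proof (rule measure_eqI)
    fix A assume "A \<in> sets \<pi>'"
    then have A[measurable]: "A \<in> sets borel" using s by simp
    have lim: "(\<lambda>n. measure (iterate_from kern y n) A) \<longlonglongrightarrow> measure \<pi> A" for y
    proof (rule LIM_zero_cancel, rule Lim_null_comparison)
      show "\<forall>\<^sub>F n in sequentially. norm (measure (iterate_from kern y n) A - measure \<pi> A)
          \<le> C * B n * (norm y + (\<integral>x. norm x \<partial>\<pi>))"
        using eventually_gt_at_top[of 0]
        by eventually_elim (use iterate_from_invariant_diff[OF \<pi> A] in auto)
      have "(\<lambda>n. C * B n * (norm y + (\<integral>x. norm x \<partial>\<pi>))) \<longlonglongrightarrow> C * 0 * (norm y + (\<integral>x. norm x \<partial>\<pi>))"
        by (intro tendsto_intros summable_LIMSEQ_zero summable_B)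
      then show "(\<lambda>n. C * B n * (norm y + (\<integral>x. norm x \<partial>\<pi>))) \<longlonglongrightarrow> 0" by simp
    qed
    have "(\<lambda>n. \<integral>y. measure (iterate_from kern y n) A \<partial>\<pi>') \<longlonglongrightarrow> (\<integral>y. measure \<pi> A \<partial>\<pi>')"
    proof (rule integral_dominated_convergence[where w="\<lambda>_. 1"])
      show "(\<lambda>y. measure (iterate_from kern y n) A) \<in> borel_measurable \<pi>'" for n by measurable
    qed (use lim in \<open>auto intro!: prob_space.prob_le_1 iterate_from_prob\<close>)
    then have "measure \<pi>' A = measure \<pi> A"
      using measure_invariant[OF \<pi>' A] by (simp add: Q.prob_space LIMSEQ_const_iff)
    then show "emeasure \<pi>' A = emeasure \<pi> A"
      by (simp add: Q.emeasure_eq_measure P.emeasure_eq_measure)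
  qed (simp add: s)
qed

text \<open>The invariant law is that of the series \<open>\<Sum>k. L\<^sup>k z\<^sub>k\<close> over an i.i.d. sequence.  Prepending an
  independent variable \<open>z\<close> to the sequence preserves its law and maps the sum \<open>S\<close> to \<open>L S + z\<close>, which is
  invariance.\<close>

lemma invariant_exists: "\<exists>\<pi>. invariant_law kern \<pi> \<and> integrable \<pi> norm"
proof -
  interpret N: prob_space \<nu> by (rule prob_noise)
  interpret S: sequence_space \<nu> by unfold_locales
  interpret NS: pair_prob_space \<nu> S.S ..
  let ?S = S.S
  define X where "X \<omega> = (\<Sum>k. (L ^^ k) (\<omega> k))" for \<omega> :: "nat \<Rightarrow> 'a"
  define R where "R \<omega> = (\<Sum>k. ennreal (norm ((L ^^ k) (\<omega> k))))" for \<omega> :: "nat \<Rightarrow> 'a"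
  have comp [measurable]: "(\<lambda>\<omega>. \<omega> k) \<in> ?S \<rightarrow>\<^sub>M borel" for k
    using measurable_component_singleton[of k UNIV "\<lambda>_. \<nu>"] measurable_cong_sets[OF refl sets_noise] by blast
  have X [measurable]: "X \<in> borel_measurable ?S" unfolding X_def by measurable
  have R [measurable]: "R \<in> borel_measurable ?S" unfolding R_def by measurable
  note B0 = pow_bound_nonneg
  define m where "m = (\<integral>x. norm x \<partial>\<nu>)"
  have m0: "0 \<le> m" unfolding m_def by simp
  have "(\<integral>\<^sup>+\<omega>. R \<omega> \<partial>?S) = (\<Sum>k. \<integral>\<^sup>+\<omega>. ennreal (norm ((L ^^ k) (\<omega> k))) \<partial>?S)"
    unfolding R_def by (rule nn_integral_suminf) measurable
  also have "\<dots> \<le> (\<Sum>k. ennreal (B k * m))"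
  proof (intro suminf_le)
    fix k
    have "(\<integral>\<^sup>+\<omega>. ennreal (norm ((L ^^ k) (\<omega> k))) \<partial>?S) =
        (\<integral>\<^sup>+z. ennreal (norm ((L ^^ k) z)) \<partial>distr ?S \<nu> (\<lambda>\<omega>. \<omega> k))"
    proof (rule nn_integral_distr[symmetric])
      show "(\<lambda>\<omega>. \<omega> k) \<in> ?S \<rightarrow>\<^sub>M \<nu>" by (rule measurable_component_singleton) simp
      have "L ^^ k \<in> \<nu> \<rightarrow>\<^sub>M borel"
        using measurable_L_pow measurable_cong_sets[OF sets_noise refl] by blast
      from measurable_compose[OF measurable_compose[OF this borel_measurable_norm] measurable_ennreal]
      show "(\<lambda>z. ennreal (norm ((L ^^ k) z))) \<in> borel_measurable (distr ?S \<nu> (\<lambda>\<omega>. \<omega> k))" by simp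
    qed
    also have "distr ?S \<nu> (\<lambda>\<omega>. \<omega> k) = \<nu>"
      by (rule S.PiM_component) simp
    also have "(\<integral>\<^sup>+z. ennreal (norm ((L ^^ k) z)) \<partial>\<nu>) \<le> (\<integral>\<^sup>+z. ennreal (B k * norm z) \<partial>\<nu>)"
      by (intro nn_integral_mono ennreal_leI pow_bound)
    also have "\<dots> = ennreal (B k * m)"
      using noise_moment B0 by (subst nn_integral_eq_integral) (auto simp: m_def)
    finally show "(\<integral>\<^sup>+\<omega>. ennreal (norm ((L ^^ k) (\<omega> k))) \<partial>?S) \<le> ennreal (B k * m)" .
  qed auto
  also have "\<dots> < \<infinity>"
    using B0 m0 summable_mult2[OF summable_B, of m] by (subst suminf_ennreal2) auto
  finally have Rfin: "(\<integral>\<^sup>+\<omega>. R \<omega> \<partial>?S) < \<infinity>" .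
  have aeR: "AE \<omega> in ?S. R \<omega> \<noteq> \<infinity>"
    using Rfin by (intro nn_integral_PInf_AE) auto
  have summ: "summable (\<lambda>k. norm ((L ^^ k) (\<omega> k)))" if "R \<omega> \<noteq> \<infinity>" for \<omega>
    using that unfolding R_def by (intro summable_suminf_not_top) auto
  have X_le: "ennreal (norm (X \<omega>)) \<le> R \<omega>" if "R \<omega> \<noteq> \<infinity>" for \<omega>
    unfolding X_def R_def using summable_norm[OF summ[OF that]] summ[OF that]
    by (subst suminf_ennreal2) (auto intro!: ennreal_leI)
  have step: "X (case_nat z \<omega>) = L (X \<omega>) + z" if "R \<omega> \<noteq> \<infinity>" for z \<omega>
  proof -
    have s: "summable (\<lambda>k. (L ^^ k) (\<omega> k))" using summable_norm_cancel[OF summ[OF that]] .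
    have bl: "bounded_linear L" using linear_L linear_conv_bounded_linear by blast
    have s': "summable (\<lambda>k. (L ^^ Suc k) (\<omega> k))"
      using bounded_linear.summable[OF bl s] by simp
    define f where "f k = (L ^^ k) (case_nat z \<omega> k)" for k
    have f: "f 0 = z" "\<And>k. f (Suc k) = (L ^^ Suc k) (\<omega> k)" by (simp_all add: f_def)
    have "summable f" using s' summable_Suc_iff[of f] by (simp add: f)
    from suminf_split_head[OF this]
    have "X (case_nat z \<omega>) = (\<Sum>k. (L ^^ Suc k) (\<omega> k)) + z"
      unfolding X_def f_def[symmetric] by (simp add: f)
    also have "(\<Sum>k. (L ^^ Suc k) (\<omega> k)) = L (X \<omega>)"
      unfolding X_def using bounded_linear.suminf[OF bl s] by simp
    finally show ?thesis .
  qed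
  define \<pi> where "\<pi> = distr ?S borel X"
  have p\<pi>: "prob_space \<pi>" "sets \<pi> = sets borel"
    unfolding \<pi>_def by (auto intro!: S.P.prob_space_distr)
  have cn: "(\<lambda>(z, \<omega>). case_nat z \<omega>) \<in> \<nu> \<Otimes>\<^sub>M ?S \<rightarrow>\<^sub>M ?S"
    by measurable
  have "\<pi> = distr (distr (\<nu> \<Otimes>\<^sub>M ?S) ?S (\<lambda>(z, \<omega>). case_nat z \<omega>)) borel X"
    unfolding \<pi>_def by (subst S.PiM_iter) simp
  also have "\<dots> = distr (\<nu> \<Otimes>\<^sub>M ?S) borel (X \<circ> (\<lambda>(z, \<omega>). case_nat z \<omega>))"
    by (rule distr_distr[OF X cn])
  also have "\<dots> = distr (\<nu> \<Otimes>\<^sub>M ?S) borel (\<lambda>(z, \<omega>). L (X \<omega>) + z)"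
  proof (rule distr_cong_AE)
    have "AE p in \<nu> \<Otimes>\<^sub>M ?S. R (snd p) \<noteq> \<infinity>"
      by (rule NS.AE_pair_measure) (use aeR in auto)
    then show "AE p in \<nu> \<Otimes>\<^sub>M ?S. (X \<circ> (\<lambda>(z, \<omega>). case_nat z \<omega>)) p = (case p of (z, \<omega>) \<Rightarrow> L (X \<omega>) + z)"
      by eventually_elim (auto simp: step split: prod.split)
    show "X \<circ> (\<lambda>(z, \<omega>). case_nat z \<omega>) \<in> borel_measurable (\<nu> \<Otimes>\<^sub>M ?S)"
      using cn X by (rule measurable_comp)
  qed auto
  also have "\<dots> = distr (distr (?S \<Otimes>\<^sub>M \<nu>) (\<nu> \<Otimes>\<^sub>M ?S) (\<lambda>(x, y). (y, x))) borel (\<lambda>(z, \<omega>). L (X \<omega>) + z)"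
    by (subst NS.distr_pair_swap) simp
  also have "\<dots> = distr (?S \<Otimes>\<^sub>M \<nu>) borel (\<lambda>(\<omega>, z). L (X \<omega>) + z)"
    by (subst distr_distr) (auto simp: comp_def case_prod_unfold)
  also have "\<dots> = distr (distr (?S \<Otimes>\<^sub>M \<nu>) (borel \<Otimes>\<^sub>M \<nu>) (\<lambda>(\<omega>, z). (X \<omega>, id z))) borel (\<lambda>(x, z). L x + z)"
    by (subst distr_distr) (auto simp: comp_def case_prod_unfold)
  also have "distr (?S \<Otimes>\<^sub>M \<nu>) (borel \<Otimes>\<^sub>M \<nu>) (\<lambda>(\<omega>, z). (X \<omega>, id z)) = distr ?S borel X \<Otimes>\<^sub>M distr \<nu> \<nu> id"
    by (rule pair_measure_distr[symmetric]) (auto simp: distr_id N.sigma_finite_measure_axioms)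
  also have "distr (distr ?S borel X \<Otimes>\<^sub>M distr \<nu> \<nu> id) borel (\<lambda>(x, z). L x + z) = \<pi> \<bind> kern"
    using bind_kern_eq_distr[OF p\<pi>] by (simp add: \<pi>_def id_def)
  finally have inv: "invariant_law kern \<pi>" using p\<pi> by (simp add: invariant_law_def)
  have "(\<integral>\<^sup>+\<omega>. ennreal (norm (X \<omega>)) \<partial>?S) \<le> (\<integral>\<^sup>+\<omega>. R \<omega> \<partial>?S)"
    by (rule nn_integral_mono_AE) (use aeR X_le in auto)
  then have "integrable ?S (\<lambda>\<omega>. norm (X \<omega>))"
    using Rfin by (intro integrableI_bounded) (auto intro: le_less_trans)
  then have "integrable \<pi> norm" unfolding \<pi>_def by (subst integrable_distr_eq) auto
  with inv show ?thesis by blast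
qed

lemma pow_tendsto_0: "(\<lambda>n. (L ^^ n) x) \<longlonglongrightarrow> 0"
proof (rule Lim_null_comparison)
  show "\<forall>\<^sub>F n in sequentially. norm ((L ^^ n) x) \<le> B n * norm x"
    using pow_bound by simp
  show "(\<lambda>n. B n * norm x) \<longlonglongrightarrow> 0"
    using tendsto_mult[OF summable_LIMSEQ_zero[OF summable_B] tendsto_const] by simp
qed

lemma adjoint_pow_tendsto_0: "(\<lambda>n. (T ^^ n) \<xi>) \<longlonglongrightarrow> 0"
proof (subst tendsto_componentwise_iff, rule ballI)
  fix b :: 'a
  have "(\<lambda>n. \<xi> \<bullet> (L ^^ n) b) \<longlonglongrightarrow> \<xi> \<bullet> 0"
    by (intro tendsto_inner tendsto_const pow_tendsto_0)
  then show "(\<lambda>n. (T ^^ n) \<xi> \<bullet> b) \<longlonglongrightarrow> 0 \<bullet> b"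
    by (simp add: adj_pow)
qed

context
  fixes q :: "'a \<Rightarrow> real" and \<pi> :: "'a measure"
  assumes gauss: "\<And>\<xi>. charfun \<nu> \<xi> = of_real (exp (- q \<xi> / 2))"
    and q_nonneg: "\<And>\<xi>. q \<xi> \<ge> 0"
    and \<pi>: "invariant_law kern \<pi>"
begin

lemma prod_charfun_noise: "(\<Prod>k<n. charfun \<nu> ((T ^^ k) \<xi>)) = of_real (\<Prod>k<n. exp (- q ((T ^^ k) \<xi>) / 2))"
  unfolding gauss by simp

text \<open>Iterating stationarity exhibits the characteristic functional of \<open>\<pi>\<close> as the limit of the decreasing
  products of noise factors, hence as a nonnegative real number.  It cannot vanish at \<open>\<xi>\<close>, because it
  would then vanish along the whole orbit of \<open>\<xi>\<close>, which tends to \<open>0\<close>.\<close>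

lemma charfun_invariant:
  "Im (charfun \<pi> \<xi>) = 0" "Re (charfun \<pi> \<xi>) > 0"
  "(\<Prod>k<n. exp (- q ((T ^^ k) \<xi>) / 2)) \<ge> Re (charfun \<pi> \<xi>)"
proof -
  have p: "prob_space \<pi>" "sets \<pi> = sets borel" using \<pi> by (auto simp: invariant_law_def)
  let ?E = "\<lambda>n. (\<Prod>k<n. exp (- q ((T ^^ k) \<xi>) / 2))"
  have lim1: "(\<lambda>n. charfun \<pi> ((T ^^ n) \<xi>)) \<longlonglongrightarrow> 1"
    by (intro charfun_tendsto_1 p adjoint_pow_tendsto_0)
  have eq: "charfun \<pi> \<xi> = charfun \<pi> ((T ^^ n) \<xi>) * of_real (?E n)" for n
    using charfun_kernel_iterate[OF p, of n \<xi>] kernel_iterate_invariant[OF \<pi>, of n]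
    by (simp only: prod_charfun_noise)
  have "\<forall>\<^sub>F n in sequentially. charfun \<pi> ((T ^^ n) \<xi>) \<noteq> 0"
    by (rule tendsto_imp_eventually_ne[OF lim1]) simp
  then have ev: "\<forall>\<^sub>F n in sequentially. charfun \<pi> \<xi> / charfun \<pi> ((T ^^ n) \<xi>) = of_real (?E n)"
  proof eventually_elim
    case (elim n)
    then show ?case using eq[of n] by (simp add: field_simps)
  qed
  have "(\<lambda>n. charfun \<pi> \<xi> / charfun \<pi> ((T ^^ n) \<xi>)) \<longlonglongrightarrow> charfun \<pi> \<xi> / 1"
    by (intro tendsto_intros lim1) simp
  from Lim_transform_eventually[OF this ev]
  have lim: "(\<lambda>n. complex_of_real (?E n)) \<longlonglongrightarrow> charfun \<pi> \<xi>" by simp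
  have limR: "?E \<longlonglongrightarrow> Re (charfun \<pi> \<xi>)" using tendsto_Re[OF lim] by (simp del: of_real_prod)
  show "Im (charfun \<pi> \<xi>) = 0"
    using tendsto_Im[OF lim] by (simp add: LIMSEQ_const_iff del: of_real_prod)
  have dec: "decseq ?E"
    by (intro decseq_SucI) (auto intro!: mult_left_le prod_nonneg simp: q_nonneg)
  show le: "?E n \<ge> Re (charfun \<pi> \<xi>)" for n by (rule decseq_ge[OF dec limR])
  have "Re (charfun \<pi> \<xi>) \<ge> 0"
    by (rule LIMSEQ_le_const[OF limR]) (auto intro!: prod_nonneg)
  moreover have "charfun \<pi> \<xi> \<noteq> 0"
  proof
    assume "charfun \<pi> \<xi> = 0"
    then have "charfun \<pi> ((T ^^ n) \<xi>) = 0" for n using eq[of n] by simp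
    then show False using lim1 by (simp add: LIMSEQ_const_iff)
  qed
  ultimately show "Re (charfun \<pi> \<xi>) > 0"
    using \<open>Im (charfun \<pi> \<xi>) = 0\<close> by (metis complex_eqI less_eq_real_def zero_complex.sel)
qed

text \<open>The law started at \<open>y\<close> has characteristic functional \<open>exp (\<i> \<xi> \<bullet> L\<^sup>n y)\<close> times a real product, so its
  imaginary part detects the drift \<open>L\<^sup>n y\<close> against every law with a real functional.\<close>

lemma tv_dist_lower:
  fixes \<mu> :: "'a measure"
  assumes \<mu>: "prob_space \<mu>" "sets \<mu> = sets borel" and im: "Im (charfun \<mu> \<xi>) = 0"
  shows "Re (charfun \<pi> \<xi>) * \<bar>sin (\<xi> \<bullet> (L ^^ n) y)\<bar> \<le> 2 * tv_dist (iterate_from kern y n) \<mu>"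
proof -
  let ?E = "(\<Prod>k<n. exp (- q ((T ^^ k) \<xi>) / 2))"
  have E: "0 \<le> ?E" by (intro prod_nonneg) auto
  have "Im (iexp x * of_real r) = sin x * r" for x r :: real by (simp add: Im_exp)
  then have "Im (charfun (iterate_from kern y n) \<xi>) = sin (\<xi> \<bullet> (L ^^ n) y) * ?E"
    unfolding charfun_iterate_from prod_charfun_noise by blast
  then have "\<bar>sin (\<xi> \<bullet> (L ^^ n) y)\<bar> * ?E = \<bar>Im (charfun (iterate_from kern y n) \<xi> - charfun \<mu> \<xi>)\<bar>"
    using im E by (simp add: abs_mult)
  also have "\<dots> \<le> 2 * tv_dist (iterate_from kern y n) \<mu>"
    by (intro Im_charfun_diff_le_tv_dist iterate_from_prob \<mu>)
  finally have "\<bar>sin (\<xi> \<bullet> (L ^^ n) y)\<bar> * ?E \<le> 2 * tv_dist (iterate_from kern y n) \<mu>" .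
  moreover have "Re (charfun \<pi> \<xi>) * \<bar>sin (\<xi> \<bullet> (L ^^ n) y)\<bar> \<le> ?E * \<bar>sin (\<xi> \<bullet> (L ^^ n) y)\<bar>"
    by (intro mult_right_mono charfun_invariant(3)) auto
  ultimately show ?thesis by (simp add: mult.commute)
qed

text \<open>All coordinate directions are tested at once: with complex eigenvalues a single coordinate of the orbit
  of \<open>y\<close> may vanish at infinitely many times, but the norm does not.\<close>

lemma tv_dist_lower_eventually:
  fixes \<mu> :: "nat \<Rightarrow> 'a measure"
  assumes \<mu>: "\<And>n. prob_space (\<mu> n)" "\<And>n. sets (\<mu> n) = sets borel" and im: "\<And>n \<xi>. Im (charfun (\<mu> n) \<xi>) = 0"
  shows "\<exists>c>0. \<forall>\<^sub>F n in sequentially. c * norm ((L ^^ n) y) \<le> tv_dist (iterate_from kern y n) (\<mu> n)"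
proof -
  define e where "e = Min ((\<lambda>b. Re (charfun \<pi> b)) ` Basis)"
  have e: "e > 0" "\<And>b. b \<in> Basis \<Longrightarrow> e \<le> Re (charfun \<pi> b)"
    unfolding e_def using charfun_invariant(2) by auto
  let ?D = "real DIM('a)"
  have D: "?D > 0" by simp
  have sin: "\<bar>x\<bar> / 2 \<le> \<bar>sin x\<bar>" if "\<bar>x\<bar> < 1" for x :: real
  proof -
    have pos: "x / 2 \<le> sin x" if "0 \<le> x" "x < 1" for x :: real
    proof -
      have "\<bar>sin x - x\<bar> \<le> inverse (fact 3) * \<bar>x\<bar> ^ 3"
        using Maclaurin_sin_bound[of x 3] by (simp add: lessThan_nat_numeral sin_coeff_def numeral_3_eq_3)
      moreover have "inverse (fact 3) * \<bar>x\<bar> ^ 3 \<le> x / 6"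
        using that power_le_one[of x 2] mult_left_mono[of "x^2" 1 x]
        by (simp add: fact_numeral power3_eq_cube power2_eq_square)
      ultimately show ?thesis using that by (simp add: abs_if split: if_splits)
    qed
    show ?thesis using pos[of x] pos[of "-x"] that by (auto simp: abs_if split: if_splits)
  qed
  have "\<forall>\<^sub>F n in sequentially. norm ((L ^^ n) y) < 1"
    using tendsto_norm[OF pow_tendsto_0[of y]] by (intro order_tendstoD) auto
  then have "\<forall>\<^sub>F n in sequentially. e / (4 * ?D) * norm ((L ^^ n) y) \<le> tv_dist (iterate_from kern y n) (\<mu> n)"
  proof eventually_elim
    case (elim n)
    let ?z = "(L ^^ n) y"
    have "e / 4 * \<bar>b \<bullet> ?z\<bar> \<le> tv_dist (iterate_from kern y n) (\<mu> n)" if b: "b \<in> Basis" for b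
    proof -
      have "\<bar>b \<bullet> ?z\<bar> < 1" using Basis_le_norm[OF b, of ?z] elim by (simp add: inner_commute)
      from sin[OF this] have "e * (\<bar>b \<bullet> ?z\<bar> / 2) \<le> Re (charfun \<pi> b) * \<bar>sin (b \<bullet> ?z)\<bar>"
        using e b by (intro mult_mono) (auto intro: less_imp_le order_trans)
      also have "\<dots> \<le> 2 * tv_dist (iterate_from kern y n) (\<mu> n)"
        by (rule tv_dist_lower[OF \<mu> im])
      finally show ?thesis by simp
    qed
    note b = this
    have "e / 4 * norm ?z \<le> e / 4 * (\<Sum>b\<in>Basis. \<bar>?z \<bullet> b\<bar>)"
      using e by (intro mult_left_mono norm_le_l1) auto
    also have "\<dots> = (\<Sum>b\<in>Basis. e / 4 * \<bar>b \<bullet> ?z\<bar>)" by (simp add: sum_distrib_left inner_commute)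
    also have "\<dots> \<le> (\<Sum>b\<in>(Basis::'a set). tv_dist (iterate_from kern y n) (\<mu> n))"
      by (intro sum_mono b)
    also have "\<dots> = ?D * tv_dist (iterate_from kern y n) (\<mu> n)" by simp
    finally show ?case using D by (simp add: field_simps)
  qed
  moreover have "e / (4 * ?D) > 0" using e D by simp
  ultimately show ?thesis by blast
qed

end

end

section \<open>Matrices of size two and real quadratic polynomials\<close>

lemma det_2x2:
  fixes A :: "'a::comm_ring_1 mat"
  assumes A: "A \<in> carrier_mat 2 2"
  shows "det A = A $$ (0, 0) * A $$ (1, 1) - A $$ (0, 1) * A $$ (1, 0)"
proof -
  have "det (mat_delete A i 0) = mat_delete A i 0 $$ (0, 0)" for i
    using mat_delete_carrier[OF A, of i 0] by (intro det_single) simp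
  then show ?thesis
    using A by (subst laplace_expansion_column[OF A, of 0])
      (auto simp: numeral_2_eq_2 cofactor_def mat_delete_def mult.commute)
qed

lemma eigenvalue_2x2:
  fixes a b c d k :: complex
  shows "eigenvalue (mat_of_rows_list 2 [[a, b], [c, d]]) k \<longleftrightarrow> k\<^sup>2 - (a + d) * k + (a * d - b * c) = 0"
proof -
  let ?A = "mat_of_rows_list 2 [[a, b], [c, d]]"
  have A: "?A \<in> carrier_mat 2 2" by (rule carrier_matI) (simp_all add: mat_of_rows_list_def)
  have "det (char_matrix ?A k) = (a - k) * (d - k) - b * c"
    unfolding char_matrix_def
    by (subst det_2x2) (auto simp: mat_of_rows_list_def)
  also have "\<dots> = k\<^sup>2 - (a + d) * k + (a * d - b * c)"
    by (simp add: power2_eq_square algebra_simps)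
  finally show ?thesis using eigenvalue_det[OF A, of k] by simp
qed

definition root_pair :: "real \<Rightarrow> real \<Rightarrow> complex \<Rightarrow> complex \<Rightarrow> bool" where
  "root_pair \<tau> \<delta> z w \<longleftrightarrow> z + w = of_real \<tau> \<and> z * w = of_real \<delta> \<and>
     ((Im z = 0 \<and> Im w = 0 \<and> Re w \<le> Re z) \<or> (w = cnj z \<and> Im z \<noteq> 0 \<and> \<tau>\<^sup>2 < 4 * \<delta>))"

lemma root_pair_exists:
  obtains z w where "root_pair \<tau> \<delta> z w"
proof (cases "\<tau>\<^sup>2 \<ge> 4 * \<delta>")
  case True
  define s where "s = sqrt (\<tau>\<^sup>2 - 4 * \<delta>)"
  have s: "s\<^sup>2 = \<tau>\<^sup>2 - 4 * \<delta>" "s \<ge> 0" using True by (simp_all add: s_def)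
  show ?thesis
  proof (rule that[of "of_real ((\<tau> + s) / 2)" "of_real ((\<tau> - s) / 2)"], unfold root_pair_def, intro conjI)
    show "complex_of_real ((\<tau> + s) / 2) + complex_of_real ((\<tau> - s) / 2) = complex_of_real \<tau>"
      by (simp only: of_real_add[symmetric] of_real_eq_iff) (simp add: field_simps)
    show "complex_of_real ((\<tau> + s) / 2) * complex_of_real ((\<tau> - s) / 2) = complex_of_real \<delta>"
      using s(1) by (simp only: of_real_mult[symmetric] of_real_eq_iff) (simp add: power2_eq_square field_simps)
  qed (use True s in auto)
next
  case False
  define s where "s = sqrt (4 * \<delta> - \<tau>\<^sup>2)"
  have s: "s\<^sup>2 = 4 * \<delta> - \<tau>\<^sup>2" "s > 0" using False by (simp_all add: s_def)
  show ?thesis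
  proof (rule that[of "Complex (\<tau> / 2) (s / 2)" "cnj (Complex (\<tau> / 2) (s / 2))"], unfold root_pair_def, intro conjI)
    show "Complex (\<tau> / 2) (s / 2) * cnj (Complex (\<tau> / 2) (s / 2)) = complex_of_real \<delta>"
      using s(1) by (simp add: complex_eq_iff power2_eq_square diff_divide_distrib)
  qed (use False s in \<open>auto simp: complex_eq_iff\<close>)
qed

lemma real_spectral_radius_2x2:
  fixes a b c d :: real
  assumes "z + w = complex_of_real (a + d)" "z * w = complex_of_real (a * d - b * c)"
  shows "real_spectral_radius (mat_of_rows_list 2 [[a, b], [c, d]]) = max (cmod z) (cmod w)"
proof -
  have m: "map_mat complex_of_real (mat_of_rows_list 2 [[a, b], [c, d]]) =
      mat_of_rows_list 2 [[of_real a, of_real b], [of_real c, of_real d]]"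
    by (rule eq_matI) (auto simp: mat_of_rows_list_def less_2_cases_iff numeral_2_eq_2[symmetric])
  have sp: "of_real a + of_real d = z + w" "of_real a * of_real d - of_real b * of_real c = z * w"
    using assms by simp_all
  have "k\<^sup>2 - (of_real a + of_real d) * k + (of_real a * of_real d - of_real b * of_real c) = (k - z) * (k - w)" for k
    unfolding sp by (simp add: power2_eq_square algebra_simps)
  then have "spectrum (map_mat complex_of_real (mat_of_rows_list 2 [[a, b], [c, d]])) = {z, w}"
    unfolding spectrum_def m by (auto simp: eigenvalue_2x2)
  then show ?thesis by (simp add: real_spectral_radius_def spectral_radius_def)
qed

text \<open>The Jury conditions.  The second one is \<open>(1 + z) (1 + w) > 0\<close>, which is a product of positive factors
  for a real pair and a squared modulus for a conjugate pair.\<close>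

lemma jury_necessary:
  assumes zw: "root_pair \<tau> \<delta> z w" and lt: "max (cmod z) (cmod w) < 1"
  shows "\<delta> < 1" "1 + \<tau> + \<delta> > 0"
proof -
  note roots = zw[unfolded root_pair_def, THEN conjunct2, THEN conjunct2]
  have sum: "z + w = of_real \<tau>" and prod: "z * w = of_real \<delta>" using zw by (simp_all add: root_pair_def)
  have "cmod z * cmod w < 1 * 1" using lt by (intro mult_strict_mono') auto
  then show "\<delta> < 1" using arg_cong[OF prod, of cmod] by (simp add: norm_mult abs_less_iff)
  have eq: "complex_of_real (1 + \<tau> + \<delta>) = (1 + z) * (1 + w)"
    using sum prod by (simp add: algebra_simps)
  from roots show "1 + \<tau> + \<delta> > 0"
  proof
    assume r: "Im z = 0 \<and> Im w = 0 \<and> Re w \<le> Re z"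
    have "\<bar>Re z\<bar> < 1" "\<bar>Re w\<bar> < 1" using lt abs_Re_le_cmod[of z] abs_Re_le_cmod[of w] by auto
    then have "0 < (1 + Re z) * (1 + Re w)" by (intro mult_pos_pos) auto
    also have "\<dots> = Re ((1 + z) * (1 + w))" using r by simp
    finally show ?thesis by (simp flip: eq)
  next
    assume r: "w = cnj z \<and> Im z \<noteq> 0 \<and> \<tau>\<^sup>2 < 4 * \<delta>"
    then have "(1 + z) * (1 + w) = of_real ((cmod (1 + z))\<^sup>2)"
      using complex_norm_square[of "1 + z"] by simp
    then have "1 + \<tau> + \<delta> = (cmod (1 + z))\<^sup>2" using eq of_real_eq_iff by metis
    moreover have "1 + z \<noteq> 0" using r by (auto simp: complex_eq_iff)
    ultimately show ?thesis by simp
  qed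
qed

text \<open>For a real pair the conditions at \<open>1\<close> and \<open>-1\<close> put both roots on the same side of each of these
  points, and the product condition excludes the two outer sides.\<close>

lemma jury_sufficient:
  assumes zw: "root_pair \<tau> \<delta> z w"
    and \<delta>: "0 < \<delta>" "\<delta> < 1" and at: "1 + \<tau> + \<delta> > 0" "1 - \<tau> + \<delta> > 0"
  shows "max (cmod z) (cmod w) < 1"
  using zw[unfolded root_pair_def, THEN conjunct2, THEN conjunct2]
proof
  assume r: "Im z = 0 \<and> Im w = 0 \<and> Re w \<le> Re z"
  obtain x where z: "z = of_real x" using r by (metis complex_is_Real_iff Reals_cases)
  obtain y where w: "w = of_real y" using r by (metis complex_is_Real_iff Reals_cases)
  have xy: "x + y = \<tau>" "x * y = \<delta>" using zw unfolding root_pair_def z w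
    by (simp_all only: of_real_add[symmetric] of_real_mult[symmetric] of_real_eq_iff)
  have p: "(1 + x) * (1 + y) > 0" "(1 - x) * (1 - y) > 0" using at xy by (simp_all add: algebra_simps)
  have "\<bar>x\<bar> < 1 \<and> \<bar>y\<bar> < 1"
  proof (rule ccontr)
    assume n: "\<not> (\<bar>x\<bar> < 1 \<and> \<bar>y\<bar> < 1)"
    have "(1 < x \<and> 1 < y) \<or> (x < -1 \<and> y < -1)"
      using n p unfolding zero_less_mult_iff by linarith
    then have "1 < x * y"
    proof
      assume "1 < x \<and> 1 < y"
      then show ?thesis using less_1_mult[of x y] by simp
    next
      assume "x < -1 \<and> y < -1"
      then show ?thesis using less_1_mult[of "-x" "-y"] by simp
    qed
    then show False using xy \<delta> by simp
  qed
  then show ?thesis by (simp add: z w)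
next
  assume r: "w = cnj z \<and> Im z \<noteq> 0 \<and> \<tau>\<^sup>2 < 4 * \<delta>"
  have "complex_of_real ((cmod z)\<^sup>2) = of_real \<delta>"
    using complex_norm_square[of z] zw r by (simp add: root_pair_def)
  then have "(cmod z)\<^sup>2 = \<delta>" using of_real_eq_iff by blast
  then have "(cmod z)\<^sup>2 < 1\<^sup>2" using \<delta> by simp
  then have "cmod z < 1" by (rule power_less_imp_less_base) simp
  then show ?thesis using r by simp
qed

section \<open>The law of the Wiener integral\<close>

lemma (in prob_space) normal_iexp:
  assumes "distributed M lborel X (normal_density 0 \<sigma>)" "\<sigma> > 0"
  shows "(CLINT \<omega>|M. iexp (b * X \<omega>)) = of_real (exp (- (b\<^sup>2 * \<sigma>\<^sup>2) / 2))"
proof -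
  have d: "distributed M lborel (\<lambda>\<omega>. X \<omega> / \<sigma>) std_normal_density"
    using normal_standard_normal_convert[OF assms(2), of X 0] assms(1) by simp
  have m: "(\<lambda>\<omega>. X \<omega> / \<sigma>) \<in> M \<rightarrow>\<^sub>M lborel" using d by (rule distributed_measurable)
  have "(CLINT \<omega>|M. iexp (b * X \<omega>)) = (CLINT \<omega>|M. iexp ((b * \<sigma>) * (X \<omega> / \<sigma>)))"
    using assms(2) by simp
  also have "\<dots> = (CLINT x|distr M lborel (\<lambda>\<omega>. X \<omega> / \<sigma>). iexp ((b * \<sigma>) * x))"
    using m by (subst integral_distr) auto
  also have "distr M lborel (\<lambda>\<omega>. X \<omega> / \<sigma>) = std_normal_distribution"
    using distributed_distr_eq_density[OF d] by simp
  also have "(CLINT x|std_normal_distribution. iexp ((b * \<sigma>) * x)) = char std_normal_distribution (b * \<sigma>)"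
    by (simp add: char_def)
  also have "\<dots> = of_real (exp (- (b\<^sup>2 * \<sigma>\<^sup>2) / 2))"
    by (simp add: char_std_normal_distribution power_mult_distrib)
  finally show ?thesis .
qed

lemma (in prob_space) brownian_increments_iexp:
  assumes W: "brownian_motion M W" and t0: "t 0 = 0" and mono: "\<And>i. i < m \<Longrightarrow> t i \<le> t (Suc i)"
  shows "(CLINT \<omega>|M. iexp (\<Sum>i<m. b i * (W (t (Suc i)) \<omega> - W (t i) \<omega>))) =
    of_real (exp (- (\<Sum>i<m. (b i)\<^sup>2 * (t (Suc i) - t i)) / 2))"
proof -
  have nonneg: "0 \<le> t i" if "i \<le> m" for i
    using that by (induction i) (auto simp: t0 intro: order_trans[OF _ mono])
  define Y where "Y i \<omega> = b i * (W (t (Suc i)) \<omega> - W (t i) \<omega>)" for i \<omega>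
  have "indep_vars (\<lambda>_. borel) (\<lambda>i \<omega>. W (t (Suc i)) \<omega> - W (t i) \<omega>) {..<m}"
    using W t0 mono unfolding brownian_motion_def by auto
  then have ind: "indep_vars (\<lambda>_. borel) Y {..<m}"
    unfolding Y_def by (rule indep_vars_compose2) auto
  then have [measurable]: "i < m \<Longrightarrow> Y i \<in> borel_measurable M" for i
    unfolding indep_vars_def by auto
  have one: "char (distr M borel (Y i)) 1 = of_real (exp (- ((b i)\<^sup>2 * (t (Suc i) - t i)) / 2))"
    if i: "i < m" for i
  proof -
    have "char (distr M borel (Y i)) 1 = (CLINT \<omega>|M. iexp (Y i \<omega>))"
      unfolding char_def using i by (subst integral_distr) auto
    also have "\<dots> = of_real (exp (- ((b i)\<^sup>2 * (t (Suc i) - t i)) / 2))"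
    proof (cases "t (Suc i) = t i")
      case True
      then show ?thesis by (simp add: Y_def prob_space)
    next
      case False
      then have less: "t i < t (Suc i)" using mono[OF i] by simp
      have "distributed M lborel (\<lambda>\<omega>. W (t (Suc i)) \<omega> - W (t i) \<omega>) (normal_density 0 (sqrt (t (Suc i) - t i)))"
        using W nonneg[of i] i less unfolding brownian_motion_def by auto
      from normal_iexp[OF this, of "b i"] less show ?thesis by (simp add: Y_def)
    qed
    finally show ?thesis .
  qed
  have "(CLINT \<omega>|M. iexp (\<Sum>i<m. Y i \<omega>)) = char (distr M borel (\<lambda>\<omega>. \<Sum>i<m. Y i \<omega>)) 1"
    unfolding char_def by (subst integral_distr) auto
  also have "\<dots> = (\<Prod>i<m. char (distr M borel (Y i)) 1)"
    by (rule char_distr_sum[OF ind])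
  also have "\<dots> = (\<Prod>i<m. of_real (exp (- ((b i)\<^sup>2 * (t (Suc i) - t i)) / 2)))"
    by (intro prod.cong refl one) simp
  also have "\<dots> = of_real (exp (\<Sum>i<m. - ((b i)\<^sup>2 * (t (Suc i) - t i)) / 2))"
    by (simp add: exp_sum)
  also have "(\<Sum>i<m. - ((b i)\<^sup>2 * (t (Suc i) - t i)) / 2) = - (\<Sum>i<m. (b i)\<^sup>2 * (t (Suc i) - t i)) / 2"
    by (simp add: sum_negf sum_divide_distrib)
  finally show ?thesis unfolding Y_def .
qed

lemma iexp_lipschitz: "norm (iexp a - iexp b) \<le> \<bar>a - b\<bar>"
proof -
  have "iexp a - iexp b = iexp b * (iexp (a - b) - 1)"
    by (simp add: algebra_simps exp_add[symmetric])
  then have "norm (iexp a - iexp b) = norm (iexp (a - b) - 1)"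
    by (simp add: norm_mult norm_exp_i_times)
  also have "\<dots> \<le> \<bar>a - b\<bar>" using iexp_approx1[of "a - b" 0] by simp
  finally show ?thesis .
qed

text \<open>The function \<open>iexp\<close> is 1-Lipschitz and bounded, so convergence in \<open>L\<^sup>2\<close> passes to its
  expectation through the Cauchy-Schwarz inequality.\<close>

lemma (in prob_space) iexp_tendsto_of_L2:
  fixes Y :: "'a \<Rightarrow> real"
  assumes [measurable]: "Y \<in> borel_measurable M" "\<And>n. X n \<in> borel_measurable M"
    and L2: "(\<lambda>n. \<integral>\<^sup>+\<omega>. ennreal ((Y \<omega> - X n \<omega>)\<^sup>2) \<partial>M) \<longlonglongrightarrow> 0"
  shows "(\<lambda>n. CLINT \<omega>|M. iexp (X n \<omega>)) \<longlonglongrightarrow> (CLINT \<omega>|M. iexp (Y \<omega>))"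
proof -
  define g where "g n \<omega> = norm (iexp (X n \<omega>) - iexp (Y \<omega>))" for n \<omega>
  have g2: "g n \<omega> \<le> 2" for n \<omega>
    unfolding g_def using norm_triangle_ineq4[of "iexp (X n \<omega>)" "iexp (Y \<omega>)"] by (simp add: norm_exp_i_times)
  have g0: "0 \<le> g n \<omega>" for n \<omega> by (simp add: g_def)
  have [measurable]: "g n \<in> borel_measurable M" for n unfolding g_def by measurable
  have g4: "(g n \<omega>)\<^sup>2 \<le> 4" for n \<omega> using power_mono[OF g2 g0, of n \<omega> 2] by simp
  have ig: "integrable M (g n)" "integrable M (\<lambda>\<omega>. (g n \<omega>)\<^sup>2)" for n
    using g0 g2 g4
    by (simp_all add: integrable_const_bound[where B=2 and f="g n"] integrable_const_bound[where B=4 and f="\<lambda>\<omega>. (g n \<omega>)\<^sup>2"])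
  have "(\<lambda>n. ennreal (\<integral>\<omega>. (g n \<omega>)\<^sup>2 \<partial>M)) \<longlonglongrightarrow> ennreal 0"
  proof (rule tendsto_sandwich[OF _ _ tendsto_const])
    show "\<forall>\<^sub>F n in sequentially. ennreal (\<integral>\<omega>. (g n \<omega>)\<^sup>2 \<partial>M) \<le> (\<integral>\<^sup>+\<omega>. ennreal ((Y \<omega> - X n \<omega>)\<^sup>2) \<partial>M)"
    proof (intro always_eventually allI)
      fix n
      have "(g n \<omega>)\<^sup>2 \<le> (Y \<omega> - X n \<omega>)\<^sup>2" for \<omega>
        unfolding g_def using power_mono[OF iexp_lipschitz[of "X n \<omega>" "Y \<omega>"], of 2]
        by (simp add: power2_commute)
      then have "(\<integral>\<^sup>+\<omega>. ennreal ((g n \<omega>)\<^sup>2) \<partial>M) \<le> (\<integral>\<^sup>+\<omega>. ennreal ((Y \<omega> - X n \<omega>)\<^sup>2) \<partial>M)"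
        by (intro nn_integral_mono ennreal_leI)
      then show "ennreal (\<integral>\<omega>. (g n \<omega>)\<^sup>2 \<partial>M) \<le> (\<integral>\<^sup>+\<omega>. ennreal ((Y \<omega> - X n \<omega>)\<^sup>2) \<partial>M)"
        using ig(2)[of n] by (subst (asm) nn_integral_eq_integral) auto
    qed
  qed (use L2 in auto)
  then have "(\<lambda>n. \<integral>\<omega>. (g n \<omega>)\<^sup>2 \<partial>M) \<longlonglongrightarrow> 0"
    by (subst (asm) tendsto_ennreal_iff) auto
  then have lim: "(\<lambda>n. sqrt (\<integral>\<omega>. (g n \<omega>)\<^sup>2 \<partial>M)) \<longlonglongrightarrow> 0"
    using tendsto_real_sqrt by fastforce
  have le: "norm ((CLINT \<omega>|M. iexp (X n \<omega>)) - (CLINT \<omega>|M. iexp (Y \<omega>))) \<le> sqrt (\<integral>\<omega>. (g n \<omega>)\<^sup>2 \<partial>M)" for n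
  proof -
    have "norm ((CLINT \<omega>|M. iexp (X n \<omega>)) - (CLINT \<omega>|M. iexp (Y \<omega>))) = norm (CLINT \<omega>|M. iexp (X n \<omega>) - iexp (Y \<omega>))"
      by (subst Bochner_Integration.integral_diff) (auto intro!: integrable_iexp)
    also have "\<dots> \<le> (\<integral>\<omega>. g n \<omega> \<partial>M)" unfolding g_def by (rule integral_norm_bound)
    also have "\<dots> \<le> sqrt (\<integral>\<omega>. (g n \<omega>)\<^sup>2 \<partial>M)"
      using variance_positive[of "g n"] variance_eq[OF ig] by (intro real_le_rsqrt) simp
    finally show ?thesis .
  qed
  show ?thesis
    by (rule LIM_zero_cancel, rule Lim_null_comparison[OF always_eventually lim]) (use le in auto)
qed

text \<open>With \<open>y = u - v\<^sub>n\<close> one has \<open>v\<^sub>n\<^sup>2 - u\<^sup>2 = y\<^sup>2 - 2 y u\<close>, and \<open>2 |y u| \<le> y\<^sup>2 / e + e u\<^sup>2\<close> for every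
  \<open>e > 0\<close>.\<close>

lemma integral_square_tendsto_of_L2:
  fixes u :: "'a \<Rightarrow> real"
  assumes [measurable]: "u \<in> borel_measurable M" "\<And>n. v n \<in> borel_measurable M"
    and u: "integrable M (\<lambda>x. (u x)\<^sup>2)" and v: "\<And>n. integrable M (\<lambda>x. (v n x)\<^sup>2)"
    and L2: "(\<lambda>n. \<integral>\<^sup>+x. ennreal ((u x - v n x)\<^sup>2) \<partial>M) \<longlonglongrightarrow> 0"
  shows "(\<lambda>n. \<integral>x. (v n x)\<^sup>2 \<partial>M) \<longlonglongrightarrow> (\<integral>x. (u x)\<^sup>2 \<partial>M)"
proof -
  define d where "d n = (\<integral>x. (u x - v n x)\<^sup>2 \<partial>M)" for n
  have id: "integrable M (\<lambda>x. (u x - v n x)\<^sup>2)" for n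
  proof (rule Bochner_Integration.integrable_bound)
    show "integrable M (\<lambda>x. 2 * (u x)\<^sup>2 + 2 * (v n x)\<^sup>2)" using u v by auto
    show "AE x in M. norm ((u x - v n x)\<^sup>2) \<le> norm (2 * (u x)\<^sup>2 + 2 * (v n x)\<^sup>2)"
    proof (rule AE_I2)
      fix x
      have "(u x - v n x)\<^sup>2 + (u x + v n x)\<^sup>2 = 2 * (u x)\<^sup>2 + 2 * (v n x)\<^sup>2"
        by (simp add: power2_eq_square algebra_simps)
      then show "norm ((u x - v n x)\<^sup>2) \<le> norm (2 * (u x)\<^sup>2 + 2 * (v n x)\<^sup>2)"
        using zero_le_power2[of "u x + v n x"] zero_le_power2[of "u x - v n x"]
        unfolding real_norm_def by linarith
    qed
  qed simp
  have "(\<lambda>n. ennreal (d n)) \<longlonglongrightarrow> ennreal 0"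
    using L2 unfolding d_def by (subst (asm) nn_integral_eq_integral) (use id in auto)
  then have d: "d \<longlonglongrightarrow> 0" by (subst (asm) tendsto_ennreal_iff) (auto simp: d_def)
  let ?U = "\<integral>x. (u x)\<^sup>2 \<partial>M"
  have U: "0 \<le> ?U" by simp
  have bound: "\<bar>(\<integral>x. (v n x)\<^sup>2 \<partial>M) - ?U\<bar> \<le> (1 + 1 / e) * d n + e * ?U" if e: "e > 0" for n e
  proof -
    have "\<bar>(\<integral>x. (v n x)\<^sup>2 \<partial>M) - ?U\<bar> = \<bar>\<integral>x. (v n x)\<^sup>2 - (u x)\<^sup>2 \<partial>M\<bar>"
      using u v by simp
    also have "\<dots> \<le> (\<integral>x. \<bar>(v n x)\<^sup>2 - (u x)\<^sup>2\<bar> \<partial>M)" by (rule integral_abs_bound)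
    also have "\<dots> \<le> (\<integral>x. (1 + 1 / e) * (u x - v n x)\<^sup>2 + e * (u x)\<^sup>2 \<partial>M)"
    proof (rule integral_mono)
      fix x
      define y z where "y = u x - v n x" and "z = u x"
      have "0 \<le> (\<bar>y\<bar> / sqrt e - \<bar>z\<bar> * sqrt e)\<^sup>2" by simp
      also have "\<dots> = y\<^sup>2 / e + e * z\<^sup>2 - 2 * \<bar>y * z\<bar>"
        using e by (simp add: power2_diff power_mult_distrib power_divide abs_mult)
      finally have "2 * \<bar>y * z\<bar> \<le> y\<^sup>2 / e + e * z\<^sup>2" by simp
      moreover have "(v n x)\<^sup>2 - (u x)\<^sup>2 = y\<^sup>2 - 2 * (y * z)"
        by (simp add: y_def z_def power2_eq_square algebra_simps)
      moreover have "0 \<le> y\<^sup>2" by simp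
      ultimately have "\<bar>(v n x)\<^sup>2 - (u x)\<^sup>2\<bar> \<le> y\<^sup>2 + y\<^sup>2 / e + e * z\<^sup>2" by linarith
      then show "\<bar>(v n x)\<^sup>2 - (u x)\<^sup>2\<bar> \<le> (1 + 1 / e) * (u x - v n x)\<^sup>2 + e * (u x)\<^sup>2"
        by (simp add: y_def z_def algebra_simps)
    qed (use u v id in auto)
    also have "\<dots> = (1 + 1 / e) * d n + e * ?U" using u id by (simp add: d_def)
    finally show ?thesis .
  qed
  show ?thesis
  proof (rule LIMSEQ_I)
    fix r :: real assume r: "r > 0"
    define e where "e = r / (2 * (?U + 1))"
    have e: "e > 0" unfolding e_def using r U by (intro divide_pos_pos mult_pos_pos) linarith+
    have "e * ?U < e * (?U + 1)" using e by simp
    also have "x / (2 * (y + 1)) * (y + 1) = x / 2" if "y \<ge> 0" for x y :: real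
      using that by (simp add: divide_simps)
    from this[OF U, of r] have "e * (?U + 1) = r / 2" unfolding e_def .
    finally have eU: "e * ?U < r / 2" .
    have "(\<lambda>n. (1 + 1 / e) * d n) \<longlonglongrightarrow> (1 + 1 / e) * 0" by (intro tendsto_intros d)
    then have "\<forall>\<^sub>F n in sequentially. (1 + 1 / e) * d n < r / 2"
      using r by (intro order_tendstoD) auto
    then obtain N where N: "\<And>n. n \<ge> N \<Longrightarrow> (1 + 1 / e) * d n < r / 2"
      by (auto simp: eventually_sequentially)
    show "\<exists>no. \<forall>n\<ge>no. norm ((\<integral>x. (v n x)\<^sup>2 \<partial>M) - ?U) < r"
    proof (intro exI allI impI)
      fix n assume "N \<le> n"
      from le_less_trans[OF bound[OF e] add_strict_mono[OF N[OF this] eU]]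
      show "norm ((\<integral>x. (v n x)\<^sup>2 \<partial>M) - ?U) < r" by (simp only: real_norm_def field_sum_of_halves)
    qed
  qed
qed

lemma step_fun_square:
  fixes b :: "nat \<Rightarrow> real"
  assumes "\<And>i. i < m \<Longrightarrow> t i \<le> t (Suc i)"
  shows "(step_fun m t b s)\<^sup>2 = (\<Sum>i<m. indicator {t i<..t (Suc i)} s * (b i)\<^sup>2)"
  using assms
proof (induction m)
  case (Suc m)
  have le: "t i \<le> t m" if "i \<le> m" for i
    using that by (rule inc_induct) (auto intro: order_trans[OF Suc.prems])
  show ?case
  proof (cases "s \<in> {t m<..t (Suc m)}")
    case True
    then have "indicator {t i<..t (Suc i)} s = (0::real)" if "i < m" for i
      using le[of "Suc i"] that by (auto simp: indicator_def)
    then show ?thesis using True by (simp add: step_fun_def power_mult_distrib power2_eq_square)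
  next
    case False
    then show ?thesis using Suc by (simp add: step_fun_def)
  qed
qed (simp add: step_fun_def)

text \<open>For step functions this is the characteristic function of a sum of independent normal increments.  Both
  sides are continuous along the approximating sequence: the left one by convergence in \<open>L\<^sup>2(M)\<close>, the
  variance on the right by convergence of the integrands in \<open>L\<^sup>2\<close>.\<close>

lemma (in prob_space) wiener_integral_iexp:
  fixes f :: "real \<Rightarrow> 'b::euclidean_space"
  assumes W: "brownian_motion M W" and Z: "has_wiener_integral M W h f Z"
    and f: "continuous_on {0..h} f"
  shows "(CLINT \<omega>|M. iexp (a \<bullet> Z \<omega>)) = of_real (exp (- (\<integral>s\<in>{0..h}. (a \<bullet> f s)\<^sup>2 \<partial>lborel) / 2))"
proof -
  from Z obtain m t c where Zm [measurable]: "Z \<in> borel_measurable M"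
    and t: "\<And>n. t n 0 = 0" "\<And>n. t n (m n) = h" "\<And>n i. i < m n \<Longrightarrow> t n i \<le> t n (Suc i)"
    and L2f: "(\<lambda>n. \<integral>\<^sup>+s\<in>{0..h}. ennreal ((norm (f s - step_fun (m n) (t n) (c n) s))\<^sup>2) \<partial>lborel) \<longlonglongrightarrow> 0"
    and L2Z: "(\<lambda>n. \<integral>\<^sup>+\<omega>. ennreal ((norm (Z \<omega> - step_integral W (m n) (t n) (c n) \<omega>))\<^sup>2) \<partial>M) \<longlonglongrightarrow> 0"
    unfolding has_wiener_integral_def by blast
  have CS: "ennreal ((a \<bullet> x - a \<bullet> y)\<^sup>2) \<le> ennreal ((norm a)\<^sup>2) * ennreal ((norm (x - y))\<^sup>2)" for x y
    using Cauchy_Schwarz_ineq2[of a "x - y"] power_mono[of "\<bar>a \<bullet> (x - y)\<bar>" "norm a * norm (x - y)" 2]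
    by (simp add: ennreal_mult[symmetric] power_mult_distrib inner_diff_right ennreal_leI)
  have nonneg: "0 \<le> t n i" if "i \<le> m n" for n i
    using that by (induction i) (auto simp: t(1) intro: order_trans[OF _ t(3)])
  have le_h: "t n i \<le> h" if "i \<le> m n" for n i
    using that unfolding t(2)[of n, symmetric] by (rule inc_induct) (auto intro: order_trans[OF t(3)])
  have Wm: "W s \<in> borel_measurable M" if "s \<ge> 0" for s
    using W that unfolding brownian_motion_def by auto
  define X where "X n \<omega> = (\<Sum>i<m n. (a \<bullet> c n i) * (W (t n (Suc i)) \<omega> - W (t n i) \<omega>))" for n \<omega>
  have X_eq: "X n \<omega> = a \<bullet> step_integral W (m n) (t n) (c n) \<omega>" for n \<omega>
    by (simp add: X_def step_integral_def inner_sum_right mult.commute)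
  have Xm: "X n \<in> borel_measurable M" for n
    unfolding X_def by (intro borel_measurable_sum borel_measurable_times borel_measurable_diff
      borel_measurable_const Wm nonneg) auto
  have Sm: "step_integral W (m n) (t n) (c n) \<in> borel_measurable M" for n
    unfolding step_integral_def by (intro borel_measurable_sum borel_measurable_scaleR borel_measurable_diff
      borel_measurable_const Wm nonneg) auto
  define V where "V n = (\<Sum>i<m n. (a \<bullet> c n i)\<^sup>2 * (t n (Suc i) - t n i))" for n
  have charX: "(CLINT \<omega>|M. iexp (X n \<omega>)) = of_real (exp (- V n / 2))" for n
    unfolding X_def V_def by (rule brownian_increments_iexp[OF W]) (use t in auto)
  have limX: "(\<lambda>n. CLINT \<omega>|M. iexp (X n \<omega>)) \<longlonglongrightarrow> (CLINT \<omega>|M. iexp (a \<bullet> Z \<omega>))"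
  proof (rule iexp_tendsto_of_L2[OF _ Xm])
    show "(\<lambda>n. \<integral>\<^sup>+\<omega>. ennreal ((a \<bullet> Z \<omega> - X n \<omega>)\<^sup>2) \<partial>M) \<longlonglongrightarrow> 0"
    proof (rule tendsto_sandwich[OF _ _ tendsto_const])
      let ?r = "\<lambda>n. ennreal ((norm a)\<^sup>2) * (\<integral>\<^sup>+\<omega>. ennreal ((norm (Z \<omega> - step_integral W (m n) (t n) (c n) \<omega>))\<^sup>2) \<partial>M)"
      show "\<forall>\<^sub>F n in sequentially. (\<integral>\<^sup>+\<omega>. ennreal ((a \<bullet> Z \<omega> - X n \<omega>)\<^sup>2) \<partial>M) \<le> ?r n"
        unfolding X_eq using Sm by (intro always_eventually allI, subst nn_integral_cmult[symmetric])
          (auto intro!: nn_integral_mono CS)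
      show "?r \<longlonglongrightarrow> 0" using ennreal_tendsto_cmult[OF _ L2Z, of "ennreal ((norm a)\<^sup>2)"] by simp
    qed simp
  qed simp
  define u where "u s = indicator {0..h} s *\<^sub>R (a \<bullet> f s)" for s
  define v where "v n s = step_fun (m n) (t n) (\<lambda>i. a \<bullet> c n i) s" for n s
  have cont: "continuous_on {0..h} (\<lambda>s. a \<bullet> f s)" by (intro continuous_intros f)
  have um [measurable]: "u \<in> borel_measurable lborel"
    unfolding u_def using borel_measurable_continuous_on_indicator[OF _ cont] by simp
  have vm [measurable]: "v n \<in> borel_measurable lborel" for n
    unfolding v_def step_fun_def by measurable
  have v_eq: "v n s = a \<bullet> step_fun (m n) (t n) (c n) s" for n s
    by (simp add: v_def step_fun_def inner_sum_right)
  have v_out: "v n s = 0" if "s \<notin> {0..h}" for n s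
  proof -
    have "indicator {t n i<..t n (Suc i)} s = (0::real)" if "i < m n" for i
      using \<open>s \<notin> {0..h}\<close> nonneg[of i n] le_h[of "Suc i" n] that by (auto simp: indicator_def)
    then show ?thesis by (simp add: v_def step_fun_def)
  qed
  have u2: "(u s)\<^sup>2 = indicator {0..h} s *\<^sub>R (a \<bullet> f s)\<^sup>2" for s
    by (simp add: u_def indicator_def)
  have v2: "(v n s)\<^sup>2 = (\<Sum>i<m n. indicator {t n i<..t n (Suc i)} s * (a \<bullet> c n i)\<^sup>2)" for n s
    unfolding v_def by (rule step_fun_square) (rule t)
  have "set_integrable lborel {0..h} (\<lambda>s. (a \<bullet> f s)\<^sup>2)"
    by (intro borel_integrable_atLeastAtMost' continuous_intros cont)
  then have iu: "integrable lborel (\<lambda>s. (u s)\<^sup>2)" unfolding u2 set_integrable_def .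
  have iv: "integrable lborel (\<lambda>s. (v n s)\<^sup>2)" for n
    unfolding v2 by (intro Bochner_Integration.integrable_sum integrable_mult_left integrable_real_indicator)
      (use t(3) in auto)
  have V_eq: "(\<integral>s. (v n s)\<^sup>2 \<partial>lborel) = V n" for n
    unfolding v2 V_def using t(3)
    by (subst Bochner_Integration.integral_sum) (auto intro!: sum.cong integrable_mult_left simp: mult.commute)
  have "(\<lambda>n. \<integral>s. (v n s)\<^sup>2 \<partial>lborel) \<longlonglongrightarrow> (\<integral>s. (u s)\<^sup>2 \<partial>lborel)"
  proof (rule integral_square_tendsto_of_L2[OF um vm iu iv])
    show "(\<lambda>n. \<integral>\<^sup>+s. ennreal ((u s - v n s)\<^sup>2) \<partial>lborel) \<longlonglongrightarrow> 0"
    proof (rule tendsto_sandwich[OF _ _ tendsto_const])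
      let ?r = "\<lambda>n. ennreal ((norm a)\<^sup>2) * (\<integral>\<^sup>+s\<in>{0..h}. ennreal ((norm (f s - step_fun (m n) (t n) (c n) s))\<^sup>2) \<partial>lborel)"
      show "\<forall>\<^sub>F n in sequentially. (\<integral>\<^sup>+s. ennreal ((u s - v n s)\<^sup>2) \<partial>lborel) \<le> ?r n"
      proof (intro always_eventually allI)
        fix n
        have fm: "(\<lambda>s. indicator {0..h} s *\<^sub>R f s) \<in> borel_measurable lborel"
          using borel_measurable_continuous_on_indicator[OF _ f] by simp
        have sm: "step_fun (m n) (t n) (c n) \<in> borel_measurable lborel"
          unfolding step_fun_def by measurable
        have "(\<lambda>s. ennreal ((norm (indicator {0..h} s *\<^sub>R f s - step_fun (m n) (t n) (c n) s))\<^sup>2) * indicator {0..h} s) \<in> borel_measurable lborel"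
          using fm sm by measurable
        also have "(\<lambda>s. ennreal ((norm (indicator {0..h} s *\<^sub>R f s - step_fun (m n) (t n) (c n) s))\<^sup>2) * indicator {0..h} s)
           = (\<lambda>s. ennreal ((norm (f s - step_fun (m n) (t n) (c n) s))\<^sup>2) * indicator {0..h} s)"
          by (auto simp: fun_eq_iff indicator_def)
        finally have me: "(\<lambda>s. ennreal ((norm (f s - step_fun (m n) (t n) (c n) s))\<^sup>2) * indicator {0..h} s) \<in> borel_measurable lborel" .
        have "(\<integral>\<^sup>+s. ennreal ((u s - v n s)\<^sup>2) \<partial>lborel) \<le> (\<integral>\<^sup>+s. ennreal ((norm a)\<^sup>2) * (ennreal ((norm (f s - step_fun (m n) (t n) (c n) s))\<^sup>2) * indicator {0..h} s) \<partial>lborel)"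
        proof (rule nn_integral_mono)
          fix s
          show "ennreal ((u s - v n s)\<^sup>2) \<le> ennreal ((norm a)\<^sup>2) * (ennreal ((norm (f s - step_fun (m n) (t n) (c n) s))\<^sup>2) * indicator {0..h} s)"
            using v_out[of s n] CS by (cases "s \<in> {0..h}") (auto simp: u_def v_eq)
        qed
        also have "\<dots> = ?r n" by (rule nn_integral_cmult[OF me])
        finally show "(\<integral>\<^sup>+s. ennreal ((u s - v n s)\<^sup>2) \<partial>lborel) \<le> ?r n" .
      qed
      show "?r \<longlonglongrightarrow> 0" using ennreal_tendsto_cmult[OF _ L2f, of "ennreal ((norm a)\<^sup>2)"] by simp
    qed simp
  qed
  then have "V \<longlonglongrightarrow> (\<integral>s\<in>{0..h}. (a \<bullet> f s)\<^sup>2 \<partial>lborel)"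
    unfolding V_eq u2 set_lebesgue_integral_def .
  then have "(\<lambda>n. complex_of_real (exp (- V n / 2))) \<longlonglongrightarrow> of_real (exp (- (\<integral>s\<in>{0..h}. (a \<bullet> f s)\<^sup>2 \<partial>lborel) / 2))"
    by (intro tendsto_intros) auto
  with limX show ?thesis unfolding charX by (rule LIMSEQ_unique)
qed

section \<open>Independence from factorising characteristic functions\<close>

text \<open>Adding a constant makes the weight \<open>w\<close> positive, so it can be normalised to a probability density.
  Under the tilted measure \<open>X\<close> has the same characteristic function as before, hence the same law by
  Levy uniqueness.\<close>

lemma (in prob_space) expectation_indicator_of_factorization:
  fixes X w :: "'a \<Rightarrow> real"
  assumes [measurable]: "X \<in> borel_measurable M" "w \<in> borel_measurable M" and w: "\<And>\<omega>. \<bar>w \<omega>\<bar> \<le> K"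
    and fact: "\<And>a. (CLINT \<omega>|M. of_real (w \<omega>) * iexp (a * X \<omega>)) = of_real (expectation w) * (CLINT \<omega>|M. iexp (a * X \<omega>))"
    and A [measurable]: "A \<in> sets borel"
  shows "expectation (\<lambda>\<omega>. w \<omega> * indicator A (X \<omega>)) = expectation w * expectation (\<lambda>\<omega>. indicator A (X \<omega>))"
proof -
  define c where "c = expectation w + K + 1"
  have iw: "integrable M w" using w by (intro integrable_const_bound[where B=K]) auto
  have w1: "1 \<le> w \<omega> + K + 1" for \<omega> using w[of \<omega>] by linarith
  have "expectation (\<lambda>_. 1) \<le> expectation (\<lambda>\<omega>. w \<omega> + K + 1)"
    by (rule integral_mono) (use iw w1 in auto)
  then have c1: "1 \<le> c" using iw by (simp add: c_def prob_space)
  define g where "g \<omega> = (w \<omega> + K + 1) / c" for \<omega>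
  have g0: "0 \<le> g \<omega>" for \<omega> unfolding g_def using w1[of \<omega>] c1 by simp
  have [measurable]: "g \<in> borel_measurable M" unfolding g_def by measurable
  have ig: "integrable M g" unfolding g_def using iw by auto
  have Eg: "expectation g = 1" unfolding g_def using iw c1 by (simp add: c_def prob_space)
  define N where "N = density M (\<lambda>\<omega>. ennreal (g \<omega>))"
  have pN: "prob_space N"
  proof
    show "emeasure N (space N) = 1"
      unfolding N_def using ig Eg g0
      by (simp add: emeasure_density nn_integral_eq_integral cong: nn_integral_cong_simp)
  qed
  then interpret N: prob_space N .
  have [measurable]: "X \<in> borel_measurable N" unfolding N_def by simp
  have rd: "real_distribution (distr N borel X)" "real_distribution (distr M borel X)"
    by (auto intro!: N.real_distribution_distr real_distribution_distr)
  have "char (distr N borel X) = char (distr M borel X)"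
  proof
    fix a
    have i1: "complex_integrable M (\<lambda>\<omega>. of_real (w \<omega>) * iexp (a * X \<omega>))"
      using w by (intro integrable_const_bound[where B=K]) (auto simp: norm_mult norm_exp_i_times)
    have i2: "complex_integrable M (\<lambda>\<omega>. iexp (a * X \<omega>))" by (auto intro!: integrable_iexp)
    have "char (distr N borel X) a = (CLINT \<omega>|N. iexp (a * X \<omega>))"
      unfolding char_def by (subst integral_distr) auto
    also have "\<dots> = (CLINT \<omega>|M. g \<omega> *\<^sub>R iexp (a * X \<omega>))"
      unfolding N_def using g0 by (subst integral_density) auto
    also have "\<dots> = (CLINT \<omega>|M. (of_real (w \<omega>) * iexp (a * X \<omega>) + of_real (K + 1) * iexp (a * X \<omega>)) / of_real c)"
      by (intro Bochner_Integration.integral_cong) (auto simp: g_def scaleR_conv_of_real field_simps)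
    also have "\<dots> = (of_real (expectation w) + of_real (K + 1)) * (CLINT \<omega>|M. iexp (a * X \<omega>)) / of_real c"
      using i1 i2 by (simp add: fact distrib_right del: of_real_mult)
    also have "of_real (expectation w) + of_real (K + 1) = complex_of_real c" by (simp add: c_def)
    also have "of_real c * (CLINT \<omega>|M. iexp (a * X \<omega>)) / of_real c = (CLINT \<omega>|M. iexp (a * X \<omega>))"
      using c1 by simp
    also have "\<dots> = char (distr M borel X) a"
      unfolding char_def by (subst integral_distr) auto
    finally show "char (distr N borel X) a = char (distr M borel X) a" .
  qed
  then have "distr N borel X = distr M borel X" by (rule Levy_uniqueness[OF rd])
  then have "(\<integral>x. indicator A x \<partial>distr N borel X) = (\<integral>x. (indicator A x :: real) \<partial>distr M borel X)" by simp
  then have "(\<integral>\<omega>. indicator A (X \<omega>) \<partial>N) = expectation (\<lambda>\<omega>. indicator A (X \<omega>) :: real)"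
    by (subst (asm) (1 2) integral_distr) auto
  moreover have "(\<integral>\<omega>. indicator A (X \<omega>) \<partial>N) = expectation (\<lambda>\<omega>. g \<omega> * indicator A (X \<omega>))"
    unfolding N_def using g0 by (subst integral_density) auto
  ultimately have eq: "expectation (\<lambda>\<omega>. g \<omega> * indicator A (X \<omega>)) = expectation (\<lambda>\<omega>. indicator A (X \<omega>))" by simp
  have iA: "integrable M (\<lambda>\<omega>. indicator A (X \<omega>) :: real)"
    by (intro integrable_const_bound[where B=1]) (auto simp: indicator_def)
  have iwA: "integrable M (\<lambda>\<omega>. w \<omega> * indicator A (X \<omega>))"
    by (rule Bochner_Integration.integrable_bound[OF iw]) (auto simp: indicator_def)
  have "expectation (\<lambda>\<omega>. g \<omega> * indicator A (X \<omega>)) =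
      expectation (\<lambda>\<omega>. (w \<omega> * indicator A (X \<omega>) + (K + 1) * indicator A (X \<omega>)) / c)"
    by (intro Bochner_Integration.integral_cong) (auto simp: g_def field_simps)
  also have "\<dots> = (expectation (\<lambda>\<omega>. w \<omega> * indicator A (X \<omega>)) + (K + 1) * expectation (\<lambda>\<omega>. indicator A (X \<omega>))) / c"
    using iA iwA by simp
  finally show ?thesis using eq c1 by (simp add: c_def field_simps)
qed

text \<open>A theorem of Kac.  One-dimensional uniqueness is applied twice: with the weights \<open>cos (b Y)\<close> and
  \<open>sin (b Y)\<close> it shows that an event of \<open>X\<close> is uncorrelated with \<open>exp (\<i> b Y)\<close>, and with the indicator of
  that event as the weight it shows independence from the events of \<open>Y\<close>.\<close>

lemma (in prob_space) pair_distr_eq_of_char_factorization: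
  fixes X Y :: "'a \<Rightarrow> real"
  assumes [measurable]: "X \<in> borel_measurable M" "Y \<in> borel_measurable M"
    and fact: "\<And>a b. (CLINT \<omega>|M. iexp (a * X \<omega> + b * Y \<omega>)) = (CLINT \<omega>|M. iexp (a * X \<omega>)) * (CLINT \<omega>|M. iexp (b * Y \<omega>))"
  shows "distr M borel X \<Otimes>\<^sub>M distr M borel Y = distr M (borel \<Otimes>\<^sub>M borel) (\<lambda>\<omega>. (X \<omega>, Y \<omega>))"
proof (rule pair_measure_eqI)
  let ?\<phi> = "\<lambda>a. CLINT \<omega>|M. iexp (a * X \<omega>)" and ?\<psi> = "\<lambda>b. CLINT \<omega>|M. iexp (b * Y \<omega>)"
  show "sigma_finite_measure (distr M borel X)" "sigma_finite_measure (distr M borel Y)"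
    by (auto intro!: prob_space_imp_sigma_finite prob_space_distr)
  show "sets (distr M borel X \<Otimes>\<^sub>M distr M borel Y) = sets (distr M (borel \<Otimes>\<^sub>M borel) (\<lambda>\<omega>. (X \<omega>, Y \<omega>)))"
    by simp
  fix A B assume "A \<in> sets (distr M borel X)" "B \<in> sets (distr M borel Y)"
  then have [measurable]: "A \<in> sets borel" "B \<in> sets borel" by simp_all
  have iXY: "complex_integrable M (\<lambda>\<omega>. iexp (a * X \<omega> + b * Y \<omega>))" for a b
    by (intro integrable_iexp) auto
  have iY: "complex_integrable M (\<lambda>\<omega>. iexp (b * Y \<omega>))" for b
    by (intro integrable_iexp) auto
  have cos: "expectation (\<lambda>\<omega>. cos (b * Y \<omega>) * indicator A (X \<omega>)) =
      expectation (\<lambda>\<omega>. cos (b * Y \<omega>)) * expectation (\<lambda>\<omega>. indicator A (X \<omega>))" for b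
  proof (rule expectation_indicator_of_factorization[where K=1])
    fix a
    have E: "of_real (cos (b * y)) = (iexp (b * y) + iexp ((- b) * y)) / 2" for y
      by (simp add: cos_exp_eq cos_of_real[symmetric] del: cos_of_real)
    have "complex_of_real (expectation (\<lambda>\<omega>. cos (b * Y \<omega>))) = (CLINT \<omega>|M. (iexp (b * Y \<omega>) + iexp ((- b) * Y \<omega>)) / 2)"
      by (subst integral_complex_of_real[symmetric], subst E) simp
    also have "\<dots> = (?\<psi> b + ?\<psi> (- b)) / 2"
      using iY[of b] iY[of "- b"] by simp
    finally have e: "complex_of_real (expectation (\<lambda>\<omega>. cos (b * Y \<omega>))) = (?\<psi> b + ?\<psi> (- b)) / 2" .
    have "(CLINT \<omega>|M. of_real (cos (b * Y \<omega>)) * iexp (a * X \<omega>)) =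
        (CLINT \<omega>|M. (iexp (a * X \<omega> + b * Y \<omega>) + iexp (a * X \<omega> + (- b) * Y \<omega>)) / 2)"
      by (subst E) (simp add: exp_add exp_diff exp_minus field_simps)
    also have "\<dots> = (?\<phi> a * ?\<psi> b + ?\<phi> a * ?\<psi> (- b)) / 2"
      unfolding fact[symmetric] using iXY[of a b] iXY[of a "- b"] by simp
    finally show "(CLINT \<omega>|M. of_real (cos (b * Y \<omega>)) * iexp (a * X \<omega>)) =
       of_real (expectation (\<lambda>\<omega>. cos (b * Y \<omega>))) * ?\<phi> a"
      unfolding e by (simp add: algebra_simps add_divide_distrib)
  qed auto
  have sin: "expectation (\<lambda>\<omega>. sin (b * Y \<omega>) * indicator A (X \<omega>)) =
      expectation (\<lambda>\<omega>. sin (b * Y \<omega>)) * expectation (\<lambda>\<omega>. indicator A (X \<omega>))" for b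
  proof (rule expectation_indicator_of_factorization[where K=1])
    fix a
    have E: "of_real (sin (b * y)) = (iexp (b * y) - iexp ((- b) * y)) / (2 * \<i>)" for y
      by (simp add: sin_exp_eq sin_of_real[symmetric] del: sin_of_real)
    have "complex_of_real (expectation (\<lambda>\<omega>. sin (b * Y \<omega>))) = (CLINT \<omega>|M. (iexp (b * Y \<omega>) - iexp ((- b) * Y \<omega>)) / (2 * \<i>))"
      by (subst integral_complex_of_real[symmetric], subst E) simp
    also have "\<dots> = (?\<psi> b - ?\<psi> (- b)) / (2 * \<i>)"
      using iY[of b] iY[of "- b"] by simp
    finally have e: "complex_of_real (expectation (\<lambda>\<omega>. sin (b * Y \<omega>))) = (?\<psi> b - ?\<psi> (- b)) / (2 * \<i>)" .
    have "(CLINT \<omega>|M. of_real (sin (b * Y \<omega>)) * iexp (a * X \<omega>)) =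
        (CLINT \<omega>|M. (iexp (a * X \<omega> + b * Y \<omega>) - iexp (a * X \<omega> + (- b) * Y \<omega>)) / (2 * \<i>))"
      by (subst E) (simp add: exp_add exp_diff exp_minus field_simps)
    also have "\<dots> = (?\<phi> a * ?\<psi> b - ?\<phi> a * ?\<psi> (- b)) / (2 * \<i>)"
      unfolding fact[symmetric] using iXY[of a b] iXY[of a "- b"] by simp
    finally show "(CLINT \<omega>|M. of_real (sin (b * Y \<omega>)) * iexp (a * X \<omega>)) =
       of_real (expectation (\<lambda>\<omega>. sin (b * Y \<omega>))) * ?\<phi> a"
      unfolding e by (simp add: algebra_simps diff_divide_distrib)
  qed auto
  have iexp_eq: "iexp z = of_real (cos z) + \<i> * of_real (sin z)" for z :: real
    by (simp add: cis_conv_exp[symmetric] complex_eq_iff)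
  have i1: "integrable M (\<lambda>\<omega>. cos (b * Y \<omega>))" "integrable M (\<lambda>\<omega>. sin (b * Y \<omega>))"
    "integrable M (\<lambda>\<omega>. cos (b * Y \<omega>) * indicator A (X \<omega>))"
    "integrable M (\<lambda>\<omega>. sin (b * Y \<omega>) * indicator A (X \<omega>))" for b
    by (auto intro!: integrable_const_bound[where B=1] simp: indicator_def)
  have parts: "(CLINT \<omega>|M. of_real (f \<omega>) + \<i> * of_real (g \<omega>)) = of_real (expectation f) + \<i> * of_real (expectation g)"
    if f: "integrable M f" and g: "integrable M g" for f g :: "'a \<Rightarrow> real"
  proof -
    have f': "complex_integrable M (\<lambda>\<omega>. of_real (f \<omega>))" using f by simp
    have g': "complex_integrable M (\<lambda>\<omega>. of_real (g \<omega>))" using g by simp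
    have "complex_integrable M (\<lambda>\<omega>. \<i> * of_real (g \<omega>))" by (rule integrable_mult_right) (rule g')
    from Bochner_Integration.integral_add[OF f' this] show ?thesis by simp
  qed
  have "expectation (\<lambda>\<omega>. indicator A (X \<omega>) * indicator B (Y \<omega>) :: real) =
      expectation (\<lambda>\<omega>. indicator A (X \<omega>)) * expectation (\<lambda>\<omega>. indicator B (Y \<omega>))"
  proof (rule expectation_indicator_of_factorization[where K=1 and w="\<lambda>\<omega>. indicator A (X \<omega>)" and X=Y])
    fix b
    have "(CLINT \<omega>|M. of_real (indicator A (X \<omega>)) * iexp (b * Y \<omega>)) =
      (CLINT \<omega>|M. of_real (cos (b * Y \<omega>) * indicator A (X \<omega>)) + \<i> * of_real (sin (b * Y \<omega>) * indicator A (X \<omega>)))"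
      by (subst iexp_eq) (simp add: algebra_simps)
    also have "\<dots> = of_real (expectation (\<lambda>\<omega>. cos (b * Y \<omega>) * indicator A (X \<omega>)))
        + \<i> * of_real (expectation (\<lambda>\<omega>. sin (b * Y \<omega>) * indicator A (X \<omega>)))"
      by (rule parts[OF i1(3,4)])
    also have "\<dots> = of_real (expectation (\<lambda>\<omega>. indicator A (X \<omega>))) *
       (of_real (expectation (\<lambda>\<omega>. cos (b * Y \<omega>))) + \<i> * of_real (expectation (\<lambda>\<omega>. sin (b * Y \<omega>))))"
      unfolding cos sin by (simp add: algebra_simps)
    also have "of_real (expectation (\<lambda>\<omega>. cos (b * Y \<omega>))) + \<i> * of_real (expectation (\<lambda>\<omega>. sin (b * Y \<omega>))) = ?\<psi> b"
      by (subst iexp_eq) (rule parts[OF i1(1,2), symmetric])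
    finally show "(CLINT \<omega>|M. of_real (indicator A (X \<omega>)) * iexp (b * Y \<omega>)) =
        of_real (expectation (\<lambda>\<omega>. indicator A (X \<omega>))) * ?\<psi> b" .
  qed (auto simp: indicator_def)
  moreover have "measure (distr M borel X) A = expectation (\<lambda>\<omega>. indicator A (X \<omega>))"
    using integral_distr[of X M borel "indicator A :: real \<Rightarrow> real"] by simp
  moreover have "measure (distr M borel Y) B = expectation (\<lambda>\<omega>. indicator B (Y \<omega>))"
    using integral_distr[of Y M borel "indicator B :: real \<Rightarrow> real"] by simp
  moreover have "measure (distr M (borel \<Otimes>\<^sub>M borel) (\<lambda>\<omega>. (X \<omega>, Y \<omega>))) (A \<times> B) = expectation (\<lambda>\<omega>. indicator A (X \<omega>) * indicator B (Y \<omega>))"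
    using integral_distr[of "\<lambda>\<omega>. (X \<omega>, Y \<omega>)" M "borel \<Otimes>\<^sub>M borel" "indicator (A \<times> B) :: real \<times> real \<Rightarrow> real"]
    by (simp add: indicator_times)
  ultimately have m: "measure (distr M borel X) A * measure (distr M borel Y) B =
     measure (distr M (borel \<Otimes>\<^sub>M borel) (\<lambda>\<omega>. (X \<omega>, Y \<omega>))) (A \<times> B)" by simp
  interpret DX: prob_space "distr M borel X" by (rule prob_space_distr) simp
  interpret DY: prob_space "distr M borel Y" by (rule prob_space_distr) simp
  interpret DXY: prob_space "distr M (borel \<Otimes>\<^sub>M borel) (\<lambda>\<omega>. (X \<omega>, Y \<omega>))" by (rule prob_space_distr) simp
  show "emeasure (distr M borel X) A * emeasure (distr M borel Y) B =
     emeasure (distr M (borel \<Otimes>\<^sub>M borel) (\<lambda>\<omega>. (X \<omega>, Y \<omega>))) (A \<times> B)"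
    using m by (simp add: DX.emeasure_eq_measure DY.emeasure_eq_measure DXY.emeasure_eq_measure ennreal_mult[symmetric])
qed

section \<open>Planar Gaussian noise\<close>

abbreviation (input) std_normal :: "real measure" where
  "std_normal \<equiv> std_normal_distribution"

lemma prob_std_normal: "prob_space std_normal"
  by (rule prob_space_normal_density) simp

lemma std_normal_iexp: "(CLINT x|std_normal. iexp (a * x)) = of_real (exp (- a\<^sup>2 / 2))"
  using fun_cong[OF char_std_normal_distribution, of a] by (simp add: char_def)

lemma distr_std_normal_shift:
  "distr std_normal borel (\<lambda>g. p + g) = density lborel (normal_density p 1)"
proof -
  interpret prob_space std_normal by (rule prob_std_normal)
  have "distributed std_normal lborel (\<lambda>x. x) (normal_density 0 1)"
    unfolding distributed_def by (simp add: distr_id2)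
  from normal_density_affine[OF this, of 1 p]
  have d: "distributed std_normal lborel (\<lambda>x. p + x) (normal_density p 1)" by simp
  have "distr std_normal borel (\<lambda>g. p + g) = distr std_normal lborel (\<lambda>g. p + g)"
    by (rule distr_cong) auto
  then show ?thesis using distributed_distr_eq_density[OF d] by simp
qed

text \<open>The two densities cross at the midpoint \<open>m\<close>, so among all sets the half-line below \<open>m\<close> maximises the
  difference.  For it the difference is the mass of an interval of length \<open>r - p\<close>, and the density is at
  most \<open>1\<close>.\<close>

lemma std_normal_shift_one_sided:
  assumes A [measurable]: "A \<in> sets borel" and "p < r"
  shows "measure (density lborel (normal_density p 1)) A - measure (density lborel (normal_density r 1)) A \<le> r - p"
proof -
  define m where "m = (p + r) / 2"
  let ?d = "\<lambda>p. density lborel (normal_density p 1)"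
  have pd: "prob_space (?d p)" for p by (rule prob_space_normal_density) simp
  have md: "measure (?d p) A = (\<integral>x. normal_density p 1 x * indicator A x \<partial>lborel)"
    if [measurable]: "A \<in> sets borel" for p A
  proof -
    interpret prob_space "?d p" by (rule pd)
    have "measure (?d p) A = (\<integral>x. indicator A x \<partial>?d p)" by simp
    also have "\<dots> = (\<integral>x. normal_density p 1 x * indicator A x \<partial>lborel)"
      by (subst integral_density) auto
    finally show ?thesis .
  qed
  have id: "integrable lborel (\<lambda>x. normal_density p 1 x * indicator A x)"
    if [measurable]: "A \<in> sets borel" for p :: real and A
    by (rule Bochner_Integration.integrable_bound[OF integrable_normal_density[of 1 p]])
       (auto simp: indicator_def)
  have "measure (?d p) A - measure (?d r) A =
      (\<integral>x. normal_density p 1 x * indicator A x - normal_density r 1 x * indicator A x \<partial>lborel)"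
    using id by (simp add: md)
  also have "\<dots> \<le> (\<integral>x. normal_density p 1 x * indicator {..m} x - normal_density r 1 x * indicator {..m} x \<partial>lborel)"
  proof (rule integral_mono)
    fix x
    have sq: "(x - r)\<^sup>2 - (x - p)\<^sup>2 = 2 * ((r - p) * (m - x))"
      by (simp add: m_def power2_eq_square field_simps)
    show "normal_density p 1 x * indicator A x - normal_density r 1 x * indicator A x \<le>
      normal_density p 1 x * indicator {..m} x - normal_density r 1 x * indicator {..m} x"
    proof (cases "x \<le> m")
      case True
      then have "(x - p)\<^sup>2 \<le> (x - r)\<^sup>2" using sq \<open>p < r\<close> mult_nonneg_nonneg[of "r - p" "m - x"] by linarith
      then have "normal_density r 1 x \<le> normal_density p 1 x"
        by (simp add: normal_density_def divide_right_mono)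
      then show ?thesis using True by (auto simp: indicator_def)
    next
      case False
      then have "(x - r)\<^sup>2 \<le> (x - p)\<^sup>2" using sq \<open>p < r\<close> mult_nonneg_nonneg[of "r - p" "x - m"]
        by (simp add: algebra_simps)
      then have "normal_density p 1 x \<le> normal_density r 1 x"
        by (simp add: normal_density_def divide_right_mono)
      then show ?thesis using False by (auto simp: indicator_def)
    qed
  qed (use id in auto)
  also have "\<dots> = measure (?d p) {..m} - measure (?d r) {..m}"
    using id by (simp add: md)
  also have "\<dots> = measure std_normal {..m - p} - measure std_normal {..m - r}"
  proof -
    have "measure (?d q) {..m} = measure std_normal {..m - q}" for q
    proof -
      have "(\<lambda>g. q + g) -` {..m} \<inter> space std_normal = {..m - q}" by auto
      then show ?thesis
        by (subst distr_std_normal_shift[symmetric], subst measure_distr) auto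
    qed
    then show ?thesis by simp
  qed
  also have "\<dots> = (\<integral>x. normal_density 0 1 x * indicator {..m - p} x - normal_density 0 1 x * indicator {..m - r} x \<partial>lborel)"
    using id[of _ 0] by (simp add: md[of _ 0])
  also have "\<dots> \<le> (\<integral>x. indicator {m - r<..m - p} x \<partial>lborel)"
  proof (rule integral_mono)
    have "1 \<le> sqrt (2 * pi)" using pi_gt3 by simp
    then have "normal_density 0 1 x \<le> 1" for x :: real
      by (simp add: normal_density_def divide_le_eq_1 order_trans[of _ 1])
    then show "normal_density 0 1 x * indicator {..m - p} x - normal_density 0 1 x * indicator {..m - r} x
        \<le> indicator {m - r<..m - p} x" for x
      using \<open>p < r\<close> by (auto simp: indicator_def)
    show "integrable lborel (indicat_real {m - r<..m - p})"
      using \<open>p < r\<close> by (intro integrable_real_indicator) auto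
  qed (use id[of _ 0] in auto)
  also have "\<dots> = r - p" using \<open>p < r\<close> by simp
  finally show ?thesis .
qed

lemma std_normal_shift:
  assumes A [measurable]: "A \<in> sets borel"
  shows "\<bar>measure (distr std_normal borel (\<lambda>g. p + g)) A - measure (distr std_normal borel (\<lambda>g. r + g)) A\<bar> \<le> \<bar>p - r\<bar>"
proof -
  let ?d = "\<lambda>p. density lborel (normal_density p 1)"
  have one_sided: "\<bar>measure (?d p) A - measure (?d r) A\<bar> \<le> r - p" if "p < r" for p r
  proof -
    have c: "measure (?d p) (- A) = 1 - measure (?d p) A" for p
    proof -
      interpret prob_space "?d p" by (rule prob_space_normal_density) simp
      show ?thesis using prob_compl[of A] by (simp add: Compl_eq_Diff_UNIV)
    qed
    have "- A \<in> sets borel" by measurable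
    from std_normal_shift_one_sided[OF A that] std_normal_shift_one_sided[OF this that]
    show ?thesis unfolding c by linarith
  qed
  show ?thesis unfolding distr_std_normal_shift
    using one_sided[of p r] one_sided[of r p] by (cases p r rule: linorder_cases) (auto simp: abs_minus_commute)
qed

lemma measure_pair_measure:
  assumes "prob_space \<mu>" "prob_space \<nu>" and E [measurable]: "E \<in> sets (\<mu> \<Otimes>\<^sub>M \<nu>)"
  shows "measure (\<mu> \<Otimes>\<^sub>M \<nu>) E = (\<integral>x. measure \<nu> (Pair x -` E) \<partial>\<mu>)"
    and "measure (\<mu> \<Otimes>\<^sub>M \<nu>) E = (\<integral>y. measure \<mu> ((\<lambda>x. (x, y)) -` E) \<partial>\<nu>)"
    and "integrable \<mu> (\<lambda>x. measure \<nu> (Pair x -` E))"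
    and "integrable \<nu> (\<lambda>y. measure \<mu> ((\<lambda>x. (x, y)) -` E))"
proof -
  interpret M: prob_space \<mu> by fact
  interpret N: prob_space \<nu> by fact
  interpret P: pair_prob_space \<mu> \<nu> ..
  have m1: "(\<lambda>x. measure \<nu> (Pair x -` E)) \<in> borel_measurable \<mu>"
    unfolding measure_def using N.measurable_emeasure_Pair[OF E] by measurable
  have m2: "(\<lambda>y. measure \<mu> ((\<lambda>x. (x, y)) -` E)) \<in> borel_measurable \<nu>"
    unfolding measure_def using P.measurable_emeasure_Pair2[OF E] by (rule borel_measurable_enn2real)
  show i1: "integrable \<mu> (\<lambda>x. measure \<nu> (Pair x -` E))"
    by (rule M.integrable_const_bound[where B=1, OF _ m1]) (simp add: N.prob_le_1)
  show i2: "integrable \<nu> (\<lambda>y. measure \<mu> ((\<lambda>x. (x, y)) -` E))"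
    by (rule N.integrable_const_bound[where B=1, OF _ m2]) (simp add: M.prob_le_1)
  have "ennreal (measure (\<mu> \<Otimes>\<^sub>M \<nu>) E) = (\<integral>\<^sup>+x. ennreal (measure \<nu> (Pair x -` E)) \<partial>\<mu>)"
    using N.emeasure_pair_measure_alt[OF E] by (simp add: P.emeasure_eq_measure N.emeasure_eq_measure)
  also have "\<dots> = ennreal (\<integral>x. measure \<nu> (Pair x -` E) \<partial>\<mu>)"
    by (rule nn_integral_eq_integral[OF i1]) simp
  finally show "measure (\<mu> \<Otimes>\<^sub>M \<nu>) E = (\<integral>x. measure \<nu> (Pair x -` E) \<partial>\<mu>)" by simp
  have "ennreal (measure (\<mu> \<Otimes>\<^sub>M \<nu>) E) = (\<integral>\<^sup>+y. ennreal (measure \<mu> ((\<lambda>x. (x, y)) -` E)) \<partial>\<nu>)"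
    using P.emeasure_pair_measure_alt2[OF E] by (simp add: P.emeasure_eq_measure M.emeasure_eq_measure)
  also have "\<dots> = ennreal (\<integral>y. measure \<mu> ((\<lambda>x. (x, y)) -` E) \<partial>\<nu>)"
    by (rule nn_integral_eq_integral[OF i2]) simp
  finally show "measure (\<mu> \<Otimes>\<^sub>M \<nu>) E = (\<integral>y. measure \<mu> ((\<lambda>x. (x, y)) -` E) \<partial>\<nu>)" by simp
qed

text \<open>One factor is replaced at a time.\<close>

lemma pair_measure_diff_le:
  fixes \<mu> \<mu>' :: "'a measure" and \<nu> \<nu>' :: "'b measure"
  assumes p: "prob_space \<mu>" "prob_space \<mu>'" "prob_space \<nu>" "prob_space \<nu>'"
    and s [measurable_cong]: "sets \<mu>' = sets \<mu>" "sets \<nu>' = sets \<nu>"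
    and d1: "\<And>A. A \<in> sets \<mu> \<Longrightarrow> \<bar>measure \<mu> A - measure \<mu>' A\<bar> \<le> a"
    and d2: "\<And>A. A \<in> sets \<nu> \<Longrightarrow> \<bar>measure \<nu> A - measure \<nu>' A\<bar> \<le> b"
    and E [measurable]: "E \<in> sets (\<mu> \<Otimes>\<^sub>M \<nu>)"
  shows "\<bar>measure (\<mu> \<Otimes>\<^sub>M \<nu>) E - measure (\<mu>' \<Otimes>\<^sub>M \<nu>') E\<bar> \<le> a + b"
proof -
  have E1: "E \<in> sets (\<mu> \<Otimes>\<^sub>M \<nu>')" and E2: "E \<in> sets (\<mu>' \<Otimes>\<^sub>M \<nu>')" by measurable
  have sec1: "Pair x -` E \<in> sets \<nu>" for x using E by (rule sets_Pair1)
  have sec2: "(\<lambda>x. (x, y)) -` E \<in> sets \<mu>" for y using E by (rule sets_Pair2)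
  have "\<bar>measure (\<mu> \<Otimes>\<^sub>M \<nu>) E - measure (\<mu> \<Otimes>\<^sub>M \<nu>') E\<bar> =
      \<bar>\<integral>x. measure \<nu> (Pair x -` E) - measure \<nu>' (Pair x -` E) \<partial>\<mu>\<bar>"
    using measure_pair_measure(1,3)[OF p(1,3) E] measure_pair_measure(1,3)[OF p(1,4) E1] by simp
  also have "\<dots> \<le> (\<integral>x. \<bar>measure \<nu> (Pair x -` E) - measure \<nu>' (Pair x -` E)\<bar> \<partial>\<mu>)"
    by (rule integral_abs_bound)
  also have "\<dots> \<le> (\<integral>x. b \<partial>\<mu>)"
    using measure_pair_measure(3)[OF p(1,3) E] measure_pair_measure(3)[OF p(1,4) E1]
    by (intro integral_mono d2 sec1) (auto intro!: finite_measure.integrable_const prob_space.finite_measure p)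
  also have "\<dots> = b" using prob_space.prob_space[OF p(1)] by simp
  finally have 1: "\<bar>measure (\<mu> \<Otimes>\<^sub>M \<nu>) E - measure (\<mu> \<Otimes>\<^sub>M \<nu>') E\<bar> \<le> b" .
  have "\<bar>measure (\<mu> \<Otimes>\<^sub>M \<nu>') E - measure (\<mu>' \<Otimes>\<^sub>M \<nu>') E\<bar> =
      \<bar>\<integral>y. measure \<mu> ((\<lambda>x. (x, y)) -` E) - measure \<mu>' ((\<lambda>x. (x, y)) -` E) \<partial>\<nu>'\<bar>"
    using measure_pair_measure(2,4)[OF p(1,4) E1] measure_pair_measure(2,4)[OF p(2,4) E2] by simp
  also have "\<dots> \<le> (\<integral>y. \<bar>measure \<mu> ((\<lambda>x. (x, y)) -` E) - measure \<mu>' ((\<lambda>x. (x, y)) -` E)\<bar> \<partial>\<nu>')"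
    by (rule integral_abs_bound)
  also have "\<dots> \<le> (\<integral>y. a \<partial>\<nu>')"
    using measure_pair_measure(4)[OF p(1,4) E1] measure_pair_measure(4)[OF p(2,4) E2]
    by (intro integral_mono d1 sec2) (auto intro!: finite_measure.integrable_const prob_space.finite_measure p)
  also have "\<dots> = a" using prob_space.prob_space[OF p(4)] by simp
  finally have 2: "\<bar>measure (\<mu> \<Otimes>\<^sub>M \<nu>') E - measure (\<mu>' \<Otimes>\<^sub>M \<nu>') E\<bar> \<le> a" .
  from 1 2 show ?thesis by linarith
qed

text \<open>The triangular (Cholesky) form of a centred Gaussian law in the plane.\<close>

definition planar_gaussian :: "real \<Rightarrow> real \<Rightarrow> real \<Rightarrow> (real \<times> real) measure" where
  "planar_gaussian s1 s2 c =
     distr (std_normal \<Otimes>\<^sub>M std_normal) borel (\<lambda>(g1, g2). (s1 * g1 + c * g2, s2 * g2))"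

lemma measurable_planar [measurable]:
  "(\<lambda>(g1, g2). (s1 * g1 + c * g2, s2 * g2)) \<in> borel \<Otimes>\<^sub>M borel \<rightarrow>\<^sub>M (borel :: (real \<times> real) measure)"
  by (subst borel_prod[symmetric]) measurable

lemma planar_gaussian_prob:
  "prob_space (planar_gaussian s1 s2 c)" "sets (planar_gaussian s1 s2 c) = sets borel"
proof -
  interpret N: prob_space std_normal by (rule prob_std_normal)
  interpret P: pair_prob_space std_normal std_normal ..
  show "prob_space (planar_gaussian s1 s2 c)" unfolding planar_gaussian_def
    by (rule P.prob_space_distr) measurable
qed (simp add: planar_gaussian_def)

lemma charfun_planar_gaussian:
  "charfun (planar_gaussian s1 s2 c) (a, b) = of_real (exp (- ((s1 * a)\<^sup>2 + (c * a + s2 * b)\<^sup>2) / 2))"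
proof -
  interpret N: prob_space std_normal by (rule prob_std_normal)
  interpret P: pair_prob_space std_normal std_normal ..
  have i: "complex_integrable (std_normal \<Otimes>\<^sub>M std_normal)
     (\<lambda>(g1, g2). iexp ((s1 * a) * g1) * iexp ((c * a + s2 * b) * g2))"
    by (rule P.integrable_const_bound[where B=1]) (auto simp: norm_mult norm_exp_i_times simp del: of_real_mult)
  have "charfun (planar_gaussian s1 s2 c) (a, b) =
      (CLINT g|std_normal \<Otimes>\<^sub>M std_normal. iexp ((a, b) \<bullet> (case g of (g1, g2) \<Rightarrow> (s1 * g1 + c * g2, s2 * g2))))"
    unfolding charfun_def planar_gaussian_def by (rule integral_distr) measurable
  also have "\<dots> = (CLINT g|std_normal \<Otimes>\<^sub>M std_normal. (case g of (g1, g2) \<Rightarrow> iexp ((s1 * a) * g1) * iexp ((c * a + s2 * b) * g2)))"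
    by (intro Bochner_Integration.integral_cong) (auto simp: exp_add[symmetric] algebra_simps)
  also have "\<dots> = (CLINT g1|std_normal. CLINT g2|std_normal. iexp ((s1 * a) * g1) * iexp ((c * a + s2 * b) * g2))"
    using P.integral_fst'[OF i] by simp
  also have "\<dots> = (CLINT g1|std_normal. iexp ((s1 * a) * g1)) * (CLINT g2|std_normal. iexp ((c * a + s2 * b) * g2))"
    by (simp del: of_real_mult of_real_add)
  also have "\<dots> = of_real (exp (- ((s1 * a)\<^sup>2 + (c * a + s2 * b)\<^sup>2) / 2))"
    unfolding std_normal_iexp by (simp add: exp_add[symmetric] flip: of_real_mult)
  finally show ?thesis .
qed

lemma planar_gaussian_moment:
  "integrable (planar_gaussian s1 s2 c) norm"
proof -
  interpret N: prob_space std_normal by (rule prob_std_normal)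
  interpret P: pair_prob_space std_normal std_normal ..
  have i: "integrable std_normal (\<lambda>x. \<bar>x\<bar>)"
    using integrable_std_normal_distribution_moment[of 1] by (intro integrable_abs) simp
  have "integrable (distr (std_normal \<Otimes>\<^sub>M std_normal) std_normal fst) (\<lambda>x. \<bar>x\<bar>)"
    unfolding N.distr_pair_fst by (rule i)
  then have f: "integrable (std_normal \<Otimes>\<^sub>M std_normal) (\<lambda>g. \<bar>fst g\<bar>)"
    by (subst (asm) integrable_distr_eq) auto
  from P.integrable_product_swap[OF f]
  have s: "integrable (std_normal \<Otimes>\<^sub>M std_normal) (\<lambda>g. \<bar>snd g\<bar>)" by (simp add: case_prod_unfold)
  have "integrable (std_normal \<Otimes>\<^sub>M std_normal) (\<lambda>g. norm (case g of (g1, g2) \<Rightarrow> (s1 * g1 + c * g2, s2 * g2)))"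
  proof (rule Bochner_Integration.integrable_bound)
    show "integrable (std_normal \<Otimes>\<^sub>M std_normal) (\<lambda>g. \<bar>s1\<bar> * \<bar>fst g\<bar> + (\<bar>c\<bar> + \<bar>s2\<bar>) * \<bar>snd g\<bar>)"
      using f s by auto
    show "AE g in std_normal \<Otimes>\<^sub>M std_normal. norm (norm (case g of (g1, g2) \<Rightarrow> (s1 * g1 + c * g2, s2 * g2)))
        \<le> norm (\<bar>s1\<bar> * \<bar>fst g\<bar> + (\<bar>c\<bar> + \<bar>s2\<bar>) * \<bar>snd g\<bar>)"
    proof (rule AE_I2)
      fix g :: "real \<times> real"
      obtain g1 g2 where g: "g = (g1, g2)" by (cases g)
      have "norm (s1 * g1 + c * g2, s2 * g2) \<le> \<bar>s1 * g1 + c * g2\<bar> + \<bar>s2 * g2\<bar>"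
        using norm_Pair_le[of "s1 * g1 + c * g2" "s2 * g2"] by simp
      also have "\<dots> \<le> \<bar>s1\<bar> * \<bar>g1\<bar> + \<bar>c\<bar> * \<bar>g2\<bar> + \<bar>s2\<bar> * \<bar>g2\<bar>"
        using abs_triangle_ineq[of "s1 * g1" "c * g2"] by (simp add: abs_mult)
      finally show "norm (norm (case g of (g1, g2) \<Rightarrow> (s1 * g1 + c * g2, s2 * g2)))
        \<le> norm (\<bar>s1\<bar> * \<bar>fst g\<bar> + (\<bar>c\<bar> + \<bar>s2\<bar>) * \<bar>snd g\<bar>)"
        by (simp add: g algebra_simps)
    qed
  qed (intro measurable_compose[OF _ borel_measurable_norm], measurable)
  then show ?thesis unfolding planar_gaussian_def
    by (subst integrable_distr_eq) measurable
qed

text \<open>Translating a linear image of the standard Gaussian is the same as translating its independent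
  components, which reduces the estimate to dimension one.\<close>

lemma planar_gaussian_shift:
  assumes s: "s1 > 0" "s2 > 0" and A [measurable]: "A \<in> sets borel"
  shows "\<bar>measure (distr (planar_gaussian s1 s2 c) borel (\<lambda>z. a + z)) A
      - measure (distr (planar_gaussian s1 s2 c) borel (\<lambda>z. b + z)) A\<bar>
    \<le> ((1 + \<bar>c\<bar> / s2) / s1 + 1 / s2) * norm (a - b)"
proof -
  interpret N: prob_space std_normal by (rule prob_std_normal)
  let ?lin = "\<lambda>(g1, g2). (s1 * g1 + c * g2, s2 * g2)"
  let ?sh = "\<lambda>p. distr std_normal borel (\<lambda>g. p + g)"
  define p1 p2 where "p1 a = (fst a - c * (snd a / s2)) / s1" and "p2 a = snd a / s2" for a :: "real \<times> real"
  have psh: "prob_space (?sh p)" for p by (rule N.prob_space_distr) simp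
  have eq: "distr (planar_gaussian s1 s2 c) borel (\<lambda>z. a + z) = distr (?sh (p1 a) \<Otimes>\<^sub>M ?sh (p2 a)) borel ?lin" for a
  proof -
    have "distr (planar_gaussian s1 s2 c) borel (\<lambda>z. a + z) = distr (std_normal \<Otimes>\<^sub>M std_normal) borel ((\<lambda>z. a + z) \<circ> ?lin)"
      unfolding planar_gaussian_def by (rule distr_distr) measurable
    also have "(\<lambda>z. a + z) \<circ> ?lin = ?lin \<circ> (\<lambda>(g1, g2). (p1 a + g1, p2 a + g2))"
      using s by (auto simp: fun_eq_iff p1_def p2_def prod_eq_iff field_simps)
    also have "distr (std_normal \<Otimes>\<^sub>M std_normal) borel (?lin \<circ> (\<lambda>(g1, g2). (p1 a + g1, p2 a + g2))) =
       distr (distr (std_normal \<Otimes>\<^sub>M std_normal) (borel \<Otimes>\<^sub>M borel) (\<lambda>(g1, g2). (p1 a + g1, p2 a + g2))) borel ?lin"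
      by (rule distr_distr[symmetric]) measurable
    also have "distr (std_normal \<Otimes>\<^sub>M std_normal) (borel \<Otimes>\<^sub>M borel) (\<lambda>(g1, g2). (p1 a + g1, p2 a + g2)) = ?sh (p1 a) \<Otimes>\<^sub>M ?sh (p2 a)"
      by (rule pair_measure_distr[symmetric]) (auto intro!: prob_space_imp_sigma_finite psh)
    finally show ?thesis .
  qed
  let ?E = "?lin -` A \<inter> space (borel \<Otimes>\<^sub>M borel)"
  have E: "?E \<in> sets (borel \<Otimes>\<^sub>M borel)" by (rule measurable_sets[OF measurable_planar A])
  have meas: "measure (distr (?sh p \<Otimes>\<^sub>M ?sh q) borel ?lin) A = measure (?sh p \<Otimes>\<^sub>M ?sh q) ?E" for p q
    by (subst measure_distr) (auto simp: space_pair_measure)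
  have "\<bar>measure (?sh (p1 a) \<Otimes>\<^sub>M ?sh (p2 a)) ?E - measure (?sh (p1 b) \<Otimes>\<^sub>M ?sh (p2 b)) ?E\<bar>
     \<le> \<bar>p1 a - p1 b\<bar> + \<bar>p2 a - p2 b\<bar>"
  proof (rule pair_measure_diff_le)
    show "?E \<in> sets (?sh (p1 a) \<Otimes>\<^sub>M ?sh (p2 a))" using E by simp
  qed (auto intro!: psh std_normal_shift)
  also have "\<dots> \<le> ((1 + \<bar>c\<bar> / s2) / s1 + 1 / s2) * norm (a - b)"
  proof -
    have n: "\<bar>fst (a - b)\<bar> \<le> norm (a - b)" "\<bar>snd (a - b)\<bar> \<le> norm (a - b)"
      using norm_fst_le[of "fst (a - b)" "snd (a - b)"] norm_snd_le[of "snd (a - b)" "fst (a - b)"]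
      by (simp_all only: prod.collapse real_norm_def)
    have "p2 a - p2 b = snd (a - b) / s2" by (simp add: p2_def diff_divide_distrib)
    then have e2: "\<bar>p2 a - p2 b\<bar> \<le> norm (a - b) / s2" using n s by (simp add: divide_right_mono)
    have "p1 a - p1 b = (fst (a - b) - c * (snd (a - b) / s2)) / s1"
      by (simp add: p1_def diff_divide_distrib add_divide_distrib algebra_simps)
    then have "\<bar>p1 a - p1 b\<bar> = \<bar>fst (a - b) - c * (snd (a - b) / s2)\<bar> / s1" using s by simp
    also have "\<dots> \<le> (norm (a - b) + \<bar>c\<bar> * (norm (a - b) / s2)) / s1"
    proof (rule divide_right_mono)
      have "\<bar>c * (snd (a - b) / s2)\<bar> \<le> \<bar>c\<bar> * (norm (a - b) / s2)"
        using n s by (simp only: abs_mult abs_divide) (intro mult_left_mono, auto intro: divide_right_mono)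
      then show "\<bar>fst (a - b) - c * (snd (a - b) / s2)\<bar> \<le> norm (a - b) + \<bar>c\<bar> * (norm (a - b) / s2)"
        using n(1) by linarith
    qed (use s in simp)
    finally show ?thesis using e2 by (simp add: algebra_simps add_divide_distrib)
  qed
  finally show ?thesis unfolding eq meas .
qed

lemma set_integral_pos_of_continuous:
  fixes g :: "real \<Rightarrow> real"
  assumes g: "continuous_on {a..b} g" and "a < b" and nonneg: "\<And>x. x \<in> {a..b} \<Longrightarrow> g x \<ge> 0"
    and x: "x \<in> {a..b}" "g x \<noteq> 0"
  shows "(\<integral>s\<in>{a..b}. g s \<partial>lborel) > 0"
proof -
  have eq: "(\<integral>s\<in>{a..b}. g s \<partial>lborel) = integral {a..b} g"
    by (intro set_borel_integral_eq_integral borel_integrable_atLeastAtMost' g)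
  have "integral {a..b} g \<noteq> 0" using integral_eq_0_iff[OF g \<open>a < b\<close> nonneg] x by blast
  moreover have "integral {a..b} g \<ge> 0"
    by (intro integral_nonneg integrable_continuous_real g nonneg)
  ultimately show ?thesis unfolding eq by simp
qed

text \<open>The quadratic form \<open>Q\<close> is the covariance of the noise.  It is positive definite because no nontrivial
  combination of the two continuous integrands vanishes identically on the interval.\<close>

lemma noise_law_planar_gaussian:
  assumes "prob_space M" and h: "h > 0" and \<gamma>: "\<gamma> > 0"
    and W: "brownian_motion M W"
    and Z: "has_wiener_integral M W h (\<lambda>t. ((1 - exp (- \<gamma> * (h - t))) / \<gamma>, exp (- \<gamma> * (h - t)))) Z"
    and \<zeta>: "\<zeta> = (\<lambda>\<omega>. sqrt (2 * \<gamma>) *\<^sub>R Z \<omega>)"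
  shows "\<exists>s1 s2 c. s1 > 0 \<and> s2 > 0 \<and> distr M borel \<zeta> = planar_gaussian s1 s2 c"
proof -
  interpret prob_space M by fact
  define p r where "p t = (1 - exp (- \<gamma> * (h - t))) / \<gamma>" and "r t = exp (- \<gamma> * (h - t))" for t
  have cp: "continuous_on {0..h} p" and cr: "continuous_on {0..h} r"
    unfolding p_def r_def using \<gamma> by (auto intro!: continuous_intros)
  note ci = continuous_on_mult continuous_on_add continuous_on_const cp cr continuous_on_power
  define I where "I f = 2 * \<gamma> * (\<integral>s\<in>{0..h}. f s \<partial>lborel)" for f :: "real \<Rightarrow> real"
  define q11 q12 q22 where "q11 = I (\<lambda>s. (p s)\<^sup>2)" and "q12 = I (\<lambda>s. p s * r s)" and "q22 = I (\<lambda>s. (r s)\<^sup>2)"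
  define Q where "Q a b = I (\<lambda>s. (a * p s + b * r s)\<^sup>2)" for a b
  have int: "set_integrable lborel {0..h} f" if "continuous_on {0..h} f" for f :: "real \<Rightarrow> real"
    by (rule borel_integrable_atLeastAtMost'[OF that])
  have Q_eq: "Q a b = a\<^sup>2 * q11 + 2 * a * b * q12 + b\<^sup>2 * q22" for a b
  proof -
    have "(\<integral>s\<in>{0..h}. (a * p s + b * r s)\<^sup>2 \<partial>lborel) =
       (\<integral>s\<in>{0..h}. (a\<^sup>2 * (p s)\<^sup>2 + 2 * a * b * (p s * r s)) + b\<^sup>2 * (r s)\<^sup>2 \<partial>lborel)"
      by (simp add: power2_eq_square algebra_simps)
    also have "\<dots> = a\<^sup>2 * (\<integral>s\<in>{0..h}. (p s)\<^sup>2 \<partial>lborel) + 2 * a * b * (\<integral>s\<in>{0..h}. p s * r s \<partial>lborel)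
        + b\<^sup>2 * (\<integral>s\<in>{0..h}. (r s)\<^sup>2 \<partial>lborel)"
      by (subst set_integral_add, (intro int ci)+, subst set_integral_add, (intro int ci)+) simp
    finally show ?thesis
      unfolding Q_def I_def q11_def q12_def q22_def by (simp add: algebra_simps)
  qed
  have Q_pos: "Q a b > 0" if "a \<noteq> 0 \<or> b \<noteq> 0" for a b
  proof -
    have ab: "\<exists>s\<in>{0..h}. (a * p s + b * r s)\<^sup>2 \<noteq> 0"
    proof (cases "b = 0")
      case True
      then have "a \<noteq> 0" using that by simp
      have "exp (- \<gamma> * h) < 1" using \<gamma> h by simp
      then have "p 0 \<noteq> 0" using \<gamma> h by (simp add: p_def)
      then show ?thesis using True \<open>a \<noteq> 0\<close> h by (intro bexI[of _ 0]) auto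
    next
      case False
      \<comment> \<open>at the right end point the position component of the integrand vanishes\<close>
      then show ?thesis using h by (intro bexI[of _ h]) (auto simp: p_def r_def)
    qed
    then obtain s where s: "s \<in> {0..h}" "(a * p s + b * r s)\<^sup>2 \<noteq> 0" by blast
    have "(\<integral>s\<in>{0..h}. (a * p s + b * r s)\<^sup>2 \<partial>lborel) > 0"
      by (rule set_integral_pos_of_continuous[where g="\<lambda>s. (a * p s + b * r s)\<^sup>2", OF _ h _ s]) (intro ci, simp)
    then show ?thesis using \<gamma> by (simp add: Q_def I_def)
  qed
  have \<zeta>m [measurable]: "\<zeta> \<in> borel_measurable M"
    using Z unfolding \<zeta> has_wiener_integral_def by (auto intro: borel_measurable_scaleR)
  have cf: "continuous_on {0..h} (\<lambda>t. (p t, r t))" by (intro continuous_on_Pair cp cr)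
  have joint: "(CLINT \<omega>|M. iexp (a * fst (\<zeta> \<omega>) + b * snd (\<zeta> \<omega>))) = of_real (exp (- Q a b / 2))" for a b
  proof -
    let ?a = "(sqrt (2 * \<gamma>) * a, sqrt (2 * \<gamma>) * b)"
    have in_eq: "a * fst (\<zeta> \<omega>) + b * snd (\<zeta> \<omega>) = ?a \<bullet> Z \<omega>" for \<omega>
      by (simp add: \<zeta> inner_prod_def algebra_simps)
    have "(?a \<bullet> (p s, r s))\<^sup>2 = 2 * \<gamma> * (a * p s + b * r s)\<^sup>2" for s
    proof -
      have "?a \<bullet> (p s, r s) = sqrt (2 * \<gamma>) * (a * p s + b * r s)" by (simp add: algebra_simps)
      then show ?thesis using \<gamma> by (simp only: power_mult_distrib) simp
    qed
    then have "(\<integral>s\<in>{0..h}. (?a \<bullet> (p s, r s))\<^sup>2 \<partial>lborel) = Q a b"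
      unfolding Q_def I_def by simp
    with wiener_integral_iexp[OF W Z[folded p_def r_def] cf, of ?a] show ?thesis
      unfolding in_eq by simp
  qed
  define s2 k where "s2 = sqrt q22" and "k = q12 / q22"
  define s1 where "s1 = sqrt (Q 1 (- k))"
  have q22: "q22 > 0" using Q_pos[of 0 1] by (simp add: Q_eq)
  have s: "s1 > 0" "s2 > 0" using q22 Q_pos[of 1 "- k"] by (simp_all add: s1_def s2_def)
  have q12: "q12 = k * q22" using q22 by (simp add: k_def)
  \<comment> \<open>subtracting the regression of the position noise on the velocity noise decorrelates the pair\<close>
  define X Y where "X \<omega> = (fst (\<zeta> \<omega>) - k * snd (\<zeta> \<omega>)) / s1" and "Y \<omega> = snd (\<zeta> \<omega>) / s2" for \<omega>
  have fs [measurable]: "(\<lambda>\<omega>. fst (\<zeta> \<omega>)) \<in> borel_measurable M" "(\<lambda>\<omega>. snd (\<zeta> \<omega>)) \<in> borel_measurable M"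
    by (auto intro!: borel_measurable_continuous_on[OF _ \<zeta>m] continuous_intros)
  have XYm [measurable]: "X \<in> borel_measurable M" "Y \<in> borel_measurable M"
    unfolding X_def Y_def by measurable
  have XY: "(CLINT \<omega>|M. iexp (a * X \<omega> + b * Y \<omega>)) = of_real (exp (- (a\<^sup>2 + b\<^sup>2) / 2))" for a b
  proof -
    have "a * X \<omega> + b * Y \<omega> = (a / s1) * fst (\<zeta> \<omega>) + (b / s2 - k * (a / s1)) * snd (\<zeta> \<omega>)" for \<omega>
      using s by (simp add: X_def Y_def field_simps)
    moreover have "Q (a / s1) (b / s2 - k * (a / s1)) = a\<^sup>2 + b\<^sup>2"
    proof -
      have "Q x (y - k * x) = x\<^sup>2 * Q 1 (- k) + y\<^sup>2 * q22" for x y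
        unfolding Q_eq q12 by (simp add: power2_eq_square algebra_simps)
      from this[of "a / s1" "b / s2"]
      have "Q (a / s1) (b / s2 - k * (a / s1)) = (a / s1)\<^sup>2 * Q 1 (- k) + (b / s2)\<^sup>2 * q22" .
      also have "Q 1 (- k) = s1\<^sup>2" using Q_pos[of 1 "- k"] by (simp add: s1_def)
      also have "q22 = s2\<^sup>2" using q22 by (simp add: s2_def)
      finally show ?thesis using s by (simp add: power_divide)
    qed
    ultimately show ?thesis using joint[of "a / s1" "b / s2 - k * (a / s1)"] by simp
  qed
  have X1: "(CLINT \<omega>|M. iexp (a * X \<omega>)) = of_real (exp (- a\<^sup>2 / 2))" for a using XY[of a 0] by simp
  have Y1: "(CLINT \<omega>|M. iexp (b * Y \<omega>)) = of_real (exp (- b\<^sup>2 / 2))" for b using XY[of 0 b] by simp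
  have normal: "distr M borel V = std_normal"
    if V [measurable]: "V \<in> borel_measurable M" and c: "\<And>a. (CLINT \<omega>|M. iexp (a * V \<omega>)) = of_real (exp (- a\<^sup>2 / 2))" for V
  proof (rule Levy_uniqueness)
    show "char (distr M borel V) = char std_normal"
    proof
      fix a
      have "char (distr M borel V) a = (CLINT \<omega>|M. iexp (a * V \<omega>))"
        unfolding char_def by (subst integral_distr) auto
      then show "char (distr M borel V) a = char std_normal a"
        unfolding c char_std_normal_distribution .
    qed
  qed (auto intro!: real_dist_normal_dist real_distribution_distr)
  have "distr M borel X \<Otimes>\<^sub>M distr M borel Y = distr M (borel \<Otimes>\<^sub>M borel) (\<lambda>\<omega>. (X \<omega>, Y \<omega>))"
    by (rule pair_distr_eq_of_char_factorization[OF XYm])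
      (simp only: XY X1 Y1 of_real_mult[symmetric] exp_add[symmetric], simp add: add_divide_distrib diff_divide_distrib)
  then have pair: "distr M (borel \<Otimes>\<^sub>M borel) (\<lambda>\<omega>. (X \<omega>, Y \<omega>)) = std_normal \<Otimes>\<^sub>M std_normal"
    by (simp add: normal[OF XYm(1) X1] normal[OF XYm(2) Y1])
  have "\<zeta> = (\<lambda>(g1, g2). (s1 * g1 + (k * s2) * g2, s2 * g2)) \<circ> (\<lambda>\<omega>. (X \<omega>, Y \<omega>))"
    using s by (auto simp: fun_eq_iff X_def Y_def prod_eq_iff)
  then have "distr M borel \<zeta> = distr M borel ((\<lambda>(g1, g2). (s1 * g1 + (k * s2) * g2, s2 * g2)) \<circ> (\<lambda>\<omega>. (X \<omega>, Y \<omega>)))"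
    by simp
  also have "\<dots> = distr (distr M (borel \<Otimes>\<^sub>M borel) (\<lambda>\<omega>. (X \<omega>, Y \<omega>))) borel (\<lambda>(g1, g2). (s1 * g1 + (k * s2) * g2, s2 * g2))"
    by (rule distr_distr[symmetric]) measurable
  also have "\<dots> = planar_gaussian s1 s2 (k * s2)" unfolding pair planar_gaussian_def ..
  finally show ?thesis using s by blast
qed

section \<open>The spectrum of the drift matrix\<close>

definition drift_trace :: "real \<Rightarrow> real \<Rightarrow> real \<Rightarrow> real" where
  "drift_trace h \<gamma> l = 1 - (\<gamma> * h + exp (- \<gamma> * h) - 1) / \<gamma>\<^sup>2 * l + exp (- \<gamma> * h)"

definition drift_det :: "real \<Rightarrow> real \<Rightarrow> real \<Rightarrow> real" where
  "drift_det h \<gamma> l = exp (- \<gamma> * h) + l / \<gamma>\<^sup>2 * (1 - exp (- \<gamma> * h) - \<gamma> * h * exp (- \<gamma> * h))"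

lemma integrator_matrix_roots:
  assumes "\<gamma> > 0"
  obtains z w where "root_pair (drift_trace h \<gamma> l) (drift_det h \<gamma> l) z w"
    "real_spectral_radius (integrator_matrix h \<gamma> l) = max (cmod z) (cmod w)"
proof -
  obtain z w where rp: "root_pair (drift_trace h \<gamma> l) (drift_det h \<gamma> l) z w"
    by (rule root_pair_exists)
  then have zw: "z + w = of_real (drift_trace h \<gamma> l)" "z * w = of_real (drift_det h \<gamma> l)"
    by (simp_all add: root_pair_def)
  define \<beta> u where "\<beta> = exp (- \<gamma> * h)" and "u = 1 / \<gamma>\<^sup>2"
  have "real_spectral_radius (integrator_matrix h \<gamma> l) = max (cmod z) (cmod w)"
    unfolding integrator_matrix_def Let_def
  proof (rule real_spectral_radius_2x2)
    show "z + w = complex_of_real (1 - 1 / \<gamma>\<^sup>2 * (\<gamma> * h + exp (- \<gamma> * h) - 1) * l + exp (- \<gamma> * h))"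
      unfolding zw(1) drift_trace_def by simp
    have "(1 - \<beta>) / \<gamma> * (- (1 - \<beta>) * l / \<gamma>) = - (1 - \<beta>) * (1 - \<beta>) * l * u"
      by (simp add: u_def power2_eq_square)
    then have "(1 - u * (\<gamma> * h + \<beta> - 1) * l) * \<beta> - (1 - \<beta>) / \<gamma> * (- (1 - \<beta>) * l / \<gamma>) =
       \<beta> + l * u * (1 - \<beta> - \<gamma> * h * \<beta>)"
      by (simp only:) (simp add: algebra_simps)
    then show "z * w = complex_of_real ((1 - 1 / \<gamma>\<^sup>2 * (\<gamma> * h + exp (- \<gamma> * h) - 1) * l) * exp (- \<gamma> * h) -
        (1 - exp (- \<gamma> * h)) / \<gamma> * (- (1 - exp (- \<gamma> * h)) * l / \<gamma>))"
      unfolding zw(2) drift_det_def \<beta>_def u_def by simp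
  qed
  with rp show ?thesis by (rule that)
qed

context
  fixes h \<gamma> :: real
  assumes h: "h > 0" and \<gamma>: "\<gamma> > 0"
begin

lemma friction_step_pos: "\<gamma> * h > 0" using h \<gamma> by simp

lemma beta_bounds: "exp (- \<gamma> * h) < 1" "exp (- \<gamma> * h) > 0"
  using friction_step_pos by simp_all

lemma exp_above_tangent: "\<gamma> * h + exp (- \<gamma> * h) - 1 > 0"
  using exp_ge_add_one_self[of "- \<gamma> * h"] exp_minus_greater[of "\<gamma> * h"] friction_step_pos h \<gamma> by simp

lemma exp_tangent_gap_pos: "1 - exp (- \<gamma> * h) - \<gamma> * h * exp (- \<gamma> * h) > 0"
proof -
  have "1 + \<gamma> * h < exp (\<gamma> * h)" using exp_minus_greater[of "- (\<gamma> * h)"] friction_step_pos h \<gamma> by simp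
  then have "(1 + \<gamma> * h) * exp (- \<gamma> * h) < exp (\<gamma> * h) * exp (- \<gamma> * h)" by simp
  also have "\<dots> = 1" by (simp add: exp_minus_inverse)
  finally show ?thesis by (simp add: algebra_simps)
qed

lemma drift_det_pos: "l > 0 \<Longrightarrow> drift_det h \<gamma> l > 0"
  unfolding drift_det_def using exp_tangent_gap_pos \<gamma> by (intro add_pos_pos mult_pos_pos divide_pos_pos) auto

lemma drift_at_one: "1 - drift_trace h \<gamma> l + drift_det h \<gamma> l = l / \<gamma>\<^sup>2 * (\<gamma> * h * (1 - exp (- \<gamma> * h)))"
  unfolding drift_trace_def drift_det_def by (simp add: algebra_simps add_divide_distrib diff_divide_distrib)

text \<open>The Jury quantities are affine in \<open>l\<close> and satisfy the weak inequalities at \<open>l = 0\<close>; the parameter \<open>l\<close>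
  lies on the segment from \<open>0\<close> to \<open>\<kappa>\<close>.\<close>

lemma schur_stable_mono:
  assumes "schur_stable (integrator_matrix h \<gamma> \<kappa>)" and l: "0 < l" "l \<le> \<kappa>"
  shows "schur_stable (integrator_matrix h \<gamma> l)"
proof -
  define \<beta> A B where "\<beta> = exp (- \<gamma> * h)" and "A = (\<gamma> * h + \<beta> - 1) / \<gamma>\<^sup>2" and "B = (1 - \<beta> - \<gamma> * h * \<beta>) / \<gamma>\<^sup>2"
  have tr: "drift_trace h \<gamma> l = 1 - A * l + \<beta>" and dt: "drift_det h \<gamma> l = \<beta> + l * B" for l
    by (simp_all add: drift_trace_def drift_det_def A_def B_def \<beta>_def)
  have \<beta>: "0 < \<beta>" "\<beta> < 1" using beta_bounds by (simp_all add: \<beta>_def)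
  obtain z w where zw: "root_pair (drift_trace h \<gamma> \<kappa>) (drift_det h \<gamma> \<kappa>) z w"
    "real_spectral_radius (integrator_matrix h \<gamma> \<kappa>) = max (cmod z) (cmod w)"
    by (rule integrator_matrix_roots[OF \<gamma>])
  have st: "max (cmod z) (cmod w) < 1" using assms(1) zw(2) by (simp add: schur_stable_def)
  note nec = jury_necessary[OF zw(1) st]
  define t where "t = l / \<kappa>"
  have t: "0 < t" "t \<le> 1" "l = t * \<kappa>" using l by (simp_all add: t_def)
  have "drift_det h \<gamma> l < 1"
  proof -
    have "drift_det h \<gamma> l = (1 - t) * \<beta> + t * drift_det h \<gamma> \<kappa>" unfolding dt t(3) by (simp add: algebra_simps)
    also have "\<dots> < (1 - t) * 1 + t * 1"
      using nec(1) \<beta> t by (intro add_le_less_mono mult_left_mono mult_strict_left_mono) auto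
    finally have "drift_det h \<gamma> l < (1 - t) * 1 + t * 1" .
    then show ?thesis by simp
  qed
  moreover have "1 + drift_trace h \<gamma> l + drift_det h \<gamma> l > 0"
  proof -
    have "1 + drift_trace h \<gamma> l + drift_det h \<gamma> l =
       (1 - t) * (2 + 2 * \<beta>) + t * (1 + drift_trace h \<gamma> \<kappa> + drift_det h \<gamma> \<kappa>)"
      unfolding tr dt t(3) by (simp add: algebra_simps)
    also have "\<dots> > 0"
    proof (rule add_nonneg_pos)
      show "0 \<le> (1 - t) * (2 + 2 * \<beta>)" using \<beta> t by (intro mult_nonneg_nonneg) auto
      show "0 < t * (1 + drift_trace h \<gamma> \<kappa> + drift_det h \<gamma> \<kappa>)" using nec(2) t(1) by (rule mult_pos_pos[rotated])
    qed
    finally show ?thesis .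
  qed
  moreover have "1 - drift_trace h \<gamma> l + drift_det h \<gamma> l > 0"
    unfolding drift_at_one using l h \<gamma> beta_bounds by (intro mult_pos_pos divide_pos_pos) auto
  moreover obtain z' w' where zw': "root_pair (drift_trace h \<gamma> l) (drift_det h \<gamma> l) z' w'"
    "real_spectral_radius (integrator_matrix h \<gamma> l) = max (cmod z') (cmod w')"
    by (rule integrator_matrix_roots[OF \<gamma>])
  ultimately show ?thesis
    using jury_sufficient[OF zw'(1) drift_det_pos[OF l(1)]] zw'(2) by (simp add: schur_stable_def)
qed

text \<open>Two regimes.  For \<open>\<gamma> h \<le> 4\<close> the determinant condition is the binding one, through the quadratic lower
  bound of the exponential; beyond \<open>4\<close> the condition at \<open>-1\<close> is, because its coefficient grows linearly
  in \<open>\<gamma> h\<close>.\<close>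

lemma stability_step_bound:
  assumes \<kappa>: "\<kappa> > 0" and st: "schur_stable (integrator_matrix h \<gamma> \<kappa>)"
  shows "\<gamma> * h / \<gamma>\<^sup>2 \<le> 16 / \<kappa>"
proof -
  define x \<beta> u where "x = \<gamma> * h" and "\<beta> = exp (- \<gamma> * h)" and "u = 1 / \<gamma>\<^sup>2"
  have x: "x > 0" and \<beta>: "0 < \<beta>" "\<beta> < 1" and u: "u > 0"
    using friction_step_pos beta_bounds \<gamma> by (simp_all add: x_def \<beta>_def u_def)
  obtain z w where zw: "root_pair (drift_trace h \<gamma> \<kappa>) (drift_det h \<gamma> \<kappa>) z w"
    "real_spectral_radius (integrator_matrix h \<gamma> \<kappa>) = max (cmod z) (cmod w)"
    by (rule integrator_matrix_roots[OF \<gamma>])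
  have "max (cmod z) (cmod w) < 1" using st zw(2) by (simp add: schur_stable_def)
  note nec = jury_necessary[OF zw(1) this]
  have tr: "drift_trace h \<gamma> \<kappa> = 1 - \<kappa> * u * (x + \<beta> - 1) + \<beta>"
    and dt: "drift_det h \<gamma> \<kappa> = \<beta> + \<kappa> * u * (1 - \<beta> - x * \<beta>)"
    by (simp_all add: drift_trace_def drift_det_def x_def \<beta>_def u_def)
  have ku: "\<kappa> * u > 0" using \<kappa> u by simp
  have "\<kappa> * u * x \<le> 16"
  proof (cases "x \<le> 4")
    case True
    have E: "exp x * \<beta> = 1" by (simp add: \<beta>_def x_def exp_minus_inverse)
    have "1 + x + x\<^sup>2 / 2 \<le> exp x" using x by (intro exp_lower_Taylor_quadratic) simp
    then have "(1 + x + x\<^sup>2 / 2) * (16 - x) \<le> exp x * (16 - x)" using True by (intro mult_right_mono) auto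
    moreover have "(1 + x + x\<^sup>2 / 2) * (16 - x) - 16 - 15 * x = x\<^sup>2 * (7 - x / 2)"
      by (simp add: power2_eq_square algebra_simps)
    moreover have "x\<^sup>2 * (7 - x / 2) \<ge> 0" using True by (intro mult_nonneg_nonneg) auto
    ultimately have "0 \<le> exp x * (16 - x) - 16 - 15 * x" by linarith
    then have "0 \<le> (exp x * (16 - x) - 16 - 15 * x) * \<beta>" using \<beta> by (intro mult_nonneg_nonneg) auto
    also have "\<dots> = exp x * \<beta> * (16 - x) - (16 + 15 * x) * \<beta>" by (simp add: algebra_simps)
    finally have "x * (1 - \<beta>) \<le> 16 * (1 - \<beta> - x * \<beta>)" unfolding E by (simp add: algebra_simps)
    then have "\<kappa> * u * (x * (1 - \<beta>)) \<le> \<kappa> * u * (16 * (1 - \<beta> - x * \<beta>))" using ku by (intro mult_left_mono) auto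
    also have "\<dots> = 16 * (\<kappa> * u * (1 - \<beta> - x * \<beta>))" by simp
    also have "\<dots> \<le> 16 * (1 - \<beta>)" using nec(1) unfolding dt by simp
    finally have "(\<kappa> * u * x) * (1 - \<beta>) \<le> 16 * (1 - \<beta>)" by (simp add: mult.assoc)
    then show ?thesis by (rule mult_right_le_imp_le) (use \<beta> in simp)
  next
    case False
    have "4 * (1 + \<beta>) \<le> x * (1 + \<beta>)" using False \<beta> by (intro mult_right_mono) auto
    then have "x * (1 + \<beta>) \<le> 8 * (x * (1 + \<beta>) - 2 * (1 - \<beta>))" using \<beta> by simp
    then have "\<kappa> * u * (x * (1 + \<beta>)) \<le> \<kappa> * u * (8 * (x * (1 + \<beta>) - 2 * (1 - \<beta>)))"
      using ku by (intro mult_left_mono) auto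
    also have "\<dots> = 8 * (\<kappa> * u * (x + \<beta> - 1) - \<kappa> * u * (1 - \<beta> - x * \<beta>))" by (simp add: algebra_simps)
    also have "\<dots> \<le> 16 * (1 + \<beta>)" using nec(2) unfolding tr dt by simp
    finally have "(\<kappa> * u * x) * (1 + \<beta>) \<le> 16 * (1 + \<beta>)" by (simp add: mult.assoc)
    then show ?thesis by (rule mult_right_le_imp_le) (use \<beta> in simp)
  qed
  then show ?thesis using \<kappa> by (simp add: x_def u_def field_simps)
qed

lemma spectral_radius_lower:
  assumes \<kappa>: "\<kappa> > 1" and st: "schur_stable (integrator_matrix h \<gamma> \<kappa>)"
  shows "real_spectral_radius (integrator_matrix h \<gamma> 1) \<ge> 1 - 64 / \<kappa>"
proof -
  define x \<beta> u where "x = \<gamma> * h" and "\<beta> = exp (- \<gamma> * h)" and "u = 1 / \<gamma>\<^sup>2"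
  have x: "x > 0" and \<beta>: "0 < \<beta>" "\<beta> < 1" and u: "u > 0"
    using friction_step_pos beta_bounds \<gamma> by (simp_all add: x_def \<beta>_def u_def)
  have A: "x + \<beta> - 1 > 0" and B: "1 - \<beta> - x * \<beta> > 0" using exp_above_tangent exp_tangent_gap_pos by (simp_all add: x_def \<beta>_def)
  have ux: "u * x \<le> 16 / \<kappa>" using stability_step_bound[OF _ st] \<kappa> by (simp add: u_def x_def)
  obtain z w where zw: "root_pair (drift_trace h \<gamma> 1) (drift_det h \<gamma> 1) z w"
    "real_spectral_radius (integrator_matrix h \<gamma> 1) = max (cmod z) (cmod w)"
    by (rule integrator_matrix_roots[OF \<gamma>])
  have st1: "max (cmod z) (cmod w) < 1"
    using schur_stable_mono[OF st, of 1] \<kappa> zw(2) by (simp add: schur_stable_def)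
  have tr: "drift_trace h \<gamma> 1 = 2 - ((1 - \<beta>) + u * (x + \<beta> - 1))"
    and dt: "drift_det h \<gamma> 1 = \<beta> + u * (1 - \<beta> - x * \<beta>)"
    by (simp_all add: drift_trace_def drift_det_def x_def \<beta>_def u_def)
  define S where "S = (1 - \<beta>) + u * (x + \<beta> - 1)"
  have S: "1 - \<beta> \<le> S" using u A by (simp add: S_def)
  have one: "1 - drift_trace h \<gamma> 1 + drift_det h \<gamma> 1 = u * x * (1 - \<beta>)"
    unfolding drift_at_one by (simp add: x_def \<beta>_def u_def)
  have sum: "z + w = of_real (drift_trace h \<gamma> 1)" and prod: "z * w = of_real (drift_det h \<gamma> 1)"
    using zw(1) by (simp_all add: root_pair_def)
  from zw(1)[unfolded root_pair_def, THEN conjunct2, THEN conjunct2] show ?thesis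
  proof
    assume r: "Im z = 0 \<and> Im w = 0 \<and> Re w \<le> Re z"
    define p q where "p = Re z" and "q = Re w"
    have z: "z = of_real p" and w: "w = of_real q" using r by (simp_all add: p_def q_def complex_eq_iff)
    have pq: "p + q = drift_trace h \<gamma> 1" "p * q = drift_det h \<gamma> 1" "q \<le> p" using sum prod r
      unfolding z w by (simp_all only: of_real_add[symmetric] of_real_mult[symmetric] of_real_eq_iff) simp
    have "cmod z < 1" using st1 by simp
    then have "p < 1" unfolding z by (simp add: abs_less_iff)
    have "(1 - p) * (1 - q) = u * x * (1 - \<beta>)" using one pq by (simp add: algebra_simps)
    moreover have "p + q = 2 - S" using pq(1) tr by (simp add: S_def)
    then have "2 * q \<le> 2 - S" using pq(3) by linarith
    with S have "1 - \<beta> \<le> 2 - 2 * q" by simp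
    then have "(1 - \<beta>) / 2 \<le> 1 - q" by simp
    then have "(1 - p) * ((1 - \<beta>) / 2) \<le> (1 - p) * (1 - q)" using \<open>p < 1\<close> by (intro mult_left_mono) auto
    ultimately have "(1 - p) * (1 - \<beta>) \<le> (2 * (u * x)) * (1 - \<beta>)" by simp
    then have "1 - p \<le> 2 * (u * x)" by (rule mult_right_le_imp_le) (use \<beta> in simp)
    also have "\<dots> \<le> 32 / \<kappa>" using ux by simp
    also have "\<dots> \<le> 64 / \<kappa>" using \<kappa> by (simp add: divide_right_mono)
    finally have "1 - 64 / \<kappa> \<le> p" by simp
    also have "\<dots> \<le> max (cmod z) (cmod w)" unfolding z by simp
    finally show ?thesis using zw(2) by simp
  next
    assume r: "w = cnj z \<and> Im z \<noteq> 0 \<and> (drift_trace h \<gamma> 1)\<^sup>2 < 4 * drift_det h \<gamma> 1"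
    have "S\<^sup>2 - 4 * (u * x * (1 - \<beta>)) = (drift_trace h \<gamma> 1)\<^sup>2 - 4 * drift_det h \<gamma> 1"
      unfolding one[symmetric] tr S_def[symmetric] by (simp add: power2_eq_square algebra_simps)
    then have "S\<^sup>2 < 4 * (u * x * (1 - \<beta>))" using r by linarith
    moreover have "(1 - \<beta>)\<^sup>2 \<le> S\<^sup>2" using S \<beta> by (intro power_mono) auto
    ultimately have "(1 - \<beta>) * (1 - \<beta>) < (4 * (u * x)) * (1 - \<beta>)" by (simp add: power2_eq_square)
    then have "1 - \<beta> < 4 * (u * x)" by (rule mult_right_less_imp_less) (use \<beta> in simp)
    also have "\<dots> \<le> 64 / \<kappa>" using ux by simp
    finally have "1 - 64 / \<kappa> \<le> \<beta>" by simp
    also have "\<beta> \<le> drift_det h \<gamma> 1" unfolding dt using u B by simp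
    also have "drift_det h \<gamma> 1 = (cmod z)\<^sup>2"
    proof -
      have "complex_of_real ((cmod z)\<^sup>2) = of_real (drift_det h \<gamma> 1)"
        using complex_norm_square[of z] prod r by simp
      then show ?thesis using of_real_eq_iff by metis
    qed
    also have "(cmod z)\<^sup>2 \<le> cmod z"
      using st1 mult_left_le[of "cmod z" "cmod z"] by (simp add: power2_eq_square)
    also have "\<dots> \<le> max (cmod z) (cmod w)" by simp
    finally show ?thesis using zw(2) by simp
  qed
qed

end

section \<open>Powers of a planar linear map\<close>

definition planar_map :: "real \<Rightarrow> real \<Rightarrow> real \<Rightarrow> real \<Rightarrow> real \<times> real \<Rightarrow> real \<times> real" where
  "planar_map a b c d = (\<lambda>(x, v). (a * x + b * v, c * x + d * v))"

lemma linear_planar_map: "linear (planar_map a b c d)"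
  by (rule linearI) (auto simp: planar_map_def algebra_simps split: prod.splits)

lemma planar_map_adj: "\<xi> \<bullet> planar_map a b c d y = planar_map a c b d \<xi> \<bullet> y"
  by (cases \<xi>, cases y) (simp add: planar_map_def algebra_simps)

text \<open>An eigenvector of the matrix is \<open>(b, z - a)\<close>, and the real part of any complex multiple of it evolves
  by multiplication with powers of \<open>z\<close>; the multiplier \<open>t\<close> serves to select real or imaginary parts.\<close>

lemma planar_map_eigen:
  fixes a b c d :: real and z :: complex
  assumes "z\<^sup>2 - of_real (a + d) * z + of_real (a * d - b * c) = 0"
  shows "(planar_map a b c d ^^ n) (Re (t * of_real b), Re (t * (z - of_real a)))
      = (Re (z ^ n * t * of_real b), Re (z ^ n * t * (z - of_real a)))"
proof (induction n)
  case (Suc n)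
  have re: "planar_map a b c d (Re p, Re q) = (Re (of_real a * p + of_real b * q), Re (of_real c * p + of_real d * q))" for p q
    by (simp add: planar_map_def)
  have "z * (z - of_real a) = of_real c * of_real b + of_real d * (z - of_real a)"
    using assms by (simp add: power2_eq_square algebra_simps)
  then have "z ^ n * t * (of_real c * of_real b + of_real d * (z - of_real a)) = z ^ n * t * (z * (z - of_real a))"
    by (simp only:)
  then have "of_real c * (z ^ n * t * of_real b) + of_real d * (z ^ n * t * (z - of_real a)) = z ^ Suc n * t * (z - of_real a)"
    by (simp add: algebra_simps)
  moreover have "of_real a * (z ^ n * t * of_real b) + of_real b * (z ^ n * t * (z - of_real a)) = z ^ Suc n * t * of_real b"
    by (simp add: algebra_simps)
  ultimately show ?case using Suc by (simp only: funpow.simps comp_def re)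
qed simp

text \<open>The difference \<open>s (n + 1) - z s n\<close> is geometric with ratio \<open>w\<close>; summing it up gives the linear factor,
  which also covers a double root.\<close>

lemma linear_recurrence_bound:
  fixes s :: "nat \<Rightarrow> complex"
  assumes rec: "\<And>n. s (Suc (Suc n)) = (z + w) * s (Suc n) - z * w * s n"
    and z: "cmod z \<le> \<rho>" and w: "cmod w \<le> \<rho>" and \<rho>: "\<rho> > 0"
  shows "cmod (s n) \<le> real (Suc n) * \<rho> ^ n * (2 * cmod (s 0) + cmod (s 1) / \<rho>)"
proof -
  define t where "t n = s (Suc n) - z * s n" for n
  have "t (Suc n) = w * t n" for n unfolding t_def rec by (simp add: algebra_simps)
  then have tn: "t n = w ^ n * t 0" for n by (induction n) auto
  have t: "cmod (t n) \<le> \<rho> ^ n * cmod (t 0)" for n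
  proof -
    have "cmod (t n) = cmod w ^ n * cmod (t 0)" using arg_cong[OF tn[of n], of cmod] by (simp only: norm_mult norm_power)
    also have "\<dots> \<le> \<rho> ^ n * cmod (t 0)" using w by (intro mult_right_mono power_mono) auto
    finally show ?thesis .
  qed
  have main: "cmod (s n) \<le> \<rho> ^ n * (cmod (s 0) + real n * (cmod (t 0) / \<rho>))"
  proof (induction n)
    case (Suc n)
    have "cmod (s (Suc n)) = cmod (z * s n + t n)" by (simp add: t_def)
    also have "\<dots> \<le> cmod z * cmod (s n) + cmod (t n)" by (metis norm_mult norm_triangle_ineq)
    also have "\<dots> \<le> \<rho> * (\<rho> ^ n * (cmod (s 0) + real n * (cmod (t 0) / \<rho>))) + \<rho> ^ n * cmod (t 0)"
      using \<rho> by (intro add_mono mult_mono z t Suc) auto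
    also have "\<dots> = \<rho> ^ Suc n * (cmod (s 0) + real (Suc n) * (cmod (t 0) / \<rho>))"
      using \<rho> by (simp add: field_simps)
    finally show ?case .
  qed simp
  have t0: "cmod (t 0) / \<rho> \<le> cmod (s 1) / \<rho> + cmod (s 0)"
  proof -
    have "cmod (t 0) \<le> cmod (s 1) + cmod z * cmod (s 0)"
      unfolding t_def using norm_triangle_ineq4[of "s 1" "z * s 0"] by (simp add: norm_mult)
    also have "\<dots> \<le> cmod (s 1) + \<rho> * cmod (s 0)" using z by (intro add_left_mono mult_right_mono) auto
    finally show ?thesis using \<rho> by (simp add: field_simps)
  qed
  have "cmod (s 0) + real n * (cmod (t 0) / \<rho>) \<le> real (Suc n) * (2 * cmod (s 0) + cmod (s 1) / \<rho>)"
  proof -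
    define X Y where "X = cmod (s 0)" and "Y = cmod (s 1) / \<rho>"
    have XY: "0 \<le> X" "0 \<le> Y" using \<rho> by (simp_all add: X_def Y_def)
    have "real n * (cmod (t 0) / \<rho>) \<le> real n * (Y + X)" unfolding X_def Y_def by (intro mult_left_mono t0) simp
    moreover have "real (Suc n) * (2 * X + Y) = X + real n * (Y + X) + (X + Y + real n * X)"
      by (simp add: algebra_simps)
    moreover have "0 \<le> X + Y + real n * X" using XY by (intro add_nonneg_nonneg mult_nonneg_nonneg) auto
    ultimately show ?thesis unfolding X_def Y_def by linarith
  qed
  then have "\<rho> ^ n * (cmod (s 0) + real n * (cmod (t 0) / \<rho>)) \<le> \<rho> ^ n * (real (Suc n) * (2 * cmod (s 0) + cmod (s 1) / \<rho>))"
    using \<rho> by (intro mult_left_mono) auto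
  with main show ?thesis by (simp add: ac_simps)
qed

text \<open>By Cayley-Hamilton every coordinate of an orbit satisfies the second-order recurrence with roots \<open>z\<close>
  and \<open>w\<close>.\<close>

lemma planar_map_pow_bound:
  fixes a b c d :: real
  assumes zw: "z + w = complex_of_real (a + d)" "z * w = complex_of_real (a * d - b * c)"
    and \<rho>: "\<rho> = max (cmod z) (cmod w)" "\<rho> > 0"
  shows "\<exists>K>0. \<forall>n y. norm ((planar_map a b c d ^^ n) y) \<le> K * real (Suc n) * \<rho> ^ n * norm y"
proof -
  let ?L = "planar_map a b c d"
  obtain KL where KL: "KL > 0" "\<And>y. norm (?L y) \<le> norm y * KL"
    using linear_planar_map linear_conv_bounded_linear bounded_linear.pos_bounded by metis
  define K where "K = 2 * (2 + KL / \<rho>)"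
  have K: "K > 0" using KL \<rho> by (simp add: K_def add_pos_pos)
  have ch: "?L (?L p) = (a + d) *\<^sub>R ?L p - (a * d - b * c) *\<^sub>R p" for p
    by (cases p) (simp add: planar_map_def algebra_simps)
  have comp: "\<bar>pr ((?L ^^ n) y)\<bar> \<le> real (Suc n) * \<rho> ^ n * ((2 + KL / \<rho>) * norm y)"
    if pr: "linear pr" "\<And>p. \<bar>pr p\<bar> \<le> norm p" for pr :: "real \<times> real \<Rightarrow> real" and n y
  proof -
    define s where "s n = complex_of_real (pr ((?L ^^ n) y))" for n
    have "s (Suc (Suc n)) = (z + w) * s (Suc n) - z * w * s n" for n
      unfolding s_def zw by (simp add: ch linear_diff[OF pr(1)] linear_scale[OF pr(1)])
    from linear_recurrence_bound[of s, OF this, of \<rho> n] \<rho>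
    have "cmod (s n) \<le> real (Suc n) * \<rho> ^ n * (2 * cmod (s 0) + cmod (s 1) / \<rho>)" by simp
    also have "\<dots> \<le> real (Suc n) * \<rho> ^ n * ((2 + KL / \<rho>) * norm y)"
    proof (rule mult_left_mono)
      have "cmod (s 1) \<le> norm y * KL" unfolding s_def using order_trans[OF pr(2) KL(2)] by simp
      then have "cmod (s 1) / \<rho> \<le> norm y * KL / \<rho>" using \<rho> by (intro divide_right_mono) auto
      moreover have "cmod (s 0) \<le> norm y" unfolding s_def using pr(2) by simp
      ultimately show "2 * cmod (s 0) + cmod (s 1) / \<rho> \<le> (2 + KL / \<rho>) * norm y" by (simp add: algebra_simps)
    qed (use \<rho> in simp)
    finally show ?thesis by (simp add: s_def)
  qed
  have fst_le: "\<bar>fst p\<bar> \<le> norm p" and snd_le: "\<bar>snd p\<bar> \<le> norm p" for p :: "real \<times> real"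
    using norm_fst_le[of "fst p" "snd p"] norm_snd_le[of "snd p" "fst p"] by simp_all
  have "norm ((?L ^^ n) y) \<le> K * real (Suc n) * \<rho> ^ n * norm y" for n y
  proof -
    have "norm ((?L ^^ n) y) \<le> \<bar>fst ((?L ^^ n) y)\<bar> + \<bar>snd ((?L ^^ n) y)\<bar>"
      using norm_Pair_le[of "fst ((?L ^^ n) y)" "snd ((?L ^^ n) y)"] by simp
    also have "\<dots> \<le> 2 * (real (Suc n) * \<rho> ^ n * ((2 + KL / \<rho>) * norm y))"
      using comp[OF bounded_linear.linear[OF bounded_linear_fst] fst_le, of n y]
        comp[OF bounded_linear.linear[OF bounded_linear_snd] snd_le, of n y] by linarith
    finally show ?thesis unfolding K_def by (simp only: ac_simps)
  qed
  with K show ?thesis by blast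
qed

text \<open>The starting point is the real part of an eigenvector for an eigenvalue of largest modulus.\<close>

lemma planar_map_pow_lower:
  fixes a b c d :: real
  assumes zw: "z + w = complex_of_real (a + d)" "z * w = complex_of_real (a * d - b * c)"
    and \<rho>: "\<rho> = max (cmod z) (cmod w)" and b: "b > 0"
  shows "\<exists>y. \<exists>k>0. \<forall>n. k * \<rho> ^ n \<le> norm ((planar_map a b c d ^^ n) y)"
proof -
  define v where "v = (if cmod w \<le> cmod z then z else w)"
  have v: "cmod v = \<rho>" by (simp add: v_def \<rho>)
  have "k\<^sup>2 - of_real (a + d) * k + of_real (a * d - b * c) = (k - z) * (k - w)" for k
    unfolding zw[symmetric] by (simp add: power2_eq_square algebra_simps)
  then have root: "v\<^sup>2 - of_real (a + d) * v + of_real (a * d - b * c) = 0" by (simp add: v_def)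
  define y where "y = (Re (1 * complex_of_real b), Re (1 * (v - of_real a)))"
  have pow: "(planar_map a b c d ^^ n) y = (Re (v ^ n * of_real b), Re (v ^ n * (v - of_real a)))" for n
    unfolding y_def using planar_map_eigen[OF root, of n 1] by simp
  show ?thesis
  proof (cases "Im v = 0")
    case True
    have "b * \<rho> ^ n \<le> norm ((planar_map a b c d ^^ n) y)" for n
    proof -
      have vr: "v = of_real (Re v)" using True by (simp add: complex_eq_iff)
      then have "\<bar>Re v\<bar> = \<rho>" using v by (metis norm_of_real)
      moreover have "Re (v ^ n * of_real b) = Re v ^ n * b" by (subst vr) (simp flip: of_real_power)
      ultimately have "b * \<rho> ^ n = \<bar>Re (v ^ n * of_real b)\<bar>" using b by (simp add: abs_mult power_abs)
      also have "\<dots> \<le> norm ((planar_map a b c d ^^ n) y)"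
        unfolding pow using norm_fst_le[of "Re (v ^ n * of_real b)" "Re (v ^ n * (v - of_real a))"] by simp
      finally show ?thesis .
    qed
    then show ?thesis using b by blast
  next
    case False
    \<comment> \<open>a real matrix has no eigenvector for \<open>v\<close> with vanishing real part, so \<open>Re\<close> of \<open>v ^ n\<close> times the
     eigenvector is at least a fixed multiple of \<open>|v| ^ n\<close>; the constant \<open>K\<close> quantifies this\<close>
    define p q where "p = Re v - a" and "q = Im v"
    have q: "q \<noteq> 0" using False by (simp add: q_def)
    define K where "K = 1 / b + (1 + \<bar>p\<bar> / b) / \<bar>q\<bar>"
    have K: "K > 0" 
    proof -
      have "1 + \<bar>p\<bar> / b > 0" using b by (intro add_pos_nonneg) auto
      then have "(1 + \<bar>p\<bar> / b) / \<bar>q\<bar> > 0"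
        by (rule divide_pos_pos) (use q in simp)
      moreover have "1 / b > 0" using b by simp
      ultimately show ?thesis unfolding K_def by (rule add_pos_pos[rotated])
    qed
    have "\<rho> ^ n \<le> K * norm ((planar_map a b c d ^^ n) y)" for n
    proof -
      define X Y N where "X = Re (v ^ n)" and "Y = Im (v ^ n)" and "N = norm ((planar_map a b c d ^^ n) y)"
      have eq: "(planar_map a b c d ^^ n) y = (X * b, X * p - Y * q)"
        unfolding pow by (simp add: X_def Y_def p_def q_def)
      have Xb: "\<bar>X * b\<bar> \<le> N" and XY: "\<bar>X * p - Y * q\<bar> \<le> N"
        unfolding N_def eq using norm_fst_le[of "X * b" "X * p - Y * q"] norm_snd_le[of "X * p - Y * q" "X * b"] by simp_all
      have X: "\<bar>X\<bar> \<le> N / b" using Xb b by (simp add: abs_mult pos_le_divide_eq)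
      have "\<bar>Y * q\<bar> \<le> N + \<bar>X * p\<bar>" using XY by linarith
      then have Yq: "\<bar>Y\<bar> * \<bar>q\<bar> \<le> N + \<bar>X\<bar> * \<bar>p\<bar>" by (simp only: abs_mult)
      have "\<bar>Y\<bar> * \<bar>q\<bar> \<le> N + N / b * \<bar>p\<bar>" using Yq mult_right_mono[OF X, of "\<bar>p\<bar>"] by simp
      then have "\<bar>Y\<bar> \<le> (N + N / b * \<bar>p\<bar>) / \<bar>q\<bar>" using q by (simp add: pos_le_divide_eq)
      then have "\<bar>X\<bar> + \<bar>Y\<bar> \<le> K * N" using X by (simp add: K_def algebra_simps add_divide_distrib)
      moreover have "\<rho> ^ n = cmod (v ^ n)" by (simp add: norm_power v)
      moreover have "cmod (v ^ n) \<le> \<bar>X\<bar> + \<bar>Y\<bar>" unfolding X_def Y_def by (rule cmod_le)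
      ultimately show ?thesis unfolding N_def by linarith
    qed
    then have "1 / K * \<rho> ^ n \<le> norm ((planar_map a b c d ^^ n) y)" for n
      using K by (simp add: field_simps)
    moreover have "1 / K > 0" using K by simp
    ultimately show ?thesis by blast
  qed
qed

section \<open>Planar maps driven by Gaussian noise\<close>

lemma charfun_planar_gaussian_vec:
  "charfun (planar_gaussian s1 s2 c) \<xi> = of_real (exp (- ((s1 * fst \<xi>)\<^sup>2 + (c * fst \<xi> + s2 * snd \<xi>)\<^sup>2) / 2))"
  using charfun_planar_gaussian[of s1 s2 c "fst \<xi>" "snd \<xi>"] by simp

lemma linear_chain_planar_gaussian:
  "linear_chain (planar_map a b c d) (planar_map a c b d) (planar_gaussian s1 s2 e)"
  by (intro linear_chain.intro linear_planar_map planar_map_adj planar_gaussian_prob)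

lemma integrator_kernel_quadratic:
  assumes \<zeta>m: "\<zeta> 1 \<in> borel_measurable M"
    and \<nu>: "distr M borel (\<zeta> 1) = planar_gaussian s1 s2 e"
    and abcd: "a = 1 - (\<gamma> * h + exp (- \<gamma> * h) - 1) / \<gamma>\<^sup>2 * l" "b = (1 - exp (- \<gamma> * h)) / \<gamma>"
      "c = - ((1 - exp (- \<gamma> * h)) / \<gamma>) * l" "d = exp (- \<gamma> * h)"
  shows "integrator_kernel M h \<gamma> \<zeta> (quadratic_potential l) y =
    linear_chain.kern (planar_map a b c d) (planar_gaussian s1 s2 e) y"
proof -
  have deriv: "deriv (quadratic_potential l) x = l * x" for x
    unfolding quadratic_potential_def
    by (rule DERIV_imp_deriv) (auto intro!: derivative_eq_intros)
  have step: "integrator_chain h \<gamma> (quadratic_potential l) \<zeta> y 1 = (\<lambda>\<omega>. planar_map a b c d y + \<zeta> 1 \<omega>)"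
  proof
    fix \<omega>
    obtain x v where y: "y = (x, v)" by (cases y)
    obtain zx zv where z: "\<zeta> (Suc 0) \<omega> = (zx, zv)" by (cases "\<zeta> (Suc 0) \<omega>")
    define \<beta> k u where "\<beta> = exp (- \<gamma> * h)" and "k = (1 - \<beta>) / \<gamma>" and "u = (\<gamma> * h + \<beta> - 1) / \<gamma>\<^sup>2"
    have abcd': "a = 1 - u * l" "b = k" "c = - k * l" "d = \<beta>"
      unfolding abcd k_def u_def \<beta>_def by simp_all
    have "integrator_chain h \<gamma> (quadratic_potential l) \<zeta> y 1 \<omega> =
        (x + k * v - u * (l * x) + zx, \<beta> * v - k * (l * x) + zv)"
      unfolding One_nat_def integrator_chain.simps integrator_step_def y z k_def u_def \<beta>_def
      by (simp add: deriv Let_def)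
    also have "\<dots> = planar_map a b c d y + \<zeta> 1 \<omega>"
      unfolding One_nat_def y z planar_map_def abcd' by (simp add: algebra_simps)
    finally show "integrator_chain h \<gamma> (quadratic_potential l) \<zeta> y 1 \<omega> = planar_map a b c d y + \<zeta> 1 \<omega>" .
  qed
  have "linear_chain.kern (planar_map a b c d) (planar_gaussian s1 s2 e) y = distr (distr M borel (\<zeta> 1)) borel (\<lambda>z. planar_map a b c d y + z)"
    unfolding linear_chain.kern_def[OF linear_chain_planar_gaussian] \<nu> ..
  also have "\<dots> = distr M borel ((\<lambda>z. planar_map a b c d y + z) \<circ> \<zeta> 1)"
    by (rule distr_distr[OF _ \<zeta>m]) simp
  also have "(\<lambda>z. planar_map a b c d y + z) \<circ> \<zeta> 1 = (\<lambda>\<omega>. planar_map a b c d y + \<zeta> 1 \<omega>)"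
    by (simp only: comp_def)
  finally show ?thesis
    unfolding integrator_kernel_def step by (rule sym)
qed

text \<open>Along the orbits of the real and imaginary parts of a left eigenvector the two values of the covariance
  form add up to \<open>|v| ^ (2 n) * \<epsilon>\<close>.  The constant \<open>\<epsilon>\<close> is positive since the eigenvector has a nonzero
  component \<open>b\<close>.\<close>

lemma no_invariant_law_planar:
  fixes a b c d s1 s2 e :: real
  assumes s: "s1 > 0" "s2 > 0" and b: "b > 0"
    and zw: "z + w = complex_of_real (a + d)" "z * w = complex_of_real (a * d - b * c)"
    and ge: "1 \<le> max (cmod z) (cmod w)"
  shows "\<not> (\<exists>\<pi>. invariant_law (linear_chain.kern (planar_map a b c d) (planar_gaussian s1 s2 e)) \<pi>)"
proof -
  interpret linear_chain "planar_map a b c d" "planar_map a c b d" "planar_gaussian s1 s2 e"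
    by (rule linear_chain_planar_gaussian)
  define v where "v = (if cmod w \<le> cmod z then z else w)"
  have v: "1 \<le> cmod v" using ge by (auto simp: v_def)
  have sp: "complex_of_real (d + a) = z + w" "complex_of_real (d * a - b * c) = z * w"
    using zw by (simp_all add: ac_simps)
  have "k\<^sup>2 - of_real (d + a) * k + of_real (d * a - b * c) = (k - z) * (k - w)" for k
    unfolding sp by (simp add: power2_eq_square algebra_simps)
  then have root: "v\<^sup>2 - of_real (d + a) * v + of_real (d * a - b * c) = 0" by (simp add: v_def)
  \<comment> \<open>swapping the coordinates turns the transposed map into a planar map with the same entry \<open>b\<close> in the
     upper right corner, so that left eigenvectors come from the formula for right ones\<close>
  have swap: "planar_map a c b d (x, y) = prod.swap (planar_map d b c a (y, x))" for x y
    by (simp add: planar_map_def)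
  have swap_pow: "(planar_map a c b d ^^ n) (x, y) = prod.swap ((planar_map d b c a ^^ n) (y, x))" for n x y
  proof (induction n)
    case (Suc n)
    show ?case using Suc swap by (cases "(planar_map d b c a ^^ n) (y, x)") simp
  qed simp
  have pow: "(planar_map a c b d ^^ n) (Re (t * (v - of_real d)), Re (t * of_real b))
      = (Re (v ^ n * t * (v - of_real d)), Re (v ^ n * t * of_real b))" for n t
    unfolding swap_pow planar_map_eigen[OF root] by simp
  define q where "q \<xi> = (s1 * fst \<xi>)\<^sup>2 + (e * fst \<xi> + s2 * snd \<xi>)\<^sup>2" for \<xi> :: "real \<times> real"
  define \<epsilon> where "\<epsilon> = s1\<^sup>2 * (cmod (v - of_real d))\<^sup>2 + (cmod (of_real e * (v - of_real d) + of_real (s2 * b)))\<^sup>2"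
  have "\<epsilon> > 0"
  proof (cases "v = of_real d")
    case True
    then show ?thesis using s b by (simp add: \<epsilon>_def norm_mult)
  next
    case False
    then show ?thesis unfolding \<epsilon>_def using s by (intro add_pos_nonneg mult_pos_pos) auto
  qed
  have sq: "(Re p)\<^sup>2 + (Re (- \<i> * p))\<^sup>2 = (cmod p)\<^sup>2" for p by (simp add: cmod_power2)
  have qq: "\<epsilon> \<le> q ((planar_map a c b d ^^ n) (Re (1 * (v - of_real d)), Re (1 * of_real b)))
      + q ((planar_map a c b d ^^ n) (Re (- \<i> * (v - of_real d)), Re (- \<i> * of_real b)))" for n
  proof -
    define x y where "x = v ^ n * (v - of_real d)" and "y = v ^ n * of_real b"
    have "q ((planar_map a c b d ^^ n) (Re (1 * (v - of_real d)), Re (1 * of_real b)))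
      + q ((planar_map a c b d ^^ n) (Re (- \<i> * (v - of_real d)), Re (- \<i> * of_real b))) =
      q (Re x, Re y) + q (Re (- \<i> * x), Re (- \<i> * y))"
      unfolding pow x_def y_def by (simp add: mult.assoc mult.left_commute)
    also have "\<dots> = s1\<^sup>2 * ((Re x)\<^sup>2 + (Re (- \<i> * x))\<^sup>2) + ((Re (of_real e * x + of_real s2 * y))\<^sup>2 + (Re (- \<i> * (of_real e * x + of_real s2 * y)))\<^sup>2)"
      by (simp add: q_def power_mult_distrib algebra_simps)
    also have "\<dots> = s1\<^sup>2 * (cmod x)\<^sup>2 + (cmod (of_real e * x + of_real s2 * y))\<^sup>2" unfolding sq ..
    also have "of_real e * x + of_real s2 * y = v ^ n * (of_real e * (v - of_real d) + of_real (s2 * b))"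
      by (simp add: x_def y_def algebra_simps)
    also have "s1\<^sup>2 * (cmod x)\<^sup>2 + (cmod (v ^ n * (of_real e * (v - of_real d) + of_real (s2 * b))))\<^sup>2 = (cmod v ^ n)\<^sup>2 * \<epsilon>"
      unfolding x_def \<epsilon>_def by (simp only: norm_mult norm_power power_mult_distrib) (simp add: algebra_simps)
    also have "\<dots> \<ge> 1 * \<epsilon>"
      using v \<open>\<epsilon> > 0\<close> by (intro mult_right_mono one_le_power) auto
    finally show ?thesis by simp
  qed
  show ?thesis
  proof (rule no_invariant_law[where q=q, OF _ _ \<open>\<epsilon> > 0\<close> qq])
    show "charfun (planar_gaussian s1 s2 e) \<xi> = complex_of_real (exp (- q \<xi> / 2))" for \<xi>
      unfolding charfun_planar_gaussian_vec q_def ..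
    show "q (t *\<^sub>R \<xi>) = t\<^sup>2 * q \<xi>" for t \<xi> by (simp add: q_def power2_eq_square algebra_simps)
  qed
qed

section \<open>Rates from two-sided bounds\<close>

lemma root_geometric_upper:
  assumes "C > 0" "\<rho> > 0"
  shows "(\<lambda>n. root n (C * real n * \<rho> ^ n)) \<longlonglongrightarrow> \<rho>"
proof -
  have "(\<lambda>n. root n C * root n (real n) * \<rho>) \<longlonglongrightarrow> 1 * 1 * \<rho>"
    by (intro tendsto_intros LIMSEQ_root LIMSEQ_root_const assms)
  moreover have "\<forall>\<^sub>F n in sequentially. root n C * root n (real n) * \<rho> = root n (C * real n * \<rho> ^ n)"
    using eventually_gt_at_top[of 0]
    by eventually_elim (use assms in \<open>simp add: real_root_mult real_root_power_cancel\<close>)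
  ultimately show ?thesis using Lim_transform_eventually by fastforce
qed

lemma root_limsup_le:
  assumes "C > 0" "\<rho> > 0" "\<And>n. n > 0 \<Longrightarrow> f n \<le> C * real n * \<rho> ^ n"
  shows "limsup (\<lambda>n. ereal (root n (f n))) \<le> ereal \<rho>"
proof -
  have "limsup (\<lambda>n. ereal (root n (f n))) \<le> limsup (\<lambda>n. ereal (root n (C * real n * \<rho> ^ n)))"
    by (intro Limsup_mono eventually_mono[OF eventually_gt_at_top[of 0]]) (simp add: assms)
  also have "\<dots> = ereal \<rho>"
    by (intro lim_imp_Limsup) (auto intro!: root_geometric_upper assms)
  finally show ?thesis .
qed

lemma root_tendsto:
  assumes C: "C > 0" and k: "k > 0" and \<rho>: "\<rho> > 0" and up: "\<And>n. n > 0 \<Longrightarrow> f n \<le> C * real n * \<rho> ^ n"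
    and low: "\<forall>\<^sub>F n in sequentially. k * \<rho> ^ n \<le> f n"
  shows "(\<lambda>n. root n (f n)) \<longlonglongrightarrow> \<rho>"
proof (rule tendsto_sandwich[OF _ _ _ root_geometric_upper[OF C \<rho>]])
  show "\<forall>\<^sub>F n in sequentially. root n (f n) \<le> root n (C * real n * \<rho> ^ n)"
    by (intro eventually_mono[OF eventually_gt_at_top[of 0]]) (simp add: up)
  show "\<forall>\<^sub>F n in sequentially. root n k * \<rho> \<le> root n (f n)"
    using low eventually_gt_at_top[of 0]
  proof eventually_elim
    case (elim n)
    have "root n k * \<rho> = root n (k * \<rho> ^ n)" using elim(2) \<rho> by (simp add: real_root_mult real_root_power_cancel)
    then show ?case using elim by simp
  qed
  have "(\<lambda>n. root n k * \<rho>) \<longlonglongrightarrow> 1 * \<rho>" by (intro tendsto_intros LIMSEQ_root_const k)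
  then show "(\<lambda>n. root n k * \<rho>) \<longlonglongrightarrow> \<rho>" by simp
qed

text \<open>The same starting point \<open>y\<close>, whose orbit decays no faster than \<open>\<rho> ^ n\<close>, serves for both limits; the
  second starting point is \<open>0\<close>, whose law is symmetric and therefore has a real characteristic functional,
  just as the invariant law.\<close>

lemma stable_rates:
  fixes a b c d s1 s2 e \<rho> :: real
  defines "P \<equiv> linear_chain.kern (planar_map a b c d) (planar_gaussian s1 s2 e)"
  assumes s: "s1 > 0" "s2 > 0" and b: "b > 0" and det: "a * d - b * c \<noteq> 0"
    and zw: "z + w = complex_of_real (a + d)" "z * w = complex_of_real (a * d - b * c)"
    and \<rho>: "\<rho> = max (cmod z) (cmod w)" "\<rho> < 1"
  shows "\<exists>\<pi>1. invariant_law P \<pi>1 \<and> (\<forall>\<pi>. invariant_law P \<pi> \<longrightarrow> \<pi> = \<pi>1) \<and>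
          (\<forall>y. limsup (\<lambda>n. ereal (root n (tv_dist (iterate_from P y n) \<pi>1))) \<le> ereal \<rho>) \<and>
          (\<exists>y. (\<lambda>n. root n (tv_dist (iterate_from P y n) \<pi>1)) \<longlonglongrightarrow> \<rho>)"
    and "\<exists>y y'. (\<lambda>n. root n (tv_dist (iterate_from P y n) (iterate_from P y' n))) \<longlonglongrightarrow> \<rho>"
proof -
  let ?L = "planar_map a b c d"
  have "complex_of_real (a * d - b * c) \<noteq> 0" unfolding of_real_eq_0_iff by (rule det)
  then have "z \<noteq> 0" unfolding zw(2)[symmetric] by simp
  then have \<rho>0: "\<rho> > 0" by (simp add: \<rho>(1) less_max_iff_disj)
  obtain K where K: "K > 0" "\<And>n y. norm ((?L ^^ n) y) \<le> K * real (Suc n) * \<rho> ^ n * norm y"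
    using planar_map_pow_bound[OF zw \<rho>(1) \<rho>0] by blast
  define B where "B n = K * real (Suc n) * \<rho> ^ n" for n
  have "summable (\<lambda>n. of_nat (Suc n) * \<rho> ^ n)"
    using geometric_deriv_sums[of \<rho>] \<rho> \<rho>0 by (auto simp: sums_iff)
  then have B_summable: "summable B" unfolding B_def using summable_mult[of _ K] by (simp add: mult.assoc)
  define C where "C = (1 + \<bar>e\<bar> / s2) / s1 + 1 / s2"
  have C0: "C > 0" unfolding C_def using s by (intro add_pos_pos divide_pos_pos add_pos_nonneg) auto
  interpret stable_linear_chain ?L "planar_map a c b d" "planar_gaussian s1 s2 e" B C
  proof (intro stable_linear_chain.intro linear_chain_planar_gaussian stable_linear_chain_axioms.intro)
    show "norm ((?L ^^ n) x) \<le> B n * norm x" for n x using K(2) by (simp add: B_def)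
    show "summable B" by (rule B_summable)
    show "integrable (planar_gaussian s1 s2 e) norm" by (rule planar_gaussian_moment)
  qed (unfold C_def, rule planar_gaussian_shift[OF s])
  define q where "q \<xi> = (s1 * fst \<xi>)\<^sup>2 + (e * fst \<xi> + s2 * snd \<xi>)\<^sup>2" for \<xi> :: "real \<times> real"
  have gauss: "charfun (planar_gaussian s1 s2 e) \<xi> = complex_of_real (exp (- q \<xi> / 2))" for \<xi>
    unfolding charfun_planar_gaussian_vec q_def ..
  have q0: "q \<xi> \<ge> 0" for \<xi> by (simp add: q_def)
  obtain \<pi> where \<pi>: "invariant_law kern \<pi>" "integrable \<pi> norm" using invariant_exists by blast
  have p\<pi>: "prob_space \<pi>" "sets \<pi> = sets borel" using \<pi>(1) by (auto simp: invariant_law_def)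
  obtain y k where y: "k > 0" "\<And>n. k * \<rho> ^ n \<le> norm ((?L ^^ n) y)"
    using planar_map_pow_lower[OF zw \<rho>(1) b] by blast
  have up_B: "B n \<le> 2 * K * real n * \<rho> ^ n" if "n > 0" for n
    unfolding B_def using that K \<rho>0 by (intro mult_right_mono) auto
  have up\<pi>: "tv_dist (iterate_from kern x n) \<pi> \<le> (C * (2 * K) * (norm x + (\<integral>x. norm x \<partial>\<pi>) + 1)) * real n * \<rho> ^ n"
    if n: "n > 0" for x n
  proof -
    let ?m = "norm x + (\<integral>x. norm x \<partial>\<pi>)"
    have m: "0 \<le> ?m" by simp
    have "tv_dist (iterate_from kern x n) \<pi> \<le> C * B n * ?m"
      by (rule tv_dist_le) (simp add: iterate_from_prob iterate_from_invariant_diff[OF \<pi> _ n])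
    also have "\<dots> \<le> C * (2 * K * real n * \<rho> ^ n) * (?m + 1)"
      using C0 K \<rho>0 m up_B[OF n] by (intro mult_mono mult_left_mono) auto
    finally show ?thesis by (simp only: ac_simps)
  qed
  have C\<pi>: "C * (2 * K) * (norm x + (\<integral>x. norm x \<partial>\<pi>) + 1) > 0" for x :: "real \<times> real"
  proof (rule mult_pos_pos)
    show "0 < C * (2 * K)" using C0 K by simp
    have "0 \<le> (\<integral>x. norm x \<partial>\<pi>)" by simp
    then show "0 < norm x + (\<integral>x. norm x \<partial>\<pi>) + 1" using norm_ge_zero[of x] by linarith
  qed
  have low: "\<exists>k'>0. \<forall>\<^sub>F n in sequentially. k' * \<rho> ^ n \<le> tv_dist (iterate_from kern y n) (\<mu> n)"
    if \<mu>: "\<And>n. prob_space (\<mu> n)" "\<And>n. sets (\<mu> n) = sets borel" "\<And>n \<xi>. Im (charfun (\<mu> n) \<xi>) = 0" for \<mu>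
  proof -
    obtain c where c: "c > 0" "\<forall>\<^sub>F n in sequentially. c * norm ((?L ^^ n) y) \<le> tv_dist (iterate_from kern y n) (\<mu> n)"
      using tv_dist_lower_eventually[where y=y and q=q and \<pi>=\<pi> and \<mu>=\<mu>, OF gauss q0 \<pi>(1) \<mu>]
      by (elim exE conjE) (rule that)
    from c(2) have "\<forall>\<^sub>F n in sequentially. (c * k) * \<rho> ^ n \<le> tv_dist (iterate_from kern y n) (\<mu> n)"
    proof eventually_elim
      case (elim n)
      have "(c * k) * \<rho> ^ n \<le> c * norm ((?L ^^ n) y)" using y(2)[of n] c(1) by (simp add: mult.assoc)
      with elim show ?case by linarith
    qed
    moreover have "c * k > 0" using c(1) y(1) by simp
    ultimately show ?thesis by blast
  qed
  have "(\<lambda>n. root n (tv_dist (iterate_from kern y n) \<pi>)) \<longlonglongrightarrow> \<rho>"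
  proof -
    obtain k' where "k' > 0" "\<forall>\<^sub>F n in sequentially. k' * \<rho> ^ n \<le> tv_dist (iterate_from kern y n) \<pi>"
      using low[of "\<lambda>_. \<pi>", OF p\<pi> charfun_invariant(1)[where q=q and \<pi>=\<pi>, OF gauss q0 \<pi>(1)]]
      by (elim exE conjE) (rule that)
    then show ?thesis by (intro root_tendsto[OF C\<pi>[of y] _ \<rho>0 up\<pi>])
  qed
  moreover have "\<forall>\<pi>'. invariant_law kern \<pi>' \<longrightarrow> \<pi>' = \<pi>" using invariant_unique[OF \<pi>] by blast
  moreover have "\<forall>x. limsup (\<lambda>n. ereal (root n (tv_dist (iterate_from kern x n) \<pi>))) \<le> ereal \<rho>"
    using root_limsup_le[OF C\<pi> \<rho>0 up\<pi>] by blast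
  ultimately show "\<exists>\<pi>1. invariant_law P \<pi>1 \<and> (\<forall>\<pi>. invariant_law P \<pi> \<longrightarrow> \<pi> = \<pi>1) \<and>
          (\<forall>y. limsup (\<lambda>n. ereal (root n (tv_dist (iterate_from P y n) \<pi>1))) \<le> ereal \<rho>) \<and>
          (\<exists>y. (\<lambda>n. root n (tv_dist (iterate_from P y n) \<pi>1)) \<longlonglongrightarrow> \<rho>)"
    unfolding P_def using \<pi>(1) by blast
  have "(\<lambda>n. root n (tv_dist (iterate_from kern y n) (iterate_from kern 0 n))) \<longlonglongrightarrow> \<rho>"
  proof -
    have "Im (charfun (iterate_from kern 0 n) \<xi>) = 0" for n \<xi>
    proof -
      have "(?L ^^ n) 0 = 0" by (rule linear_0[OF linear_L_pow])
      then show ?thesis unfolding charfun_iterate_from prod_charfun_noise[where q=q and \<pi>=\<pi>, OF gauss q0 \<pi>(1)]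
        by (simp del: of_real_prod)
    qed
    from low[of "iterate_from kern 0", OF iterate_from_prob this]
    obtain k' where k': "k' > 0" "\<forall>\<^sub>F n in sequentially. k' * \<rho> ^ n \<le> tv_dist (iterate_from kern y n) (iterate_from kern 0 n)"
      by (elim exE conjE) (rule that)
    have "tv_dist (iterate_from kern y n) (iterate_from kern 0 n) \<le> (C * (2 * K) * (norm y + 1)) * real n * \<rho> ^ n"
      if n: "n > 0" for n
    proof -
      have "tv_dist (iterate_from kern y n) (iterate_from kern 0 n) \<le> C * norm ((?L ^^ n) (y - 0))"
        by (rule tv_dist_le, rule iterate_from_diff[OF _ n]) (simp add: iterate_from_prob)
      also have "\<dots> \<le> C * (B n * norm y)" using C0 pow_bound[of n y] by (intro mult_left_mono) auto
      also have "\<dots> \<le> C * ((2 * K * real n * \<rho> ^ n) * (norm y + 1))"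
        using C0 K \<rho>0 up_B[OF n] by (intro mult_mono mult_left_mono) auto
      finally show ?thesis by (simp only: ac_simps)
    qed
    note up = this
    have "C * (2 * K) * (norm y + 1) > 0"
    proof (rule mult_pos_pos)
      show "0 < C * (2 * K)" using C0 K by simp
      show "0 < norm y + 1" using norm_ge_zero[of y] by linarith
    qed
    then show ?thesis by (rule root_tendsto[OF _ k'(1) \<rho>0 up k'(2)])
  qed
  then show "\<exists>y y'. (\<lambda>n. root n (tv_dist (iterate_from P y n) (iterate_from P y' n))) \<longlonglongrightarrow> \<rho>"
    unfolding P_def by (intro exI)
qed

theorem propositionA1:
  fixes \<kappa> h \<gamma> :: real
    and M :: "'w measure"
    and W :: "nat \<Rightarrow> real \<Rightarrow> 'w \<Rightarrow> real"
    and \<zeta> :: "nat \<Rightarrow> 'w \<Rightarrow> real \<times> real"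
  assumes "\<kappa> > 1" and "h > 0" and "\<gamma> > 0"
    and "left_endpoint_noise M h \<gamma> W \<zeta>"
  shows "(\<not> schur_stable (integrator_matrix h \<gamma> \<kappa>) \<longrightarrow>
      \<not> (\<exists>\<pi>. invariant_law (integrator_kernel M h \<gamma> \<zeta> (quadratic_potential \<kappa>)) \<pi>)) \<and>
    (schur_stable (integrator_matrix h \<gamma> \<kappa>) \<longrightarrow>
      (\<forall>l\<in>{1..\<kappa>}. schur_stable (integrator_matrix h \<gamma> l)) \<and>
      real_spectral_radius (integrator_matrix h \<gamma> 1) \<ge> 1 - 64 / \<kappa> \<and>
      (let P = integrator_kernel M h \<gamma> \<zeta> (quadratic_potential 1);
           \<rho> = real_spectral_radius (integrator_matrix h \<gamma> 1) in
        (\<exists>\<pi>1. invariant_law P \<pi>1 \<and> (\<forall>\<pi>. invariant_law P \<pi> \<longrightarrow> \<pi> = \<pi>1) \<and>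
          (\<forall>y. limsup (\<lambda>n. ereal (root n (tv_dist (iterate_from P y n) \<pi>1))) \<le> ereal \<rho>) \<and>
          (\<exists>y. (\<lambda>n. root n (tv_dist (iterate_from P y n) \<pi>1)) \<longlonglongrightarrow> \<rho>)) \<and>
        (\<exists>y y'. (\<lambda>n. root n (tv_dist (iterate_from P y n) (iterate_from P y' n))) \<longlonglongrightarrow> \<rho> \<and>
          \<rho> \<ge> 1 - 64 / \<kappa>)))"
proof -
  note \<kappa> = assms(1) and h = assms(2) and \<gamma> = assms(3)
  interpret left_endpoint_noise M h \<gamma> W \<zeta> by fact
  obtain Z where Z: "has_wiener_integral M (W 0) h (\<lambda>t. ((1 - exp (- \<gamma> * (h - t))) / \<gamma>, exp (- \<gamma> * (h - t)))) Z"
    "\<zeta> (Suc 0) = (\<lambda>\<omega>. sqrt (2 * \<gamma>) *\<^sub>R Z \<omega>)"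
    using noise[of 0] by blast
  have \<zeta>m: "\<zeta> 1 \<in> borel_measurable M"
    using Z unfolding has_wiener_integral_def by (auto intro!: borel_measurable_scaleR)
  obtain s1 s2 e where s: "s1 > 0" "s2 > 0" and \<nu>: "distr M borel (\<zeta> 1) = planar_gaussian s1 s2 e"
    using noise_law_planar_gaussian[OF prob_space_axioms h \<gamma> brownian Z] by auto
  define a b c d where "a l = 1 - (\<gamma> * h + exp (- \<gamma> * h) - 1) / \<gamma>\<^sup>2 * l" and "b = (1 - exp (- \<gamma> * h)) / \<gamma>"
    and "c l = - ((1 - exp (- \<gamma> * h)) / \<gamma>) * l" and "d = exp (- \<gamma> * h)" for l
  have kernel: "integrator_kernel M h \<gamma> \<zeta> (quadratic_potential l) =
      linear_chain.kern (planar_map (a l) b (c l) d) (planar_gaussian s1 s2 e)" for l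
    by (rule ext, rule integrator_kernel_quadratic[where \<zeta>=\<zeta> and M=M, OF \<zeta>m \<nu>]) (simp_all only: a_def b_def c_def d_def)
  have b: "b > 0" unfolding b_def using beta_bounds[OF h \<gamma>] \<gamma> by simp
  have tr: "drift_trace h \<gamma> l = a l + d" for l by (simp add: drift_trace_def a_def d_def)
  have dt: "drift_det h \<gamma> l = a l * d - b * c l" for l
  proof -
    define u where "u = l / \<gamma>\<^sup>2"
    have eqs: "b * c l = - (u * ((1 - d) * (1 - d)))" "a l = 1 - u * (\<gamma> * h + d - 1)"
      "drift_det h \<gamma> l = d + u * (1 - d - \<gamma> * h * d)"
      unfolding a_def b_def c_def drift_det_def d_def u_def by (simp_all add: power2_eq_square)
    show ?thesis unfolding eqs by (simp add: algebra_simps)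
  qed
  show ?thesis
  proof (intro conjI impI)
    assume ns: "\<not> schur_stable (integrator_matrix h \<gamma> \<kappa>)"
    obtain z w where rp: "root_pair (drift_trace h \<gamma> \<kappa>) (drift_det h \<gamma> \<kappa>) z w"
      and radius: "real_spectral_radius (integrator_matrix h \<gamma> \<kappa>) = max (cmod z) (cmod w)"
      by (rule integrator_matrix_roots[OF \<gamma>])
    have zw: "z + w = of_real (a \<kappa> + d)" "z * w = of_real (a \<kappa> * d - b * c \<kappa>)"
      using rp unfolding root_pair_def tr dt by blast+
    have "1 \<le> max (cmod z) (cmod w)" using ns unfolding schur_stable_def radius not_less .
    then show "\<not> (\<exists>\<pi>. invariant_law (integrator_kernel M h \<gamma> \<zeta> (quadratic_potential \<kappa>)) \<pi>)"
      unfolding kernel by (rule no_invariant_law_planar[OF s b zw])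
  next
    assume st: "schur_stable (integrator_matrix h \<gamma> \<kappa>)"
    show all: "\<forall>l\<in>{1..\<kappa>}. schur_stable (integrator_matrix h \<gamma> l)"
      using schur_stable_mono[OF h \<gamma> st] by auto
    show low: "real_spectral_radius (integrator_matrix h \<gamma> 1) \<ge> 1 - 64 / \<kappa>"
      by (rule spectral_radius_lower[OF h \<gamma> \<kappa> st])
    obtain z w where rp: "root_pair (drift_trace h \<gamma> 1) (drift_det h \<gamma> 1) z w"
      and radius: "real_spectral_radius (integrator_matrix h \<gamma> 1) = max (cmod z) (cmod w)"
      by (rule integrator_matrix_roots[OF \<gamma>])
    have zw: "z + w = of_real (a 1 + d)" "z * w = of_real (a 1 * d - b * c 1)"
      using rp unfolding root_pair_def tr dt by blast+
    have less: "real_spectral_radius (integrator_matrix h \<gamma> 1) < 1"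
      using all \<kappa> by (simp add: schur_stable_def)
    have det: "a 1 * d - b * c 1 \<noteq> 0"
      unfolding dt[symmetric] using drift_det_pos[OF h \<gamma>, of 1] by simp
    note rates = stable_rates[where e=e, OF s b det zw radius less, folded kernel[of 1]]
    show "let P = integrator_kernel M h \<gamma> \<zeta> (quadratic_potential 1);
           \<rho> = real_spectral_radius (integrator_matrix h \<gamma> 1) in
        (\<exists>\<pi>1. invariant_law P \<pi>1 \<and> (\<forall>\<pi>. invariant_law P \<pi> \<longrightarrow> \<pi> = \<pi>1) \<and>
          (\<forall>y. limsup (\<lambda>n. ereal (root n (tv_dist (iterate_from P y n) \<pi>1))) \<le> ereal \<rho>) \<and>
          (\<exists>y. (\<lambda>n. root n (tv_dist (iterate_from P y n) \<pi>1)) \<longlonglongrightarrow> \<rho>)) \<and>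
        (\<exists>y y'. (\<lambda>n. root n (tv_dist (iterate_from P y n) (iterate_from P y' n))) \<longlonglongrightarrow> \<rho> \<and>
          \<rho> \<ge> 1 - 64 / \<kappa>)"
      unfolding Let_def
    proof (rule conjI[OF rates(1)])
      from rates(2) obtain y y' where "(\<lambda>n. root n (tv_dist
          (iterate_from (integrator_kernel M h \<gamma> \<zeta> (quadratic_potential 1)) y n)
          (iterate_from (integrator_kernel M h \<gamma> \<zeta> (quadratic_potential 1)) y' n)))
          \<longlonglongrightarrow> real_spectral_radius (integrator_matrix h \<gamma> 1)"
        by (elim exE) (rule that)
      with low show "\<exists>y y'. (\<lambda>n. root n (tv_dist
          (iterate_from (integrator_kernel M h \<gamma> \<zeta> (quadratic_potential 1)) y n)
          (iterate_from (integrator_kernel M h \<gamma> \<zeta> (quadratic_potential 1)) y' n)))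
          \<longlonglongrightarrow> real_spectral_radius (integrator_matrix h \<gamma> 1)
          \<and> 1 - 64 / \<kappa> \<le> real_spectral_radius (integrator_matrix h \<gamma> 1)"
        by (intro exI conjI)
    qed
  qed
qed

end
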